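(* Let $D$ be an Eulerian digraph, and let $M$ be the oriented graphic matroid associated to $D$. Let $A$ be a totally unimodular matrix representing $M^*$, the oriented dual of $M$, and let $m$ be the size of a basis of $M^*$. Then $$P_D(t)=\sum_{H \text{ has property } *} \mathrm{Vol}(Q_H)\,(t-1)^{\#\mathrm{col}(H)-m},$$ where a matrix $H$ has property $*$ if it is obtained by deleting a set of columns from $A$ without decreasing the rank of the matrix, and $\#\mathrm{col}(H)$ is the number of columns of $H$.
   Context: A digraph (finite, multiple edges allowed) is Eulerian if it is connected and $\mathrm{indeg}(v)=\mathrm{outdeg}(v)$ at every vertex $v$. An oriented spanning tree of $D$ rooted at $r\in V(D)$ is a spanning tree in which every vertex has a unique directed path to $r$. A $k$-spanning tree rooted at $r$ is a spanning tree of $D$ such that reversing the orientation of exactly $k$ of its edges yields an oriented spanning tree rooted at $r$. Let $c_k(D,r)$ be the number of $k$-spanning trees of $D$ rooted at $r$; for Eulerian $D$ this is independent of $r$, and $P_D(t)=\sum_{k\ge 0} c_k(D,r)t^k$ for any $r\in V(D)$. A matrix is totally unimodular if all its subdeterminants lie in $\{0,1,-1\}$. A totally unimodular matrix with columns $a_1,\dots,a_N$ represents a regular oriented matroid on its columns: for each circuit $C=\{i_1,\dots,i_j\}$ with linear dependence $\sum_k \lambda_k a_{i_k}=0$, put $C^+=\{i_k:\lambda_k>0\}$, $C^-=\{i_k:\lambda_k<0\}$ (defined up to exchanging $C^+$ and $C^-$). The oriented graphic matroid of $D$ is the one represented by the signed vertex-edge incidence matrix of $D$. The oriented dual $M^*$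 of a regular oriented matroid $M$ is the unique oriented matroid structure on the dual matroid such that, for every signed circuit $C_1$ of $M$ and $C_2$ of $M^*$, either $C_1\cap C_2=\emptyset$ or both $(C_1^+\cap C_2^+)\cup(C_1^-\cap C_2^-)$ and $(C_1^+\cap C_2^-)\cup(C_1^-\cap C_2^+)$ are nonempty. For a totally unimodular matrix $H$ with columns $a_1,\dots,a_p$, the root polytope is $Q_H=\mathrm{conv}(a_1,\dots,a_p)$. $\mathrm{Vol}$ is normalized volume, for which each simplex $\mathrm{conv}(a_i : i\in B)$, with $B$ a basis of the matroid represented by $H$, has volume $1$. The sum is over subsets of columns of $A$ whose deletion does not decrease the rank (columns are labeled by the edges of $D$, so different subsets give different summands; the empty subset is allowed). *)

theory Defs
  imports
    "HOL-Analysis.Analysis"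
    "HOL-Computational_Algebra.Polynomial"
    "Jordan_Normal_Form.Determinant"
    "Graph_Theory.Digraph_Component"
begin

section \<open>Eulerian digraphs and \<open>k\<close>-spanning trees\<close>

text \<open>The library predicate \<open>Digraph_Component.connected\<close> refers to the underlying undirected
  graph and includes that there is at least one vertex. Parallel arcs and loops are allowed.\<close>

definition eulerian :: "('v, 'e) pre_digraph \<Rightarrow> bool" where
  "eulerian D \<longleftrightarrow> fin_digraph D \<and> Digraph_Component.connected D \<and>
     (\<forall>v\<in>verts D. in_degree D v = out_degree D v)"

definition reverse_arcs :: "'e set \<Rightarrow> ('v, 'e) pre_digraph \<Rightarrow> ('v, 'e) pre_digraph" where
  "reverse_arcs S G = G\<lparr>tail := (\<lambda>e. if e \<in> S then head G e else tail G e),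
                        head := (\<lambda>e. if e \<in> S then tail G e else head G e)\<rparr>"

text \<open>The library predicate \<open>forest\<close> only excludes directed cycles (and the library's \<open>tree\<close>
  inherits this). A cycle of the underlying undirected multigraph is a directed cycle for a
  suitable orientation of the arcs, hence the quantification over all reorientations.\<close>

definition undirected_tree :: "('v, 'e) pre_digraph \<Rightarrow> bool" where
  "undirected_tree T \<longleftrightarrow>
     Digraph_Component.connected T \<and> (\<forall>S\<subseteq>arcs T. forest (reverse_arcs S T))"

definition oriented_tree :: "('v, 'e) pre_digraph \<Rightarrow> 'v \<Rightarrow> bool" where
  "oriented_tree T r \<longleftrightarrow> undirected_tree T \<and> r \<in> verts T \<and>
     (\<forall>v\<in>verts T. \<exists>!p. pre_digraph.apath T v p r)"

definition k_spanning_tree ::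
  "('v, 'e) pre_digraph \<Rightarrow> 'v \<Rightarrow> nat \<Rightarrow> ('v, 'e) pre_digraph \<Rightarrow> bool" where
  "k_spanning_tree D r k T \<longleftrightarrow> spanning T D \<and> undirected_tree T \<and>
     (\<exists>S\<subseteq>arcs T. card S = k \<and> oriented_tree (reverse_arcs S T) r)"

definition num_k_spanning_trees :: "('v, 'e) pre_digraph \<Rightarrow> 'v \<Rightarrow> nat \<Rightarrow> nat" where
  "num_k_spanning_trees D r k = card {T. k_spanning_tree D r k T}"

text \<open>No \<open>k\<close>-spanning tree exists for \<open>k > card (arcs D)\<close>, so that the sum may be truncated.\<close>

definition tree_poly :: "('v, 'e) pre_digraph \<Rightarrow> 'v \<Rightarrow> real poly" where
  "tree_poly D r = (\<Sum>k\<le>card (arcs D). monom (real (num_k_spanning_trees D r k)) k)"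


section \<open>Matrices and oriented matroids\<close>

text \<open>A matrix is given by its entries \<open>M i e\<close>, where \<open>i\<close> ranges over the set \<open>R\<close> of row labels
  and \<open>e\<close> over the set \<open>E\<close> of column labels. Distinct labels may carry equal columns.\<close>

definition totally_unimodular :: "'i set \<Rightarrow> 'e set \<Rightarrow> ('i \<Rightarrow> 'e \<Rightarrow> real) \<Rightarrow> bool" where
  "totally_unimodular R E M \<longleftrightarrow>
     (\<forall>rs cs. distinct rs \<and> set rs \<subseteq> R \<and> distinct cs \<and> set cs \<subseteq> E \<and> length rs = length cs \<longrightarrow>
        Determinant.det (Matrix.mat (length rs) (length cs) (\<lambda>(i, j). M (rs ! i) (cs ! j)))
          \<in> {0, 1, -1})"

definition lin_dependence ::
  "'i set \<Rightarrow> ('i \<Rightarrow> 'e \<Rightarrow> real) \<Rightarrow> 'e set \<Rightarrow> ('e \<Rightarrow> real) \<Rightarrow> bool" where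
  "lin_dependence R M C l \<longleftrightarrow> (\<exists>e\<in>C. l e \<noteq> 0) \<and> (\<forall>i\<in>R. (\<Sum>e\<in>C. l e * M i e) = 0)"

definition circuit :: "'i set \<Rightarrow> 'e set \<Rightarrow> ('i \<Rightarrow> 'e \<Rightarrow> real) \<Rightarrow> 'e set \<Rightarrow> bool" where
  "circuit R E M C \<longleftrightarrow> C \<subseteq> E \<and> (\<exists>l. lin_dependence R M C l) \<and>
     (\<forall>C'. C' \<subset> C \<longrightarrow> \<not> (\<exists>l. lin_dependence R M C' l))"

text \<open>An oriented matroid on \<open>E\<close> is represented by its set of signed circuits \<open>(C\<^sup>+, C\<^sup>-)\<close>;
  this set contains \<open>(C\<^sup>-, C\<^sup>+)\<close> together with \<open>(C\<^sup>+, C\<^sup>-)\<close>.\<close>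

definition signed_circuits ::
  "'i set \<Rightarrow> 'e set \<Rightarrow> ('i \<Rightarrow> 'e \<Rightarrow> real) \<Rightarrow> ('e set \<times> 'e set) set" where
  "signed_circuits R E M =
     {({e\<in>C. l e > 0}, {e\<in>C. l e < 0}) | C l. circuit R E M C \<and> lin_dependence R M C l}"

definition incidence :: "('v, 'e) pre_digraph \<Rightarrow> 'v \<Rightarrow> 'e \<Rightarrow> real" where
  "incidence D v e = of_bool (head D e = v) - of_bool (tail D e = v)"

definition graphic_circuits :: "('v, 'e) pre_digraph \<Rightarrow> ('e set \<times> 'e set) set" where
  "graphic_circuits D = signed_circuits (verts D) (arcs D) (incidence D)"

definition oriented_matroid :: "'e set \<Rightarrow> ('e set \<times> 'e set) set \<Rightarrow> bool" where
  "oriented_matroid E \<C> \<longleftrightarrow>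
     (\<forall>(P, N)\<in>\<C>. P \<union> N \<subseteq> E \<and> P \<inter> N = {} \<and> P \<union> N \<noteq> {} \<and> (N, P) \<in> \<C>) \<and>
     (\<forall>(P, N)\<in>\<C>. \<forall>(P', N')\<in>\<C>. P \<union> N \<subseteq> P' \<union> N' \<longrightarrow>
        (P, N) = (P', N') \<or> (P, N) = (N', P')) \<and>
     (\<forall>(P, N)\<in>\<C>. \<forall>(P', N')\<in>\<C>. (P, N) \<noteq> (N', P') \<longrightarrow>
        (\<forall>e\<in>P \<inter> N'. \<exists>(P'', N'')\<in>\<C>. P'' \<subseteq> P \<union> P' - {e} \<and> N'' \<subseteq> N \<union> N' - {e}))"

definition matroid_indep :: "'e set \<Rightarrow> ('e set \<times> 'e set) set \<Rightarrow> 'e set \<Rightarrow> bool" where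
  "matroid_indep E \<C> B \<longleftrightarrow> B \<subseteq> E \<and> (\<forall>(P, N)\<in>\<C>. \<not> P \<union> N \<subseteq> B)"

definition matroid_bases :: "'e set \<Rightarrow> ('e set \<times> 'e set) set \<Rightarrow> 'e set set" where
  "matroid_bases E \<C> =
     {B. matroid_indep E \<C> B \<and> (\<forall>B'. B \<subset> B' \<longrightarrow> \<not> matroid_indep E \<C> B')}"

definition orthogonal_signed :: "'e set \<times> 'e set \<Rightarrow> 'e set \<times> 'e set \<Rightarrow> bool" where
  "orthogonal_signed = (\<lambda>(P\<^sub>1, N\<^sub>1) (P\<^sub>2, N\<^sub>2).
     (P\<^sub>1 \<union> N\<^sub>1) \<inter> (P\<^sub>2 \<union> N\<^sub>2) = {} \<or>
     (P\<^sub>1 \<inter> P\<^sub>2) \<union> (N\<^sub>1 \<inter> N\<^sub>2) \<noteq> {} \<and> (P\<^sub>1 \<inter> N\<^sub>2) \<union> (N\<^sub>1 \<inter> P\<^sub>2) \<noteq> {})"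

text \<open>\<open>\<D>\<close> is the oriented matroid structure on the dual of the matroid underlying \<open>\<C>\<close> (the one
  whose bases are the complements of bases) singled out by orthogonality.\<close>

definition is_oriented_dual ::
  "'e set \<Rightarrow> ('e set \<times> 'e set) set \<Rightarrow> ('e set \<times> 'e set) set \<Rightarrow> bool" where
  "is_oriented_dual E \<C> \<D> \<longleftrightarrow> oriented_matroid E \<D> \<and>
     matroid_bases E \<D> = (\<lambda>B. E - B) ` matroid_bases E \<C> \<and>
     (\<forall>C\<^sub>1\<in>\<C>. \<forall>C\<^sub>2\<in>\<D>. orthogonal_signed C\<^sub>1 C\<^sub>2)"


section \<open>Root polytopes and normalized volume\<close>

text \<open>From here on the rows are labelled by a finite type, and the matrix obtained from \<open>A\<close> by
  deleting columns is given by the set \<open>F\<close> of labels of the remaining columns.\<close>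

definition column_vec :: "('n::finite \<Rightarrow> 'e \<Rightarrow> real) \<Rightarrow> 'e \<Rightarrow> real ^ 'n" where
  "column_vec A e = (\<chi> i. A i e)"

definition column_rank :: "('n::finite \<Rightarrow> 'e \<Rightarrow> real) \<Rightarrow> 'e set \<Rightarrow> nat" where
  "column_rank A F = dim (column_vec A ` F)"

definition root_polytope :: "('n::finite \<Rightarrow> 'e \<Rightarrow> real) \<Rightarrow> 'e set \<Rightarrow> (real ^ 'n) set" where
  "root_polytope A F = convex hull (column_vec A ` F)"

text \<open>Lebesgue measure on the affine hull of the simplex with vertices \<open>a e\<close> for \<open>e \<in> B\<close>, taken
  in the affine coordinates with origin \<open>a b\<close> and axes \<open>a e - a b\<close>.\<close>

definition chart_volume ::
  "('e \<Rightarrow> real ^ 'n) \<Rightarrow> 'e set \<Rightarrow> 'e \<Rightarrow> (real ^ 'n) set \<Rightarrow> real" where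
  "chart_volume a B b X =
     measure (Pi\<^sub>M (B - {b}) (\<lambda>_. lborel))
       {x \<in> space (Pi\<^sub>M (B - {b}) (\<lambda>_. lborel)).
          a b + (\<Sum>e\<in>B - {b}. x e *\<^sub>R (a e - a b)) \<in> X}"

text \<open>\<open>\<B>\<close> is the collection of label sets of the simplices that have volume 1. If the matroid has
  rank 0, then its only basis is \<open>{}\<close>, and the normalization gives the empty simplex volume 1.\<close>

definition normalized_volume ::
  "('e \<Rightarrow> real ^ 'n) \<Rightarrow> 'e set set \<Rightarrow> (real ^ 'n) set \<Rightarrow> real" where
  "normalized_volume a \<B> X =
     (if {} \<in> \<B> then 1
      else (THE v. \<forall>B\<in>\<B>. \<forall>b\<in>B.
              chart_volume a B b X = v * chart_volume a B b (convex hull (a ` B))))"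

definition Vol :: "('n::finite \<Rightarrow> 'e \<Rightarrow> real) \<Rightarrow> 'e set \<Rightarrow> real" where
  "Vol A F = normalized_volume (column_vec A) (matroid_bases F (signed_circuits UNIV F A))
     (root_polytope A F)"

definition property_star :: "('n::finite \<Rightarrow> 'e \<Rightarrow> real) \<Rightarrow> 'e set \<Rightarrow> 'e set \<Rightarrow> bool" where
  "property_star A E F \<longleftrightarrow> F \<subseteq> E \<and> column_rank A F = column_rank A E"

end

theory Submission
  imports Defs
begin

text \<open>
  For a spanning tree \<open>T\<close> let \<open>away T\<close> be the set of its arcs that point away from the root \<open>r\<close>. These
  are exactly the arcs that must be reversed to orient \<open>T\<close> towards \<open>r\<close>, so \<open>P\<^sub>D(t)\<close> is the sum of
  \<open>t ^ card (away T)\<close> over all spanning trees (\<open>tree_poly_eq_sum_away_arcs\<close>). Expanding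
  \<open>t = (t - 1) + 1\<close> turns each term into the sum of \<open>(t - 1) ^ card S\<close> over all \<open>S \<subseteq> away T\<close>. The set
  \<open>F = (E - T) \<union> S\<close>, where \<open>E\<close> is the set of arcs, contains the basis \<open>E - T\<close> of the dual and exceeds it
  by \<open>card S\<close> elements. Collecting the terms by \<open>F\<close>, the theorem says that the normalized volume of the
  root polytope of \<open>F\<close> is the number of spanning trees \<open>T\<close> with \<open>E - T \<subseteq> F\<close> and \<open>F \<inter> T \<subseteq> away T\<close>
  (\<open>Vol_eq_card_compatible_trees\<close>).

  This is proved by dissecting the polytope into simplices of bases. Assign a cost \<open>w e\<close> to every
  column. A generic point of the polytope has a unique cheapest representation as a convex combination
  of columns; it is supported on a basis, and the bases that occur are those for which all reduced
  costs are positive (\<open>chart_root_polytope\<close>). Total unimodularity makes all simplices of bases equally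
  large (\<open>chart_independent_of_basis\<close>). Lebesgue measure in an affine chart is preserved by a
  reflection and shear in one coordinate, which is what a basis exchange amounts to.

  Duality enters through one fact (\<open>fundamental_circuit_eq_cut\<close>): for a spanning tree \<open>T\<close> and \<open>e \<in> T\<close>,
  the coefficients of column \<open>e\<close> in the basis \<open>E - T\<close> are read off from the fundamental cut of \<open>e\<close>. It has
  two consequences. As the all-one vector is a circulation of an Eulerian digraph, it is orthogonal to
  all cuts, and hence the columns lie on an affine hyperplane that avoids the origin
  (\<open>columns_at_height_one\<close>). And the reduced cost of \<open>e\<close> is the net flow of \<open>w\<close> through its fundamental
  cut. For \<open>w\<close> take a flow that sends one unit from the root to every vertex: then the reduced cost of
  \<open>e\<close> is positive if \<open>e\<close> points away from the root and negative otherwise (\<open>reduced_cost_root_flow\<close>). The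
  same cost serves for all \<open>F\<close> at once.
\<close>

section \<open>Bases and fundamental circuits of a labelled matrix\<close>

lemma lin_dependence_mono:
  assumes "lin_dependence R M C l" "C \<subseteq> C'" "finite C'"
  shows "lin_dependence R M C' (\<lambda>e. if e \<in> C then l e else 0)"
proof -
  have "(\<Sum>e\<in>C'. (if e \<in> C then l e else 0) * M i e) = (\<Sum>e\<in>C. l e * M i e)" for i
    using assms(2,3) by (intro sum.mono_neutral_cong_right) auto
  then show ?thesis
    using assms unfolding lin_dependence_def by auto
qed

lemma lin_dependence_drop_zeros:
  assumes "lin_dependence R M C l" "finite C" "\<And>e. e \<in> C - C' \<Longrightarrow> l e = 0" "C' \<subseteq> C"
  shows "lin_dependence R M C' l"
proof -
  have "(\<Sum>e\<in>C. l e * M i e) = (\<Sum>e\<in>C'. l e * M i e)" for i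
    using assms(2-4) by (intro sum.mono_neutral_right) auto
  then show ?thesis
    using assms unfolding lin_dependence_def by auto
qed

lemma dependent_contains_circuit:
  assumes "lin_dependence R M C l" "finite C" "C \<subseteq> E"
  shows "\<exists>C'\<subseteq>C. circuit R E M C'"
  using assms
proof (induction "card C" arbitrary: C l rule: less_induct)
  case less
  show ?case
  proof (cases "\<exists>C' l'. C' \<subset> C \<and> lin_dependence R M C' l'")
    case True
    then obtain C' l' where C': "C' \<subset> C" "lin_dependence R M C' l'" by blast
    have "card C' < card C" "finite C'" "C' \<subseteq> E"
      using C'(1) less.prems by (auto simp: psubset_card_mono intro: finite_subset)
    from less.hyps[OF this(1) C'(2) this(2,3)] C'(1) show ?thesis by blast
  next
    case False
    then have "circuit R E M C"
      using less.prems unfolding circuit_def by blast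
    then show ?thesis by blast
  qed
qed

lemma circuit_coeff_nonzero:
  assumes "circuit R E M C" "lin_dependence R M C l" "finite C" "e \<in> C"
  shows "l e \<noteq> 0"
proof
  assume "l e = 0"
  then have "lin_dependence R M (C - {e}) l"
    using assms by (intro lin_dependence_drop_zeros[OF assms(2,3)]) auto
  with assms show False unfolding circuit_def by blast
qed

lemma matroid_indep_iff:
  assumes "finite E"
  shows "matroid_indep E (signed_circuits R E M) B \<longleftrightarrow>
    B \<subseteq> E \<and> (\<forall>l. \<not> lin_dependence R M B l)"
proof
  assume L: "matroid_indep E (signed_circuits R E M) B"
  have "\<not> lin_dependence R M B l" for l
  proof
    assume dep: "lin_dependence R M B l"
    have B: "B \<subseteq> E" "finite B"
      using L assms by (auto simp: matroid_indep_def intro: finite_subset)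
    obtain C where C: "C \<subseteq> B" "circuit R E M C"
      using dependent_contains_circuit[OF dep B(2,1)] by blast
    then obtain l' where l': "lin_dependence R M C l'"
      unfolding circuit_def by blast
    then have "({e\<in>C. l' e > 0}, {e\<in>C. l' e < 0}) \<in> signed_circuits R E M"
      using C unfolding signed_circuits_def by blast
    then show False
      using L C(1) unfolding matroid_indep_def by fastforce
  qed
  then show "B \<subseteq> E \<and> (\<forall>l. \<not> lin_dependence R M B l)"
    using L by (auto simp: matroid_indep_def)
next
  assume Rt: "B \<subseteq> E \<and> (\<forall>l. \<not> lin_dependence R M B l)"
  have "\<not> P \<union> N \<subseteq> B" if PN: "(P, N) \<in> signed_circuits R E M" for P N
  proof
    assume sub: "P \<union> N \<subseteq> B"
    obtain C l where C: "P = {e\<in>C. l e > 0}" "N = {e\<in>C. l e < 0}"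
      "circuit R E M C" "lin_dependence R M C l"
      using PN unfolding signed_circuits_def by blast
    have fin: "finite C" using C(3) assms unfolding circuit_def by (auto intro: finite_subset)
    have "e \<in> P \<union> N" if "e \<in> C" for e
      using circuit_coeff_nonzero[OF C(3,4) fin that] that C(1,2) by auto
    with sub have "C \<subseteq> B" by blast
    then have "lin_dependence R M B (\<lambda>e. if e \<in> C then l e else 0)"
      using lin_dependence_mono[OF C(4)] Rt assms by (meson finite_subset)
    with Rt show False by blast
  qed
  then show "matroid_indep E (signed_circuits R E M) B"
    using Rt unfolding matroid_indep_def by blast
qed

lemma matroid_bases_iff:
  assumes "finite E"
  shows "B \<in> matroid_bases E (signed_circuits R E M) \<longleftrightarrow>
    B \<subseteq> E \<and> (\<forall>l. \<not> lin_dependence R M B l) \<and>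
    (\<forall>e\<in>E - B. \<exists>l. lin_dependence R M (insert e B) l)"
proof -
  have "(\<forall>B'. B \<subset> B' \<longrightarrow> B' \<subseteq> E \<longrightarrow> (\<exists>l. lin_dependence R M B' l)) \<longleftrightarrow>
        (\<forall>e\<in>E - B. \<exists>l. lin_dependence R M (insert e B) l)" if "B \<subseteq> E"
  proof (intro iffI ballI allI impI)
    fix e assume "\<forall>B'. B \<subset> B' \<longrightarrow> B' \<subseteq> E \<longrightarrow> (\<exists>l. lin_dependence R M B' l)" "e \<in> E - B"
    then show "\<exists>l. lin_dependence R M (insert e B) l"
      using that by (metis DiffD1 DiffD2 insertI1 insert_subset psubsetI subset_insertI)
  next
    fix B' assume *: "\<forall>e\<in>E - B. \<exists>l. lin_dependence R M (insert e B) l" "B \<subset> B'" "B' \<subseteq> E"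
    then obtain e where e: "e \<in> B' - B" by blast
    then obtain l where "lin_dependence R M (insert e B) l" using * by blast
    moreover have "insert e B \<subseteq> B'" "finite B'"
      using e * assms by (auto intro: finite_subset)
    ultimately show "\<exists>l. lin_dependence R M B' l"
      using lin_dependence_mono by blast
  qed
  then show ?thesis
    unfolding matroid_bases_def by (auto simp: matroid_indep_iff[OF assms])
qed

text \<open>Normalizing the dependence at \<open>e\<close> makes it unique, which is why its support is minimal.\<close>

lemma fundamental_circuit:
  assumes fin: "finite E" and B: "B \<in> matroid_bases E (signed_circuits R E M)" and e: "e \<in> E - B"
  shows "\<exists>l. l e = 1 \<and> (\<forall>g. g \<notin> insert e B \<longrightarrow> l g = 0) \<and>
    (\<forall>i\<in>R. (\<Sum>g\<in>E. l g * M i g) = 0) \<and>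
    ({g. l g > 0}, {g. l g < 0}) \<in> signed_circuits R E M"
proof -
  have BE: "B \<subseteq> E" and ind: "\<And>l. \<not> lin_dependence R M B l" and finB: "finite B"
    using B fin by (auto simp: matroid_bases_iff[OF fin] intro: finite_subset)
  obtain l0 where l0: "lin_dependence R M (insert e B) l0"
    using B e unfolding matroid_bases_iff[OF fin] by blast
  have nz: "l e \<noteq> 0" if "lin_dependence R M (insert e B) l" for l
  proof
    assume "l e = 0"
    then have "lin_dependence R M B l"
      using finB e by (intro lin_dependence_drop_zeros[OF that]) auto
    then show False using ind by blast
  qed
  define l where "l = (\<lambda>g. if g \<in> insert e B then l0 g / l0 e else 0)"
  have le: "l e = 1" using nz[OF l0] by (simp add: l_def)
  have sumB: "(\<Sum>g\<in>insert e B. l g * M i g) = 0" if "i \<in> R" for i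
  proof -
    have "(\<Sum>g\<in>insert e B. l g * M i g) = (\<Sum>g\<in>insert e B. l0 g * M i g) / l0 e"
      unfolding sum_divide_distrib by (intro sum.cong) (auto simp: l_def)
    then show ?thesis using l0 that by (auto simp: lin_dependence_def)
  qed
  have sumE: "(\<Sum>g\<in>E. l g * M i g) = 0" if "i \<in> R" for i
  proof -
    have "(\<Sum>g\<in>E. l g * M i g) = (\<Sum>g\<in>insert e B. l g * M i g)"
      using BE e fin by (intro sum.mono_neutral_right) (auto simp: l_def)
    then show ?thesis using sumB[OF that] by simp
  qed
  define C where "C = {g. l g \<noteq> 0}"
  have CB: "C \<subseteq> insert e B" by (auto simp: C_def l_def)
  then have CE: "C \<subseteq> E" and finC: "finite C"
    using BE e finB by (auto intro: finite_subset)
  have eC: "e \<in> C" by (simp add: C_def le)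
  have depC: "lin_dependence R M C l"
    using CB finB eC le sumB
    by (intro lin_dependence_drop_zeros[of R M "insert e B" l C]) (auto simp: C_def lin_dependence_def)
  have "\<not> lin_dependence R M C' k" if C': "C' \<subset> C" for C' k
  proof
    assume k: "lin_dependence R M C' k"
    have C'B: "C' \<subseteq> insert e B" and finC': "finite C'" using C' CB finC by (auto intro: finite_subset)
    obtain c where c: "c \<in> C" "c \<notin> C'" using C' by blast
    define k' where "k' = (\<lambda>g. if g \<in> C' then k g else 0)"
    have k': "lin_dependence R M (insert e B) k'"
      unfolding k'_def using lin_dependence_mono[OF k C'B] finB by simp
    have k'e: "k' e \<noteq> 0" by (rule nz[OF k'])
    define d where "d = (\<lambda>g. k' g - k' e * l g)"
    have "d c \<noteq> 0" using c k'e by (auto simp: d_def k'_def C_def)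
    moreover have "d e = 0" by (simp add: d_def le)
    moreover have "(\<Sum>g\<in>insert e B. d g * M i g) = 0" if "i \<in> R" for i
    proof -
      have "(\<Sum>g\<in>insert e B. d g * M i g) =
        (\<Sum>g\<in>insert e B. k' g * M i g) - k' e * (\<Sum>g\<in>insert e B. l g * M i g)"
        unfolding d_def left_diff_distrib sum_subtractf sum_distrib_left
        by (simp add: mult.assoc)
      then show ?thesis using k' sumB[OF that] that by (auto simp: lin_dependence_def)
    qed
    ultimately have "lin_dependence R M (insert e B) d"
      using c CB unfolding lin_dependence_def by blast
    with nz \<open>d e = 0\<close> show False by blast
  qed
  then have "circuit R E M C" using CE depC unfolding circuit_def by blast
  moreover have "{g. l g > 0} = {g\<in>C. l g > 0}" "{g. l g < 0} = {g\<in>C. l g < 0}"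
    by (auto simp: C_def)
  ultimately have "({g. l g > 0}, {g. l g < 0}) \<in> signed_circuits R E M"
    unfolding signed_circuits_def using depC by auto
  moreover have "\<forall>g. g \<notin> insert e B \<longrightarrow> l g = 0" by (simp add: l_def)
  ultimately show ?thesis using le sumE by blast
qed

section \<open>Dependences in totally unimodular matrices\<close>

text \<open>A nonzero minor of maximal size cannot use all columns of a dependent set \<open>C\<close>. Bordering it with a
  further column of \<open>C\<close> and an arbitrary row gives a vanishing determinant, and the Laplace expansion
  along that row is a dependence whose coefficients are minors.\<close>

lemma totally_unimodular_dependence:
  assumes tu: "totally_unimodular R E M" and fin: "finite C" and CE: "C \<subseteq> E"
    and dep: "lin_dependence R M C l"
  shows "\<exists>l'. lin_dependence R M C l' \<and> (\<forall>e. l' e \<in> {0, 1, -1})"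
proof -
  define minor where "minor = (\<lambda>rs cs.
    Determinant.det (Matrix.mat (length rs) (length cs) (\<lambda>(i, j). M (rs ! i) (cs ! j))))"
  define good where "good = (\<lambda>k. \<exists>rs cs. distinct rs \<and> set rs \<subseteq> R \<and> distinct cs \<and> set cs \<subseteq> C \<and>
    length rs = k \<and> length cs = k \<and> minor rs cs \<noteq> 0)"
  have good0: "good 0"
    unfolding good_def minor_def by (intro exI[of _ "[]"]) auto
  have bound: "k \<le> card C" if "good k" for k
    using that fin unfolding good_def by (metis card_mono distinct_card)
  obtain k where k: "good k" and kmax: "\<And>k'. good k' \<Longrightarrow> k' \<le> k"
    using good0 bound by (metis Greatest_le_nat GreatestI_nat)
  obtain rs cs where rs: "distinct rs" "set rs \<subseteq> R" and cs: "distinct cs" "set cs \<subseteq> C"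
    and len: "length rs = k" "length cs = k" and nz: "minor rs cs \<noteq> 0"
    using k unfolding good_def by blast
  have "set cs \<noteq> C"
  proof
    assume eq: "set cs = C"
    define A where "A = Matrix.mat k k (\<lambda>(i, j). M (rs ! i) (cs ! j))"
    define v where "v = Matrix.vec k (\<lambda>j. l (cs ! j))"
    obtain e where "e \<in> C" "l e \<noteq> 0" using dep by (auto simp: lin_dependence_def)
    then obtain j where j: "j < k" "l (cs ! j) \<noteq> 0"
      using eq len by (metis in_set_conv_nth)
    have "v \<noteq> 0\<^sub>v k"
      using j by (metis index_vec index_zero_vec(1) v_def)
    moreover have "v \<in> carrier_vec k" by (simp add: v_def)
    moreover have "A *\<^sub>v v = 0\<^sub>v k"
    proof (rule eq_vecI)
      show "dim_vec (A *\<^sub>v v) = dim_vec (0\<^sub>v k)" by (simp add: A_def)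
      fix i assume "i < dim_vec (0\<^sub>v k :: real Matrix.vec)"
      then have i: "i < k" by simp
      have "vec_index (A *\<^sub>v v) i = (\<Sum>j = 0..<k. M (rs ! i) (cs ! j) * l (cs ! j))"
        using i by (simp add: A_def v_def scalar_prod_def)
      also have "\<dots> = (\<Sum>e\<in>set cs. M (rs ! i) e * l e)"
        using sum.reindex_bij_betw[OF bij_betw_nth[OF cs(1) refl refl], of "\<lambda>e. M (rs ! i) e * l e"]
          len by (simp add: atLeast0LessThan)
      also have "\<dots> = 0"
      proof -
        have "rs ! i \<in> R" using i len rs by auto
        then show ?thesis using dep eq by (auto simp: lin_dependence_def mult.commute)
      qed
      finally show "vec_index (A *\<^sub>v v) i = vec_index (0\<^sub>v k) i" using i by simp
    qed
    moreover have "A \<in> carrier_mat k k" by (simp add: A_def)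
    ultimately have "Determinant.det A = 0"
      using det_0_iff_vec_prod_zero by blast
    then show False using nz len by (simp add: A_def minor_def)
  qed
  then obtain e where e: "e \<in> C" "e \<notin> set cs" using cs by blast
  define cs' where "cs' = cs @ [e]"
  have cs': "distinct cs'" "set cs' \<subseteq> C" "length cs' = Suc k"
    using cs e len by (auto simp: cs'_def)
  \<comment> \<open>The bordering row does not enter its own cofactors, so one vector of cofactors serves all rows.\<close>
  define N where "N = (\<lambda>i. Matrix.mat (Suc k) (Suc k) (\<lambda>(a, b). M ((rs @ [i]) ! a) (cs' ! b)))"
  define cof where "cof = (\<lambda>j. (-1) ^ (k + j) *
    minor rs (take j cs' @ drop (Suc j) cs'))"
  have cofactor_N: "cofactor (N i) k j = cof j" if j: "j < Suc k" for i j
  proof -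
    have "mat_delete (N i) k j =
      Matrix.mat (length rs) (length (take j cs' @ drop (Suc j) cs'))
        (\<lambda>(a, b). M (rs ! a) ((take j cs' @ drop (Suc j) cs') ! b))"
      using j cs'(3) len
      by (intro eq_matI) (auto simp: mat_delete_def N_def nth_append min_def)
    then show ?thesis by (simp add: cofactor_def cof_def minor_def)
  qed
  have det_N: "Determinant.det (N i) = (\<Sum>j<Suc k. M i (cs' ! j) * cof j)" for i
  proof -
    have "Determinant.det (N i) = (\<Sum>j<Suc k. N i $$ (k, j) * cofactor (N i) k j)"
      by (intro laplace_expansion_row) (auto simp: N_def)
    also have "\<dots> = (\<Sum>j<Suc k. M i (cs' ! j) * cof j)"
    proof (intro sum.cong refl)
      fix j assume "j \<in> {..<Suc k}"
      then have j: "j < Suc k" by simp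
      then have "N i $$ (k, j) = M i (cs' ! j)" using len by (simp add: N_def nth_append)
      then show "N i $$ (k, j) * cofactor (N i) k j = M i (cs' ! j) * cof j"
        using cofactor_N[OF j] by simp
    qed
    finally show ?thesis .
  qed
  have det_N_0: "Determinant.det (N i) = 0" if i: "i \<in> R" for i
  proof (cases "i \<in> set rs")
    case True
    then obtain a where a: "a < k" "rs ! a = i" using len by (metis in_set_conv_nth)
    show ?thesis
    proof (rule det_identical_rows[of "N i" "Suc k" a k])
      show "Matrix.row (N i) a = Matrix.row (N i) k"
        using a len by (intro eq_vecI) (auto simp: N_def nth_append)
    qed (use a in \<open>auto simp: N_def\<close>)
  next
    case False
    show ?thesis
    proof (rule ccontr)
      assume nz': "Determinant.det (N i) \<noteq> 0"
      have "minor (rs @ [i]) cs' = Determinant.det (N i)"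
        using len cs'(3) by (simp add: minor_def N_def)
      with nz' have "good (Suc k)"
        unfolding good_def using rs cs' i False len
        by (intro exI[of _ "rs @ [i]"] exI[of _ cs']) auto
      then show False using kmax by fastforce
    qed
  qed
  have cof_val: "cof j \<in> {0, 1, -1}" if j: "j < Suc k" for j
  proof -
    define ds where "ds = take j cs' @ drop (Suc j) cs'"
    have "distinct (take j cs' @ cs' ! j # drop (Suc j) cs')"
      using cs' j by (simp add: id_take_nth_drop[symmetric])
    then have "distinct ds" by (auto simp: ds_def)
    moreover have "set ds \<subseteq> E"
      using cs'(2) CE unfolding ds_def by (auto dest!: in_set_takeD in_set_dropD)
    moreover have "length ds = k" using j cs'(3) by (simp add: ds_def)
    ultimately have "minor rs ds \<in> {0, 1, -1}"
      using tu rs len unfolding totally_unimodular_def minor_def by auto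
    then show ?thesis
      by (cases "even (k + j)") (auto simp: cof_def ds_def)
  qed
  have cof_k: "cof k \<noteq> 0"
    using nz len by (simp add: cof_def cs'_def)
  define pos where "pos = inv_into {..<Suc k} ((!) cs')"
  define l' where "l' = (\<lambda>g. if g \<in> set cs' then cof (pos g) else 0)"
  have bij: "bij_betw ((!) cs') {..<Suc k} (set cs')"
    using bij_betw_nth[OF cs'(1)] cs'(3) by auto
  have l'_nth: "l' (cs' ! j) = cof j" if "j < Suc k" for j
    using that bij cs'(3) by (auto simp: l'_def pos_def bij_betw_def inv_into_f_f)
  have "lin_dependence R M (set cs') l'"
    unfolding lin_dependence_def
  proof (intro conjI ballI)
    have "cs' ! k = e" using len by (simp add: cs'_def nth_append)
    then show "\<exists>e\<in>set cs'. l' e \<noteq> 0"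
      using l'_nth[of k] cof_k by (intro bexI[of _ e]) (auto simp: cs'_def)
    fix i assume i: "i \<in> R"
    have "(\<Sum>g\<in>set cs'. l' g * M i g) = (\<Sum>j<Suc k. l' (cs' ! j) * M i (cs' ! j))"
      by (rule sum.reindex_bij_betw[OF bij, symmetric])
    also have "\<dots> = (\<Sum>j<Suc k. M i (cs' ! j) * cof j)"
      by (intro sum.cong) (auto simp: l'_nth)
    also have "\<dots> = 0" using det_N det_N_0[OF i] by simp
    finally show "(\<Sum>g\<in>set cs'. l' g * M i g) = 0" .
  qed
  from lin_dependence_mono[OF this cs'(2) fin]
  have "lin_dependence R M C (\<lambda>e. if e \<in> set cs' then l' e else 0)" .
  moreover have "(if g \<in> set cs' then l' g else 0) \<in> {0, 1, -1}" for g
  proof (cases "g \<in> set cs'")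
    case True
    then obtain j where "j < Suc k" "g = cs' ! j" using cs'(3) by (metis in_set_conv_nth)
    then show ?thesis using cof_val l'_nth by auto
  qed auto
  ultimately show ?thesis by blast
qed

section \<open>Spanning trees and their fundamental cuts\<close>

definition adjacency :: "('v, 'e) pre_digraph \<Rightarrow> 'e set \<Rightarrow> ('v \<times> 'v) set" where
  "adjacency D T = (\<Union>e\<in>T. {(tail D e, head D e), (head D e, tail D e)})"

text \<open>Connectivity of the underlying undirected graph is a predicate of the arc set alone, so that the
  subgraphs of a digraph with the same vertices can be compared without naming them.\<close>

definition linked :: "('v, 'e) pre_digraph \<Rightarrow> 'e set \<Rightarrow> 'v \<Rightarrow> 'v \<Rightarrow> bool" where
  "linked D T u v \<longleftrightarrow> (u, v) \<in> (adjacency D T)\<^sup>*"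

text \<open>One side of the fundamental cut of \<open>e\<close> if \<open>T\<close> is a spanning tree: removing \<open>e\<close> leaves two components,
  and this is the one that contains the head of \<open>e\<close>.\<close>

definition head_side :: "('v, 'e) pre_digraph \<Rightarrow> 'e set \<Rightarrow> 'e \<Rightarrow> 'v set" where
  "head_side D T e = {v. linked D (T - {e}) (head D e) v}"

definition cut_vector :: "('v, 'e) pre_digraph \<Rightarrow> 'v set \<Rightarrow> 'e \<Rightarrow> real" where
  "cut_vector D X e = of_bool (head D e \<in> X) - of_bool (tail D e \<in> X)"

text \<open>An arc of a tree points away from the root if deleting it separates its head from the root.\<close>

definition away_arcs :: "('v, 'e) pre_digraph \<Rightarrow> 'v \<Rightarrow> 'e set \<Rightarrow> 'e set" where
  "away_arcs D r T = {e\<in>T. r \<notin> head_side D T e}"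

text \<open>The bases of the graphic matroid. By \<open>undirected_tree_iff\<close> they are the arc sets of the spanning
  trees.\<close>

definition tree_arcs :: "('v, 'e) pre_digraph \<Rightarrow> 'e set set" where
  "tree_arcs D = matroid_bases (arcs D) (graphic_circuits D)"

lemma linked_refl [simp]: "linked D T u u"
  by (simp add: linked_def)

lemma linked_trans: "linked D T u v \<Longrightarrow> linked D T v w \<Longrightarrow> linked D T u w"
  unfolding linked_def by (rule rtrancl_trans)

lemma linked_sym: "linked D T u v \<Longrightarrow> linked D T v u"
proof -
  have "sym (adjacency D T)" by (auto simp: sym_def adjacency_def)
  then have "sym ((adjacency D T)\<^sup>*)" by (rule sym_rtrancl)
  then show "linked D T u v \<Longrightarrow> linked D T v u" unfolding linked_def by (rule symD)
qed

lemma linked_arc: "e \<in> T \<Longrightarrow> linked D T (tail D e) (head D e)"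
  unfolding linked_def adjacency_def by (intro r_into_rtrancl) auto

lemma linked_closed_set:
  assumes "linked D T u v" "u \<in> X" "\<And>e. e \<in> T \<Longrightarrow> tail D e \<in> X \<longleftrightarrow> head D e \<in> X"
  shows "v \<in> X"
  using assms(1) unfolding linked_def
proof (induction rule: rtrancl_induct)
  case base show ?case by (fact assms(2))
next
  case (step y z) then show ?case using assms(3) by (auto simp: adjacency_def)
qed

lemma cut_vector_linked_component:
  assumes "e \<in> T"
  shows "cut_vector D {v. linked D T u v} e = 0"
proof -
  have "linked D T u (tail D e) \<longleftrightarrow> linked D T u (head D e)"
    using linked_arc[OF assms] linked_sym linked_trans by metis
  then show ?thesis by (simp add: cut_vector_def)
qed

text \<open>A walk, each arc counted with the sign of the direction in which it is traversed, is a flow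
  of one unit from its start to its end.\<close>

lemma linked_unit_flow:
  assumes "linked D T u v" "finite T"
  shows "\<exists>l. \<forall>x. (\<Sum>e\<in>T. l e * incidence D x e) = of_bool (x = v) - of_bool (x = u)"
  using assms(1) unfolding linked_def
proof (induction rule: rtrancl_induct)
  case base
  show ?case by (intro exI[of _ "\<lambda>_. 0"]) simp
next
  case (step y z)
  then obtain l where l: "\<And>x. (\<Sum>e\<in>T. l e * incidence D x e) = of_bool (x = y) - of_bool (x = u)"
    by blast
  obtain e where e: "e \<in> T" "(y, z) = (tail D e, head D e) \<or> (y, z) = (head D e, tail D e)"
    using step.hyps(2) by (auto simp: adjacency_def)
  define s :: real where "s = (if (y, z) = (tail D e, head D e) then 1 else -1)"
  have s: "s * incidence D x e = of_bool (x = z) - of_bool (x = y)" for x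
    using e(2) by (auto simp: s_def incidence_def)
  have "(\<Sum>g\<in>T. (l g + (if g = e then s else 0)) * incidence D x g) =
    of_bool (x = z) - of_bool (x = u)" for x
  proof -
    have "(\<Sum>g\<in>T. (l g + (if g = e then s else 0)) * incidence D x g) =
      (\<Sum>g\<in>T. l g * incidence D x g) + (\<Sum>g\<in>T. if g = e then s * incidence D x e else 0)"
      unfolding sum.distrib[symmetric] by (intro sum.cong) (auto simp: algebra_simps)
    also have "(\<Sum>g\<in>T. if g = e then s * incidence D x e else 0) = s * incidence D x e"
      using e(1) assms(2) by simp
    finally show ?thesis using l[of x] s[of x] by simp
  qed
  then show ?case by (intro exI[of _ "\<lambda>g. l g + (if g = e then s else 0)"]) simp
qed

text \<open>A cut vector is the sum of the rows of the incidence matrix on one side of the cut.\<close>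

lemma (in fin_digraph) cut_vector_pairing:
  assumes "T \<subseteq> arcs G"
  shows "(\<Sum>e\<in>T. l e * cut_vector G X e) =
    (\<Sum>v\<in>verts G \<inter> X. \<Sum>e\<in>T. l e * incidence G v e)"
proof -
  have "cut_vector G X e = (\<Sum>v\<in>verts G \<inter> X. incidence G v e)" if "e \<in> T" for e
  proof -
    have "(\<Sum>v\<in>verts G \<inter> X. of_bool (x = v) :: real) = of_bool (x \<in> X)" if "x \<in> verts G" for x
      using that by (simp add: of_bool_def)
    then show ?thesis
      using that assms unfolding cut_vector_def incidence_def sum_subtractf by auto
  qed
  then have "(\<Sum>e\<in>T. l e * cut_vector G X e) =
    (\<Sum>e\<in>T. \<Sum>v\<in>verts G \<inter> X. l e * incidence G v e)"
    by (simp add: sum_distrib_left)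
  also have "\<dots> = (\<Sum>v\<in>verts G \<inter> X. \<Sum>e\<in>T. l e * incidence G v e)"
    by (rule sum.swap)
  finally show ?thesis .
qed

lemma (in fin_digraph) tree_arcs_iff:
  "T \<in> tree_arcs G \<longleftrightarrow> T \<subseteq> arcs G \<and> (\<forall>l. \<not> lin_dependence (verts G) (incidence G) T l) \<and>
    (\<forall>e\<in>arcs G - T. \<exists>l. lin_dependence (verts G) (incidence G) (insert e T) l)"
  unfolding tree_arcs_def graphic_circuits_def by (rule matroid_bases_iff) simp

lemma (in fin_digraph)
  assumes "T \<in> tree_arcs G"
  shows tree_arcs_subset: "T \<subseteq> arcs G"
    and tree_arcs_independent: "\<not> lin_dependence (verts G) (incidence G) T l"
  using assms unfolding tree_arcs_iff by blast+

lemma (in fin_digraph) independent_if_flow_zero: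
  assumes "T \<subseteq> arcs G" "\<And>l. \<not> lin_dependence (verts G) (incidence G) T l"
    and "\<And>v. v \<in> verts G \<Longrightarrow> (\<Sum>e\<in>T. l e * incidence G v e) = 0" "e \<in> T"
  shows "l e = 0"
  using assms unfolding lin_dependence_def by blast

text \<open>Otherwise a walk that joins the ends of \<open>e\<close> and avoids \<open>e\<close> closes up to a nonzero circulation on \<open>T\<close>.\<close>

lemma (in fin_digraph) tail_notin_head_side:
  assumes T: "T \<subseteq> arcs G" "\<And>l. \<not> lin_dependence (verts G) (incidence G) T l" and e: "e \<in> T"
  shows "tail G e \<notin> head_side G T e"
proof
  assume "tail G e \<in> head_side G T e"
  then have link: "linked G (T - {e}) (head G e) (tail G e)" by (simp add: head_side_def)
  have fT: "finite T" by (rule finite_subset[OF T(1) finite_arcs])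
  obtain l where l: "\<And>x. (\<Sum>g\<in>T - {e}. l g * incidence G x g) =
      of_bool (x = tail G e) - of_bool (x = head G e)"
    using linked_unit_flow[OF link finite_Diff[OF fT]] by blast
  have "(\<Sum>g\<in>T. (if g = e then 1 else l g) * incidence G x g) = 0" for x
  proof -
    have "(\<Sum>g\<in>T. (if g = e then 1 else l g) * incidence G x g) =
      incidence G x e + (\<Sum>g\<in>T - {e}. (if g = e then 1 else l g) * incidence G x g)"
      by (subst sum.remove[OF fT e]) simp
    also have "(\<Sum>g\<in>T - {e}. (if g = e then 1 else l g) * incidence G x g) =
      (\<Sum>g\<in>T - {e}. l g * incidence G x g)"
      by (intro sum.cong) auto
    finally show ?thesis using l[of x] by (auto simp: incidence_def)
  qed
  from independent_if_flow_zero[OF T this e] show False by simp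
qed

lemma (in fin_digraph) cut_vector_head_side:
  assumes "T \<in> tree_arcs G" "e \<in> T" "g \<in> T"
  shows "cut_vector G (head_side G T e) g = of_bool (g = e)"
proof (cases "g = e")
  case True
  have "tail G e \<notin> head_side G T e"
    by (rule tail_notin_head_side[OF tree_arcs_subset[OF assms(1)] tree_arcs_independent[OF assms(1)] assms(2)])
  then show ?thesis using True by (simp add: cut_vector_def head_side_def)
next
  case False
  then show ?thesis
    using cut_vector_linked_component[of g "T - {e}" G "head G e"] assms(3)
    by (simp add: head_side_def)
qed

lemma connected_iff_linked:
  assumes "wf_digraph G"
  shows "Digraph_Component.connected G \<longleftrightarrow>
    verts G \<noteq> {} \<and> (\<forall>u\<in>verts G. \<forall>v\<in>verts G. linked G (arcs G) u v)"
proof -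
  define M where "M = with_proj (mk_symmetric G)"
  have M: "verts M = verts G" "arcs_ends M = adjacency G (arcs G)"
    by (simp_all add: M_def adjacency_def parcs_mk_symmetric)
  have "wf_digraph M"
    using assms by (auto simp: M_def wf_digraph_def parcs_mk_symmetric)
  then have "u \<rightarrow>\<^sup>*\<^bsub>M\<^esub> v \<longleftrightarrow> linked G (arcs G) u v" if "u \<in> verts G" for u v
    using wf_digraph.reachable_conv'[of M u v] that by (simp add: linked_def M)
  then show ?thesis
    unfolding Digraph_Component.connected_def strongly_connected_def M_def[symmetric] by (simp add: M)
qed

text \<open>If the ends of an arc \<open>f\<close> were not linked in \<open>T\<close>, then \<open>f\<close> would be the only arc of \<open>T \<union> {f}\<close> in
  the cut around the component of its head. A circulation has no net flow through a cut, so it would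
  vanish on \<open>f\<close>, and \<open>T \<union> {f}\<close> would be independent.\<close>

lemma (in fin_digraph) tree_arcs_linked:
  assumes T: "T \<in> tree_arcs G" and conn: "Digraph_Component.connected G"
    and uv: "u \<in> verts G" "v \<in> verts G"
  shows "linked G T u v"
proof -
  note TG = tree_arcs_subset[OF T] and ind = tree_arcs_independent[OF T]
  have fT: "finite T" by (rule finite_subset[OF TG finite_arcs])
  have arc: "linked G T (head G f) (tail G f)" if f: "f \<in> arcs G" for f
  proof (cases "f \<in> T")
    case True then show ?thesis using linked_arc linked_sym by metis
  next
    case False
    show ?thesis
    proof (rule ccontr)
      assume nl: "\<not> linked G T (head G f) (tail G f)"
      define X where "X = {v. linked G T (head G f) v}"
      obtain l where l: "lin_dependence (verts G) (incidence G) (insert f T) l"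
        using T f False unfolding tree_arcs_iff by blast
      have "(\<Sum>g\<in>insert f T. l g * cut_vector G X g) = 0"
        using cut_vector_pairing[of "insert f T" l X] TG f l by (simp add: lin_dependence_def)
      moreover have "cut_vector G X g = 0" if "g \<in> T" for g
        using cut_vector_linked_component[OF that] by (simp add: X_def)
      moreover have "cut_vector G X f = 1" using nl by (simp add: cut_vector_def X_def)
      ultimately have "l f = 0" using False fT by simp
      then have "lin_dependence (verts G) (incidence G) T l"
        using fT by (intro lin_dependence_drop_zeros[OF l]) auto
      with ind show False by blast
    qed
  qed
  have "linked G (arcs G) u v"
    using conn uv by (simp add: connected_iff_linked wf_digraph)
  then have "v \<in> {v. linked G T u v}"
  proof (rule linked_closed_set)
    fix e assume "e \<in> arcs G"
    from arc[OF this] have "linked G T u (tail G e) \<longleftrightarrow> linked G T u (head G e)"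
      using linked_sym linked_trans by metis
    then show "tail G e \<in> {v. linked G T u v} \<longleftrightarrow> head G e \<in> {v. linked G T u v}" by simp
  qed simp
  then show ?thesis by simp
qed

section \<open>Directed walks in reoriented digraphs\<close>

lemma reverse_arcs_simps [simp]:
  "verts (reverse_arcs S G) = verts G" "arcs (reverse_arcs S G) = arcs G"
  "tail (reverse_arcs S G) = (\<lambda>e. if e \<in> S then head G e else tail G e)"
  "head (reverse_arcs S G) = (\<lambda>e. if e \<in> S then tail G e else head G e)"
  by (simp_all add: reverse_arcs_def)

lemma fin_digraph_reverse_arcs: "fin_digraph G \<Longrightarrow> fin_digraph (reverse_arcs S G)"
  by (auto simp: fin_digraph_def wf_digraph_def fin_digraph_axioms_def)

lemma adjacency_reverse_arcs: "adjacency (reverse_arcs S G) T = adjacency G T"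
  unfolding adjacency_def by (intro SUP_cong) auto

lemma directed_walk_unit_flow:
  assumes "pre_digraph.cas (reverse_arcs S G) u p v" "finite T" "set p \<subseteq> T"
  shows "(\<Sum>e\<in>T. (if e \<in> S then -1 else 1) * real (count_list p e) * incidence G x e) =
    of_bool (x = v) - of_bool (x = u)"
  using assms(1,3)
proof (induction p arbitrary: u)
  case Nil
  then show ?case by (simp add: pre_digraph.cas.simps)
next
  case (Cons a p)
  have sum1: "(\<Sum>e\<in>T. if e = a then (if a \<in> S then -1 else 1) * incidence G x a else 0) =
    (if a \<in> S then -1 else 1) * incidence G x a"
    using Cons.prems assms(2) by simp
  have "(\<Sum>e\<in>T. (if e \<in> S then -1 else 1) * real (count_list (a # p) e) * incidence G x e) =
    (\<Sum>e\<in>T. (if e \<in> S then -1 else 1) * real (count_list p e) * incidence G x e) +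
    (\<Sum>e\<in>T. if e = a then (if a \<in> S then -1 else 1) * incidence G x a else 0)"
    unfolding sum.distrib[symmetric] by (intro sum.cong) (auto simp: algebra_simps)
  also have "\<dots> = of_bool (x = v) - of_bool (x = u)"
  proof -
    have "(if a \<in> S then -1 else 1) * incidence G x a =
      of_bool (x = head (reverse_arcs S G) a) - of_bool (x = tail (reverse_arcs S G) a)"
      by (simp add: incidence_def eq_commute)
    moreover have "tail (reverse_arcs S G) a = u"
      "pre_digraph.cas (reverse_arcs S G) (head (reverse_arcs S G) a) p v" "set p \<subseteq> T"
      using Cons.prems by (simp_all add: pre_digraph.cas.simps)
    ultimately show ?thesis unfolding sum1 using Cons.IH by simp
  qed
  finally show ?case .
qed

lemma reverse_arcs_twice:
  "reverse_arcs S' (reverse_arcs S G) = reverse_arcs ((S - S') \<union> (S' - S)) G"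
  by (auto simp: reverse_arcs_def fun_eq_iff)

lemma connected_reverse_arcs:
  assumes "wf_digraph G"
  shows "Digraph_Component.connected (reverse_arcs S G) \<longleftrightarrow> Digraph_Component.connected G"
proof -
  have "wf_digraph (reverse_arcs S G)" using assms by (auto simp: wf_digraph_def)
  then show ?thesis using assms
    by (simp add: connected_iff_linked linked_def adjacency_reverse_arcs)
qed

lemma undirected_tree_reverse_arcs:
  assumes "wf_digraph G" "undirected_tree G" "S \<subseteq> arcs G"
  shows "undirected_tree (reverse_arcs S G)"
proof -
  have "forest (reverse_arcs ((S - S') \<union> (S' - S)) G)" if "S' \<subseteq> arcs G" for S'
  proof -
    have "(S - S') \<union> (S' - S) \<subseteq> arcs G" using assms(3) that by blast
    then show ?thesis using assms(2) by (simp add: undirected_tree_def)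
  qed
  then show ?thesis
    using assms by (simp add: undirected_tree_def connected_reverse_arcs reverse_arcs_twice)
qed

text \<open>A dependence among the columns of the incidence matrix becomes a positive circulation once the
  arcs with negative coefficients are reversed, and no circulation leaves the set of
  vertices that can be reached along it.\<close>

lemma forest_imp_independent:
  assumes fin: "fin_digraph H" and forest: "\<And>S. S \<subseteq> arcs H \<Longrightarrow> forest (reverse_arcs S H)"
  shows "\<not> lin_dependence (verts H) (incidence H) (arcs H) l"
proof
  assume dep: "lin_dependence (verts H) (incidence H) (arcs H) l"
  interpret H: fin_digraph H by fact
  define S where "S = {e\<in>arcs H. l e < 0}"
  define G' where "G' = reverse_arcs S H"
  interpret G': fin_digraph G' unfolding G'_def by (rule fin_digraph_reverse_arcs) (fact fin)
  have G'_arcs: "arcs G' = arcs H" by (simp add: G'_def)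
  define R where "R = {(tail G' e, head G' e) | e. e \<in> arcs H \<and> l e \<noteq> 0}"
  obtain e0 where e0: "e0 \<in> arcs H" "l e0 \<noteq> 0" using dep by (auto simp: lin_dependence_def)
  define Y where "Y = {v. (head G' e0, v) \<in> R\<^sup>*}"
  have "(\<Sum>e\<in>arcs H. l e * cut_vector H Y e) = 0"
    using H.cut_vector_pairing[of "arcs H" l Y] dep by (simp add: lin_dependence_def)
  moreover have "l e * cut_vector H Y e = \<bar>l e\<bar> * cut_vector G' Y e" if "e \<in> arcs H" for e
    using that by (auto simp: cut_vector_def G'_def S_def)
  ultimately have sum0: "(\<Sum>e\<in>arcs H. \<bar>l e\<bar> * cut_vector G' Y e) = 0" by simp
  have "0 \<le> \<bar>l e\<bar> * cut_vector G' Y e" if "e \<in> arcs H" for e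
  proof (cases "l e = 0")
    case False
    have "tail G' e \<in> Y \<Longrightarrow> head G' e \<in> Y"
      using that False unfolding Y_def R_def by (auto intro: rtrancl_into_rtrancl)
    then show ?thesis by (auto simp: cut_vector_def)
  qed simp
  then have "\<bar>l e0\<bar> * cut_vector G' Y e0 = 0"
    using sum0 e0(1) by (subst (asm) sum_nonneg_eq_0_iff) auto
  then have "cut_vector G' Y e0 = 0" using e0(2) by simp
  moreover have "head G' e0 \<in> Y" by (simp add: Y_def)
  ultimately have "tail G' e0 \<in> Y" by (auto simp: cut_vector_def split: if_splits)
  then have "(head G' e0, tail G' e0) \<in> R\<^sup>*" by (simp add: Y_def)
  moreover have "R \<subseteq> arcs_ends G'"
    using G'.in_arcs_imp_in_arcs_ends G'_arcs unfolding R_def by blast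
  ultimately have "(head G' e0, tail G' e0) \<in> (arcs_ends G')\<^sup>*"
    using rtrancl_mono by blast
  moreover have e0G: "e0 \<in> arcs G'" using e0(1) by (simp add: G'_def)
  ultimately obtain p where p: "G'.awalk (head G' e0) p (tail G' e0)"
    using G'.reachable_conv'[OF G'.head_in_verts[OF e0G]] G'.reachable_awalk by blast
  then have "G'.closed_w (e0 # p)"
    using e0G by (auto simp: G'.closed_w_def G'.awalk_Cons_iff)
  then have "\<exists>p. G'.cycle p" by (rule G'.closed_w_imp_cycle)
  moreover have "forest G'" unfolding G'_def by (rule forest) (auto simp: S_def)
  ultimately show False by (simp add: forest_def)
qed

text \<open>A directed cycle in a reorientation is a circulation once the reversed arcs are counted negatively.\<close>

lemma independent_imp_forest:
  assumes fin: "finite (arcs H)" and ind: "\<And>l. \<not> lin_dependence (verts H) (incidence H) (arcs H) l"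
  shows "forest (reverse_arcs S H)"
  unfolding forest_def
proof
  assume "\<exists>p. pre_digraph.cycle (reverse_arcs S H) p"
  then obtain p u where p: "pre_digraph.awalk (reverse_arcs S H) u p u" "p \<noteq> []"
    unfolding pre_digraph.cycle_def by blast
  then have cas: "pre_digraph.cas (reverse_arcs S H) u p u" and sub: "set p \<subseteq> arcs H"
    by (auto simp: pre_digraph.awalk_def)
  define c where "c = (\<lambda>e. (if e \<in> S then -1 else 1) * real (count_list p e))"
  have "(\<Sum>e\<in>arcs H. c e * incidence H x e) = 0" for x
    using directed_walk_unit_flow[OF cas fin sub, of x] by (simp add: c_def)
  moreover obtain a where "a \<in> set p" using p(2) by (cases p) auto
  then have "a \<in> arcs H" "c a \<noteq> 0"
    using sub by (auto simp: c_def count_list_0_iff)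
  ultimately have "lin_dependence (verts H) (incidence H) (arcs H) c"
    unfolding lin_dependence_def by blast
  with ind show False by blast
qed

lemma incidence_update_arcs [simp]: "incidence (D\<lparr>arcs := T\<rparr>) = incidence D"
  by (simp add: incidence_def fun_eq_iff)

lemma linked_update_arcs [simp]: "linked (D\<lparr>arcs := T\<rparr>) = linked D"
  by (simp add: linked_def adjacency_def fun_eq_iff)

lemma (in fin_digraph) fin_digraph_update_arcs:
  "T \<subseteq> arcs G \<Longrightarrow> fin_digraph (G\<lparr>arcs := T\<rparr>)"
  by unfold_locales (auto intro: finite_subset)

lemma (in fin_digraph) undirected_tree_iff:
  assumes conn: "Digraph_Component.connected G" and T: "T \<subseteq> arcs G"
  shows "undirected_tree (G\<lparr>arcs := T\<rparr>) \<longleftrightarrow> T \<in> tree_arcs G"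
proof -
  have fT: "finite T" by (rule finite_subset[OF T finite_arcs])
  interpret H: fin_digraph "G\<lparr>arcs := T\<rparr>" by (rule fin_digraph_update_arcs[OF T])
  show ?thesis
  proof
    assume ut: "undirected_tree (G\<lparr>arcs := T\<rparr>)"
    then have "forest (reverse_arcs S (G\<lparr>arcs := T\<rparr>))" if "S \<subseteq> T" for S
      using that by (simp add: undirected_tree_def)
    then have ind: "\<not> lin_dependence (verts G) (incidence G) T l" for l
      using forest_imp_independent[OF H.fin_digraph, of l] by simp
    have dep: "\<exists>l. lin_dependence (verts G) (incidence G) (insert f T) l" if f: "f \<in> arcs G - T" for f
    proof -
      have "linked G T (head G f) (tail G f)"
        using ut f by (simp add: undirected_tree_def connected_iff_linked[OF H.wf_digraph])
      from linked_unit_flow[OF this fT]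
      obtain l where l: "\<And>x. (\<Sum>e\<in>T. l e * incidence G x e) =
          of_bool (x = tail G f) - of_bool (x = head G f)"
        by blast
      have "(\<Sum>e\<in>insert f T. (l(f := 1)) e * incidence G x e) = 0" for x
      proof -
        have "(\<Sum>e\<in>T. (l(f := 1)) e * incidence G x e) = (\<Sum>e\<in>T. l e * incidence G x e)"
          using f by (intro sum.cong) auto
        then show ?thesis using f fT l[of x] by (simp add: incidence_def)
      qed
      then have "lin_dependence (verts G) (incidence G) (insert f T) (l(f := 1))"
        unfolding lin_dependence_def by auto
      then show ?thesis by blast
    qed
    from ind dep show "T \<in> tree_arcs G" using T unfolding tree_arcs_iff by blast
  next
    assume tr: "T \<in> tree_arcs G"
    have "verts G \<noteq> {}" using conn by (simp add: connected_iff_linked[OF wf_digraph])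
    then have "Digraph_Component.connected (G\<lparr>arcs := T\<rparr>)"
      using tree_arcs_linked[OF tr conn] by (simp add: connected_iff_linked[OF H.wf_digraph])
    moreover have "forest (reverse_arcs S (G\<lparr>arcs := T\<rparr>))" for S
    proof (rule independent_imp_forest)
      show "\<not> lin_dependence (verts (G\<lparr>arcs := T\<rparr>)) (incidence (G\<lparr>arcs := T\<rparr>)) (arcs (G\<lparr>arcs := T\<rparr>)) l" for l
        using tree_arcs_independent[OF tr] by simp
    qed (simp add: fT)
    ultimately show "undirected_tree (G\<lparr>arcs := T\<rparr>)" by (simp add: undirected_tree_def)
  qed
qed

section \<open>Orienting a tree towards its root\<close>

text \<open>The signed arc multiplicities of two walks with common ends differ by a dependence, so
  independence of the columns forces equal arc sets.\<close>

lemma walks_same_arcs: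
  assumes fin: "finite T" and ind: "\<And>l. \<not> lin_dependence (verts G) (incidence G) T l"
    and p: "pre_digraph.cas (reverse_arcs S G) u p v" "set p \<subseteq> T"
    and q: "pre_digraph.cas (reverse_arcs S G) u q v" "set q \<subseteq> T"
  shows "set p = set q"
proof -
  define c where "c = (\<lambda>e. (if e \<in> S then -1 else 1) * (real (count_list p e) - real (count_list q e)))"
  have "(\<Sum>e\<in>T. c e * incidence G x e) = 0" for x
  proof -
    have "(\<Sum>e\<in>T. c e * incidence G x e) =
      (\<Sum>e\<in>T. (if e \<in> S then -1 else 1) * real (count_list p e) * incidence G x e) -
      (\<Sum>e\<in>T. (if e \<in> S then -1 else 1) * real (count_list q e) * incidence G x e)"
      unfolding c_def sum_subtractf[symmetric] by (simp add: algebra_simps)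
    then show ?thesis
      unfolding directed_walk_unit_flow[OF p(1) fin p(2)] directed_walk_unit_flow[OF q(1) fin q(2)]
      by simp
  qed
  then have "\<forall>e\<in>T. c e = 0" using ind unfolding lin_dependence_def by blast
  then have eq: "count_list p e = count_list q e" if "e \<in> T" for e
    using that by (auto simp: c_def split: if_splits)
  have "e \<in> set p \<longleftrightarrow> e \<in> set q" if "e \<in> T" for e
    using eq[OF that] count_list_0_iff by metis
  then show ?thesis using p(2) q(2) by blast
qed

text \<open>A path visits its start only once, so only its first arc can leave the start.\<close>

lemma (in wf_digraph) apath_determined_by_arcs:
  assumes "apath u p v" "apath u q v" "set p = set q"
  shows "p = q"
  using assms
proof (induction p arbitrary: u q)
  case Nil
  then show ?case by simp
next
  case (Cons a p)
  have hd_unique: "b = c" if "apath u (c # cs) v" "b \<in> set (c # cs)" "tail G b = u" for b c cs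
    using that awalk_verts_arc1[of b cs "head G c"] by (auto simp: apath_Cons_iff)
  have notin: "c \<notin> set cs" if "apath u (c # cs) v" for c cs
    using that awalk_verts_arc1[of c cs "head G c"] by (auto simp: apath_Cons_iff)
  obtain b q' where q: "q = b # q'" using Cons.prems(3) by (cases q) auto
  have "tail G a = u" using Cons.prems(1) by (simp add: apath_Cons_iff)
  moreover have "a \<in> set (b # q')" using Cons.prems(3) q by auto
  ultimately have ab: "a = b" using hd_unique[of b q' a] Cons.prems(2) q by auto
  have "set p = set q'"
    using notin[OF Cons.prems(1)] notin[of b q'] Cons.prems(2,3) q ab by auto
  moreover have "apath (head G a) p v" "apath (head G a) q' v"
    using Cons.prems(1,2) q ab by (auto simp: apath_Cons_iff)
  ultimately show ?case using Cons.IH q ab by blast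
qed

lemma (in wf_digraph) walk_leaves_set:
  assumes "(u, v) \<in> (arcs_ends G)\<^sup>*" "u \<in> X" "v \<notin> X"
  obtains e where "e \<in> arcs G" "tail G e \<in> X" "head G e \<notin> X" "(head G e, v) \<in> (arcs_ends G)\<^sup>*"
proof -
  have "\<exists>e\<in>arcs G. tail G e \<in> X \<and> head G e \<notin> X \<and> (head G e, v) \<in> (arcs_ends G)\<^sup>*"
    using assms
  proof (induction rule: converse_rtrancl_induct)
    case base then show ?case by simp
  next
    case (step y z)
    obtain e where e: "e \<in> arcs G" "tail G e = y" "head G e = z"
      using step.hyps(1) by (auto simp: arcs_ends_conv)
    show ?case
    proof (cases "z \<in> X")
      case True then show ?thesis using step by blast
    next
      case False then show ?thesis using e step by blast
    qed
  qed
  then show ?thesis using that by blast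
qed

text \<open>A walk to the root from the far side of a tree arc \<open>e\<close> must leave that side, and \<open>e\<close> is the only arc
  that can do so. This forces the orientation of \<open>e\<close>. If conversely all arcs are oriented like this,
  the vertices from which the root can be reached are closed under tree arcs in both directions, so
  they are all the vertices.\<close>

lemma (in fin_digraph) oriented_tree_iff_away_arcs:
  assumes conn: "Digraph_Component.connected G" and T: "T \<in> tree_arcs G"
    and S: "S \<subseteq> T" and r: "r \<in> verts G"
  shows "oriented_tree (reverse_arcs S (G\<lparr>arcs := T\<rparr>)) r \<longleftrightarrow> S = away_arcs G r T"
proof -
  note TG = tree_arcs_subset[OF T] and ind = tree_arcs_independent[OF T]
  have fT: "finite T" by (rule finite_subset[OF TG finite_arcs])
  interpret H: fin_digraph "G\<lparr>arcs := T\<rparr>" by (rule fin_digraph_update_arcs[OF TG])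
  define H' where "H' = reverse_arcs S (G\<lparr>arcs := T\<rparr>)"
  interpret H': fin_digraph H'
    unfolding H'_def by (rule fin_digraph_reverse_arcs[OF H.fin_digraph])
  have H'_simps: "verts H' = verts G" "arcs H' = T"
    "tail H' = (\<lambda>e. if e \<in> S then head G e else tail G e)"
    "head H' = (\<lambda>e. if e \<in> S then tail G e else head G e)"
    by (auto simp: H'_def)
  have ut: "undirected_tree (G\<lparr>arcs := T\<rparr>)" using undirected_tree_iff[OF conn TG] T by simp
  then have ut': "undirected_tree H'"
    unfolding H'_def by (rule undirected_tree_reverse_arcs[OF H.wf_digraph]) (use S in auto)
  \<comment> \<open>The side of \<open>e\<close> in the tree that does not contain the root.\<close>
  define far where "far = (\<lambda>e. if r \<in> head_side G T e then - head_side G T e else head_side G T e)"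
  have r_far: "r \<notin> far e" for e by (simp add: far_def)
  have far_ends: "tail G g \<in> far e \<longleftrightarrow> head G g \<in> far e" if "e \<in> T" "g \<in> T" "g \<noteq> e" for e g
    using cut_vector_head_side[OF T that(1,2)] that(3)
    by (auto simp: far_def cut_vector_def of_bool_def split: if_splits)
  have far_own: "head G e \<in> far e \<longleftrightarrow> e \<in> away_arcs G r T" "tail G e \<in> far e \<longleftrightarrow> e \<notin> away_arcs G r T"
    if "e \<in> T" for e
  proof -
    have "head G e \<in> head_side G T e" by (simp add: head_side_def)
    moreover have "tail G e \<notin> head_side G T e" by (rule tail_notin_head_side[OF TG ind that])
    ultimately show "head G e \<in> far e \<longleftrightarrow> e \<in> away_arcs G r T"
      "tail G e \<in> far e \<longleftrightarrow> e \<notin> away_arcs G r T"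
      using that by (auto simp: far_def away_arcs_def)
  qed
  have leave: "e = g \<and> (e \<in> S \<longleftrightarrow> e \<in> away_arcs G r T)"
    if "e \<in> T" "g \<in> T" "tail H' g \<in> far e" "head H' g \<notin> far e" for e g
  proof -
    have "e = g" using that far_ends[of e g] by (auto simp: H'_simps split: if_splits)
    then show ?thesis using that far_own[OF that(1)] by (auto simp: H'_simps split: if_splits)
  qed
  have "oriented_tree H' r \<longleftrightarrow> S = away_arcs G r T"
  proof
    assume ot: "oriented_tree H' r"
    have "e \<in> S \<longleftrightarrow> e \<in> away_arcs G r T" if e: "e \<in> T" for e
    proof -
      obtain u where u: "u \<in> verts G" "u \<in> far e"
        using far_own[OF e] e TG tail_in_verts head_in_verts by blast
      then obtain p where "H'.apath u p r" using ot by (auto simp: oriented_tree_def H'_simps)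
      then have "H'.awalk u p r" by (rule H'.awalkI_apath)
      then have "(u, r) \<in> (arcs_ends H')\<^sup>*"
        using H'.reachable_awalk H'.reachable_conv by blast
      from H'.walk_leaves_set[OF this u(2) r_far]
      obtain g where "g \<in> arcs H'" "tail H' g \<in> far e" "head H' g \<notin> far e" by blast
      moreover from this(1) have "g \<in> T" by (simp add: H'_simps)
      ultimately show ?thesis using leave[OF e, of g] by blast
    qed
    then show "S = away_arcs G r T" using S by (auto simp: away_arcs_def)
  next
    assume S_eq: "S = away_arcs G r T"
    have tail_far: "tail H' e \<in> far e" "head H' e \<notin> far e" if "e \<in> T" for e
      using far_own[OF that] S_eq by (auto simp: H'_simps)
    define Y where "Y = {v. (v, r) \<in> (arcs_ends H')\<^sup>*}"
    have arc: "(tail H' e, head H' e) \<in> arcs_ends H'" if "e \<in> T" for e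
      using that by (auto simp: arcs_ends_conv H'_simps)
    have Y_arc: "tail H' e \<in> Y \<longleftrightarrow> head H' e \<in> Y" if e: "e \<in> T" for e
    proof
      assume "head H' e \<in> Y"
      then show "tail H' e \<in> Y"
        using arc[OF e] unfolding Y_def by (auto intro: converse_rtrancl_into_rtrancl)
    next
      assume "tail H' e \<in> Y"
      then have "(tail H' e, r) \<in> (arcs_ends H')\<^sup>*" by (simp add: Y_def)
      from H'.walk_leaves_set[OF this tail_far(1)[OF e] r_far]
      obtain g where g: "g \<in> arcs H'" "tail H' g \<in> far e" "head H' g \<notin> far e"
        "(head H' g, r) \<in> (arcs_ends H')\<^sup>*" by blast
      from g(1) have "g \<in> T" by (simp add: H'_simps)
      then have "e = g" using leave[OF e, of g] g(2,3) by blast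
      with g(4) show "head H' e \<in> Y" by (simp add: Y_def)
    qed
    have "\<exists>!p. H'.apath v p r" if v: "v \<in> verts G" for v
    proof -
      have "linked G T r v" by (rule tree_arcs_linked[OF T conn r v])
      then have "v \<in> Y"
      proof (rule linked_closed_set)
        show "r \<in> Y" by (simp add: Y_def)
        show "tail G e \<in> Y \<longleftrightarrow> head G e \<in> Y" if "e \<in> T" for e
          using Y_arc[OF that] by (auto simp: H'_simps split: if_splits)
      qed
      then have "v \<rightarrow>\<^sup>*\<^bsub>H'\<^esub> r"
        using v H'.reachable_conv'[of v r] by (simp add: Y_def H'_simps)
      then obtain p where p: "H'.apath v p r" using H'.reachable_apath by blast
      have "q = p" if q: "H'.apath v q r" for q
      proof -
        have "set q = set p"
        proof (rule walks_same_arcs[OF fT, of "G\<lparr>arcs := T\<rparr>" S v q r p])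
          show "\<not> lin_dependence (verts (G\<lparr>arcs := T\<rparr>)) (incidence (G\<lparr>arcs := T\<rparr>)) T l" for l
            using ind by simp
        qed (use p q in \<open>auto simp: H'.apath_def H'.awalk_def H'_simps H'_def[symmetric]\<close>)
        with q p show ?thesis by (rule H'.apath_determined_by_arcs)
      qed
      with p show ?thesis by blast
    qed
    then show "oriented_tree H' r"
      using ut' r by (simp add: oriented_tree_def H'_simps)
  qed
  then show ?thesis by (simp add: H'_def)
qed

lemma (in fin_digraph) k_spanning_tree_iff:
  assumes conn: "Digraph_Component.connected G" and r: "r \<in> verts G"
  shows "k_spanning_tree G r k H \<longleftrightarrow>
    (\<exists>T\<in>tree_arcs G. card (away_arcs G r T) = k \<and> H = G\<lparr>arcs := T\<rparr>)"
proof
  assume k: "k_spanning_tree G r k H"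
  define T where "T = arcs H"
  have sp: "verts H = verts G" "T \<subseteq> arcs G" "tail H = tail G" "head H = head G"
    using k by (auto simp: k_spanning_tree_def spanning_def subgraph_def compatible_def T_def)
  have H: "H = G\<lparr>arcs := T\<rparr>" using sp by (simp add: T_def)
  then have T: "T \<in> tree_arcs G"
    using undirected_tree_iff[OF conn sp(2)] k by (simp add: k_spanning_tree_def)
  moreover obtain S where "S \<subseteq> T" "card S = k" "oriented_tree (reverse_arcs S H) r"
    using k by (auto simp: k_spanning_tree_def T_def)
  ultimately have "card (away_arcs G r T) = k"
    using oriented_tree_iff_away_arcs[OF conn T _ r, of S] H by auto
  with T H show "\<exists>T\<in>tree_arcs G. card (away_arcs G r T) = k \<and> H = G\<lparr>arcs := T\<rparr>" by blast
next
  assume "\<exists>T\<in>tree_arcs G. card (away_arcs G r T) = k \<and> H = G\<lparr>arcs := T\<rparr>"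
  then obtain T where T: "T \<in> tree_arcs G" "card (away_arcs G r T) = k" "H = G\<lparr>arcs := T\<rparr>" by blast
  have TG: "T \<subseteq> arcs G" by (rule tree_arcs_subset[OF T(1)])
  have away: "away_arcs G r T \<subseteq> T" by (auto simp: away_arcs_def)
  have "spanning H G"
    using T(3) TG fin_digraph_update_arcs[OF TG] wf_digraph
    by (simp add: spanning_def subgraph_def compatible_def fin_digraph_def)
  moreover have "undirected_tree H" using T undirected_tree_iff[OF conn TG] by simp
  moreover have "oriented_tree (reverse_arcs (away_arcs G r T) H) r"
    using oriented_tree_iff_away_arcs[OF conn T(1) away r] T(3) by simp
  ultimately show "k_spanning_tree G r k H"
    unfolding k_spanning_tree_def using T(2,3) away by auto
qed

lemma (in fin_digraph) tree_poly_eq_sum_away_arcs: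
  assumes conn: "Digraph_Component.connected G" and r: "r \<in> verts G"
  shows "tree_poly G r = (\<Sum>T\<in>tree_arcs G. monom 1 (card (away_arcs G r T)))"
proof -
  have "tree_arcs G \<subseteq> Pow (arcs G)" using tree_arcs_subset by blast
  then have fin: "finite (tree_arcs G)" by (rule finite_subset) simp
  have num: "num_k_spanning_trees G r k = card {T\<in>tree_arcs G. card (away_arcs G r T) = k}" for k
  proof -
    have "{H. k_spanning_tree G r k H} =
      (\<lambda>T. G\<lparr>arcs := T\<rparr>) ` {T\<in>tree_arcs G. card (away_arcs G r T) = k}"
      using k_spanning_tree_iff[OF conn r] by auto
    moreover have "inj_on (\<lambda>T. G\<lparr>arcs := T\<rparr>) A" for A
      by (rule inj_on_inverseI[where g = arcs]) simp
    ultimately show ?thesis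
      unfolding num_k_spanning_trees_def by (simp add: card_image)
  qed
  have bound: "card (away_arcs G r T) \<le> card (arcs G)" if "T \<in> tree_arcs G" for T
    using tree_arcs_subset[OF that] by (intro card_mono) (auto simp: away_arcs_def)
  have "(\<Sum>T\<in>tree_arcs G. monom (1::real) (card (away_arcs G r T))) =
    (\<Sum>k\<le>card (arcs G). \<Sum>T\<in>{T\<in>tree_arcs G. card (away_arcs G r T) = k}.
      monom 1 (card (away_arcs G r T)))"
    using fin bound by (intro sum.group[symmetric]) auto
  also have "\<dots> = (\<Sum>k\<le>card (arcs G). monom (real (num_k_spanning_trees G r k)) k)"
    by (intro sum.cong refl) (simp add: num of_nat_poly smult_monom flip: of_nat_mult_conv_smult)
  finally show ?thesis by (simp add: tree_poly_def)
qed

section \<open>Lebesgue measure in affine charts\<close>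

text \<open>Integrals of functions instead of volumes of sets allow changes of coordinates to be carried out one
  coordinate at a time, by Fubini's theorem.\<close>

definition chart_integral ::
  "'e set \<Rightarrow> 'a::euclidean_space \<Rightarrow> ('e \<Rightarrow> 'a) \<Rightarrow> ('a \<Rightarrow> ennreal) \<Rightarrow> ennreal" where
  "chart_integral I p v F = (\<integral>\<^sup>+x. F (p + (\<Sum>e\<in>I. x e *\<^sub>R v e)) \<partial>Pi\<^sub>M I (\<lambda>_. lborel))"

interpretation lborel_product: product_sigma_finite "\<lambda>_. lborel :: real measure"
  by standard

lemma chart_point_measurable [measurable]:
  fixes v :: "'e \<Rightarrow> 'a::euclidean_space"
  assumes "finite I"
  shows "(\<lambda>x. \<Sum>e\<in>I. x e *\<^sub>R v e) \<in> borel_measurable (Pi\<^sub>M I (\<lambda>_. lborel :: real measure))"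
proof (intro borel_measurable_sum borel_measurable_scaleR borel_measurable_const)
  fix e assume "e \<in> I"
  then show "(\<lambda>x. x e) \<in> borel_measurable (Pi\<^sub>M I (\<lambda>_. lborel :: real measure))"
    using measurable_component_singleton[of e I "\<lambda>_. lborel :: real measure"] by simp
qed

lemma chart_integral_empty [simp]: "chart_integral {} p v F = F p"
proof -
  have "emeasure (Pi\<^sub>M {} (\<lambda>_. lborel :: real measure)) {\<lambda>_. undefined} = 1"
    using lborel_product.emeasure_PiM[of "{}" "\<lambda>_. {}"] by simp
  then show ?thesis
    by (simp add: chart_integral_def PiM_empty nn_integral_count_space_finite)
qed

lemma sum_insert_update:
  assumes "finite I" "i \<notin> I"
  shows "(\<Sum>e\<in>insert i I. (x(i := s)) e *\<^sub>R v e) = s *\<^sub>R v i + (\<Sum>e\<in>I. x e *\<^sub>R v e)"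
proof -
  have "(\<Sum>e\<in>I. (x(i := s)) e *\<^sub>R v e) = (\<Sum>e\<in>I. x e *\<^sub>R v e)"
    using assms by (intro sum.cong) auto
  then show ?thesis using assms by simp
qed

lemma chart_integral_insert_outer:
  assumes I: "finite I" "i \<notin> I" and F[measurable]: "F \<in> borel_measurable borel"
  shows "chart_integral (insert i I) p v F =
    (\<integral>\<^sup>+s. chart_integral I (p + s *\<^sub>R v i) v F \<partial>lborel)"
proof -
  note [measurable] = chart_point_measurable[OF I(1)] chart_point_measurable[of "insert i I"]
  have "chart_integral (insert i I) p v F =
    (\<integral>\<^sup>+s. \<integral>\<^sup>+x. F (p + (\<Sum>e\<in>insert i I. (x(i := s)) e *\<^sub>R v e)) \<partial>Pi\<^sub>M I (\<lambda>_. lborel) \<partial>lborel)"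
    unfolding chart_integral_def
    by (rule lborel_product.product_nn_integral_insert_rev) (use I in measurable)
  then show ?thesis
    unfolding sum_insert_update[OF I] chart_integral_def by (simp add: add.assoc)
qed

lemma chart_integral_insert_inner:
  assumes I: "finite I" "i \<notin> I" and F[measurable]: "F \<in> borel_measurable borel"
  shows "chart_integral (insert i I) p v F =
    (\<integral>\<^sup>+x. \<integral>\<^sup>+s. F (p + (\<Sum>e\<in>I. x e *\<^sub>R v e) + s *\<^sub>R v i) \<partial>lborel \<partial>Pi\<^sub>M I (\<lambda>_. lborel))"
proof -
  note [measurable] = chart_point_measurable[of "insert i I"]
  have "chart_integral (insert i I) p v F =
    (\<integral>\<^sup>+x. \<integral>\<^sup>+s. F (p + (\<Sum>e\<in>insert i I. (x(i := s)) e *\<^sub>R v e)) \<partial>lborel \<partial>Pi\<^sub>M I (\<lambda>_. lborel))"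
    unfolding chart_integral_def
    by (rule lborel_product.product_nn_integral_insert) (use I in measurable)
  then show ?thesis
    unfolding sum_insert_update[OF I] by (simp add: add_ac)
qed

lemma nn_integral_lborel_shift:
  fixes F :: "real \<Rightarrow> ennreal"
  assumes "F \<in> borel_measurable borel" "\<bar>c\<bar> = 1"
  shows "(\<integral>\<^sup>+s. F (t + c * s) \<partial>lborel) = (\<integral>\<^sup>+s. F s \<partial>lborel)"
  using nn_integral_real_affine[OF assms(1), of c t] assms(2) by (auto simp: ac_simps)

lemma chart_integral_translate:
  assumes "finite I" "i \<in> I" and F[measurable]: "F \<in> borel_measurable borel"
  shows "chart_integral I (p + t *\<^sub>R v i) v F = chart_integral I p v F"
proof -
  define J where "J = I - {i}"
  have I: "I = insert i J" and J: "finite J" "i \<notin> J" using assms by (auto simp: J_def)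
  have "(\<integral>\<^sup>+s. F (p + t *\<^sub>R v i + z + s *\<^sub>R v i) \<partial>lborel) = (\<integral>\<^sup>+s. F (p + z + s *\<^sub>R v i) \<partial>lborel)" for z
    using nn_integral_lborel_shift[of "\<lambda>s. F (p + z + s *\<^sub>R v i)" 1 t]
    by (simp add: algebra_simps)
  then show ?thesis
    unfolding I chart_integral_insert_inner[OF J F] by simp
qed

lemma chart_integral_translate_sum:
  assumes "finite I" "F \<in> borel_measurable borel"
  shows "chart_integral I (p + (\<Sum>e\<in>I. t e *\<^sub>R v e)) v F = chart_integral I p v F"
proof -
  have "chart_integral I (p + (\<Sum>e\<in>K. t e *\<^sub>R v e)) v F = chart_integral I p v F" if "K \<subseteq> I" for K
    using finite_subset[OF that assms(1)] that
  proof (induction K rule: finite_induct)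
    case empty
    then show ?case by simp
  next
    case (insert i K)
    have eq: "p + (\<Sum>e\<in>insert i K. t e *\<^sub>R v e) = (p + (\<Sum>e\<in>K. t e *\<^sub>R v e)) + t i *\<^sub>R v i"
      using insert.hyps by (simp add: add_ac)
    show ?case
      unfolding eq using insert chart_integral_translate[OF assms(1) _ assms(2), of i] by simp
  qed
  from this[OF order_refl] show ?thesis .
qed

text \<open>A shear followed by a reflection in one coordinate preserves the measure.\<close>

lemma chart_integral_exchange:
  assumes I: "finite I" "f \<notin> I" "g \<notin> I" and F[measurable]: "F \<in> borel_measurable borel"
    and vg: "v g = c *\<^sub>R v f + (\<Sum>e\<in>I. k e *\<^sub>R v e)" and c: "\<bar>c\<bar> = 1"
  shows "chart_integral (insert g I) p v F = chart_integral (insert f I) p v F"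
proof -
  note [measurable] = chart_point_measurable[OF I(1)]
  have "chart_integral I (p + s *\<^sub>R v g) v F = chart_integral I (p + (0 + c * s) *\<^sub>R v f) v F" for s
  proof -
    have "p + s *\<^sub>R v g = (p + (0 + c * s) *\<^sub>R v f) + (\<Sum>e\<in>I. (s * k e) *\<^sub>R v e)"
      by (simp add: vg scaleR_right_distrib scaleR_sum_right mult.commute)
    then show ?thesis using chart_integral_translate_sum[OF I(1) F] by metis
  qed
  then have "chart_integral (insert g I) p v F =
    (\<integral>\<^sup>+s. chart_integral I (p + (0 + c * s) *\<^sub>R v f) v F \<partial>lborel)"
    using chart_integral_insert_outer[OF I(1,3) F] by simp
  also have "\<dots> = (\<integral>\<^sup>+s. chart_integral I (p + s *\<^sub>R v f) v F \<partial>lborel)"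
  proof (rule nn_integral_lborel_shift[OF _ c])
    interpret sigma_finite_measure "Pi\<^sub>M I (\<lambda>_. lborel :: real measure)"
      by (rule lborel_product.sigma_finite[OF I(1)])
    show "(\<lambda>s. chart_integral I (p + s *\<^sub>R v f) v F) \<in> borel_measurable borel"
      unfolding chart_integral_def by measurable
  qed
  also have "\<dots> = chart_integral (insert f I) p v F"
    using chart_integral_insert_outer[OF I(1,2) F] by simp
  finally show ?thesis .
qed

text \<open>Moving the origin from \<open>a b\<close> to \<open>a f\<close> replaces the barycentric coordinate of \<open>f\<close> by that of
  \<open>b\<close>, which is \<open>1\<close> minus the sum of the others.\<close>

lemma chart_integral_change_origin:
  assumes I: "finite I" "f \<notin> I" "b \<notin> I" and F[measurable]: "F \<in> borel_measurable borel"
  shows "chart_integral (insert f I) (a b) (\<lambda>e. a e - a b) F =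
    chart_integral (insert b I) (a f) (\<lambda>e. a e - a f) F"
proof -
  have "(\<integral>\<^sup>+s. F (a b + (\<Sum>e\<in>I. x e *\<^sub>R (a e - a b)) + s *\<^sub>R (a f - a b)) \<partial>lborel) =
    (\<integral>\<^sup>+s. F (a f + (\<Sum>e\<in>I. x e *\<^sub>R (a e - a f)) + s *\<^sub>R (a b - a f)) \<partial>lborel)" for x :: "'a \<Rightarrow> real"
  proof -
    have eq: "a b + (\<Sum>e\<in>I. x e *\<^sub>R (a e - a b)) + (1 - sum x I + -1 * s) *\<^sub>R (a f - a b) =
      a f + (\<Sum>e\<in>I. x e *\<^sub>R (a e - a f)) + s *\<^sub>R (a b - a f)" for s
      by (simp add: algebra_simps sum_subtractf scaleR_sum_left[symmetric])
    have "(\<lambda>s. F (a b + (\<Sum>e\<in>I. x e *\<^sub>R (a e - a b)) + s *\<^sub>R (a f - a b))) \<in> borel_measurable borel"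
      by measurable
    from nn_integral_lborel_shift[OF this, of "-1" "1 - sum x I"]
    show ?thesis unfolding eq by simp
  qed
  then show ?thesis
    unfolding chart_integral_insert_inner[OF I(1,2) F] chart_integral_insert_inner[OF I(1,3) F] by simp
qed

lemma chart_integral_hyperplane:
  assumes I: "finite I" and ne: "inner y p \<noteq> 0 \<or> (\<exists>e\<in>I. inner y (v e) \<noteq> 0)"
  shows "chart_integral I p v (indicator {z. inner y z = 0}) = 0"
proof (cases "\<exists>e\<in>I. inner y (v e) \<noteq> 0")
  case True
  then obtain i where i: "i \<in> I" "inner y (v i) \<noteq> 0" by blast
  define J where "J = I - {i}"
  have IJ: "I = insert i J" and J: "finite J" "i \<notin> J" using I i by (auto simp: J_def)
  have F: "(indicator {z. inner y z = 0} :: 'b \<Rightarrow> ennreal) \<in> borel_measurable borel"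
    by (intro borel_measurable_indicator) measurable
  have "(\<integral>\<^sup>+s. indicator {z. inner y z = 0} (q + s *\<^sub>R v i) \<partial>lborel) = (0::ennreal)" for q
  proof -
    have "indicator {z. inner y z = 0} (q + s *\<^sub>R v i) =
      (indicator {- inner y q / inner y (v i)} s :: ennreal)" for s :: real
    proof -
      have "inner y (q + s *\<^sub>R v i) = 0 \<longleftrightarrow> s = - inner y q / inner y (v i)"
        using i(2) by (auto simp: inner_right_distrib field_simps add_eq_0_iff)
      then show ?thesis by (simp add: indicator_def)
    qed
    then show ?thesis by simp
  qed
  then show ?thesis unfolding IJ chart_integral_insert_inner[OF J F] by simp
next
  case False
  then have "inner y (p + (\<Sum>e\<in>I. x e *\<^sub>R v e)) = inner y p" for x :: "'a \<Rightarrow> real"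
    by (simp add: inner_right_distrib inner_sum_right)
  then show ?thesis using ne False by (simp add: chart_integral_def)
qed

lemma chart_integral_simplex:
  assumes I: "finite I"
    and mem: "\<And>x. p + (\<Sum>e\<in>I. x e *\<^sub>R v e) \<in> X \<longleftrightarrow> (\<forall>e\<in>I. 0 \<le> x e) \<and> sum x I \<le> 1"
  shows "chart_integral I p v (indicator X) = ennreal (1 / fact (card I))"
proof -
  let ?S = "{x. (\<forall>e\<in>I. 0 \<le> x e) \<and> sum x I \<le> 1} \<inter> space (Pi\<^sub>M I (\<lambda>_. lborel :: real measure))"
  have "?S = Pi\<^sub>E I (\<lambda>_. {0..}) \<inter> (\<lambda>x. sum x I) -` {..1} \<inter> space (Pi\<^sub>M I (\<lambda>_. lborel :: real measure))"
    by (auto simp: space_PiM)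
  also have "\<dots> \<in> sets (Pi\<^sub>M I (\<lambda>_. lborel :: real measure))"
    using I by measurable
  finally have meas: "?S \<in> sets (Pi\<^sub>M I (\<lambda>_. lborel :: real measure))" .
  have "chart_integral I p v (indicator X) =
    (\<integral>\<^sup>+x. indicator ?S x \<partial>Pi\<^sub>M I (\<lambda>_. lborel :: real measure))"
    unfolding chart_integral_def by (intro nn_integral_cong) (auto simp: indicator_def mem)
  also have "\<dots> = emeasure (Pi\<^sub>M I (\<lambda>_. lborel :: real measure)) ?S"
    using meas by simp
  also have "\<dots> = ennreal (1 / fact (card I))"
    using emeasure_std_simplex_aux[OF I, of 1] by simp
  finally show ?thesis .
qed

lemma chart_volume_eq_chart_integral:
  assumes B: "finite B" and X: "X \<in> sets borel"
  shows "chart_volume a B b X =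
    enn2real (chart_integral (B - {b}) (a b) (\<lambda>e. a e - a b) (indicator X))"
proof -
  let ?M = "Pi\<^sub>M (B - {b}) (\<lambda>_. lborel :: real measure)"
  let ?S = "{x \<in> space ?M. a b + (\<Sum>e\<in>B - {b}. x e *\<^sub>R (a e - a b)) \<in> X}"
  note [measurable] = chart_point_measurable[of "B - {b}"]
  have "?S \<in> sets ?M"
    using X B by measurable
  moreover have "chart_integral (B - {b}) (a b) (\<lambda>e. a e - a b) (indicator X) =
    (\<integral>\<^sup>+x. indicator ?S x \<partial>?M)"
    unfolding chart_integral_def by (intro nn_integral_cong) (auto simp: indicator_def)
  ultimately show ?thesis
    by (simp add: chart_volume_def measure_def)
qed

section \<open>Bases of a labelled family of vectors\<close>

text \<open>A basis is a set of labels, because different labels may carry the same vector.\<close>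

definition family_basis :: "('e \<Rightarrow> 'a::euclidean_space) \<Rightarrow> 'e set \<Rightarrow> 'e set \<Rightarrow> bool" where
  "family_basis a F B \<longleftrightarrow> B \<subseteq> F \<and> inj_on a B \<and> independent (a ` B) \<and> a ` F \<subseteq> span (a ` B)"

lemma span_image_iff:
  fixes a :: "'e \<Rightarrow> 'a::real_vector"
  assumes "finite B"
  shows "x \<in> span (a ` B) \<longleftrightarrow> (\<exists>c. x = (\<Sum>e\<in>B. c e *\<^sub>R a e))"
proof
  assume "x \<in> span (a ` B)"
  then show "\<exists>c. x = (\<Sum>e\<in>B. c e *\<^sub>R a e)"
  proof (induction rule: span_induct_alt)
    case base
    show ?case by (intro exI[of _ "\<lambda>_. 0"]) simp
  next
    case (step k z w)
    then obtain c e where c: "w = (\<Sum>e\<in>B. c e *\<^sub>R a e)" and e: "e \<in> B" "z = a e" by blast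
    have "(\<Sum>g\<in>B. (c g + (if g = e then k else 0)) *\<^sub>R a g) =
      (\<Sum>g\<in>B. c g *\<^sub>R a g) + (\<Sum>g\<in>B. if g = e then k *\<^sub>R a e else 0)"
      unfolding sum.distrib[symmetric] by (intro sum.cong) (auto simp: scaleR_left_distrib)
    also have "\<dots> = k *\<^sub>R z + w" using e assms by (simp add: c)
    finally show ?case by metis
  qed
next
  assume "\<exists>c. x = (\<Sum>e\<in>B. c e *\<^sub>R a e)"
  then obtain c where "x = (\<Sum>e\<in>B. c e *\<^sub>R a e)" by blast
  moreover have "(\<Sum>e\<in>B. c e *\<^sub>R a e) \<in> span (a ` B)"
    by (intro span_sum span_scale span_base imageI)
  ultimately show "x \<in> span (a ` B)" by simp
qed

lemma independent_family_iff:
  fixes a :: "'e \<Rightarrow> 'a::real_vector"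
  assumes "finite B"
  shows "inj_on a B \<and> independent (a ` B) \<longleftrightarrow>
    (\<forall>c. (\<Sum>e\<in>B. c e *\<^sub>R a e) = 0 \<longrightarrow> (\<forall>e\<in>B. c e = 0))"
proof (intro iffI allI impI ballI)
  fix c e
  assume ind: "inj_on a B \<and> independent (a ` B)" and c: "(\<Sum>e\<in>B. c e *\<^sub>R a e) = 0" and e: "e \<in> B"
  define u where "u = (\<lambda>x. c (the_inv_into B a x))"
  have "(\<Sum>x\<in>a ` B. u x *\<^sub>R x) = (\<Sum>e\<in>B. c e *\<^sub>R a e)"
    using ind by (subst sum.reindex) (auto simp: u_def the_inv_into_f_f intro!: sum.cong)
  then have "u (a e) = 0"
    using ind c e independentD[of "a ` B" "a ` B" u "a e"] assms by auto
  then show "c e = 0" using ind e by (simp add: u_def the_inv_into_f_f)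
next
  assume *: "\<forall>c. (\<Sum>e\<in>B. c e *\<^sub>R a e) = 0 \<longrightarrow> (\<forall>e\<in>B. c e = 0)"
  have inj: "inj_on a B"
  proof (rule inj_onI, rule ccontr)
    fix e g assume eg: "e \<in> B" "g \<in> B" "a e = a g" "e \<noteq> g"
    define c where "c = (\<lambda>x. if x = e then 1 else if x = g then -1 else (0::real))"
    have "(\<Sum>x\<in>B. c x *\<^sub>R a x) = (\<Sum>x\<in>{e, g}. c x *\<^sub>R a x)"
      using eg assms by (intro sum.mono_neutral_right) (auto simp: c_def)
    also have "\<dots> = 0" using eg by (simp add: c_def)
    finally have "c e = 0" using * eg by blast
    then show False by (simp add: c_def)
  qed
  moreover have "independent (a ` B)"
    unfolding independent_explicit_finite_subsets
  proof (intro allI impI ballI)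
    fix S u v assume S: "S \<subseteq> a ` B" "finite S" "(\<Sum>v\<in>S. u v *\<^sub>R v) = 0" "v \<in> S"
    define c where "c = (\<lambda>e. if a e \<in> S then u (a e) else 0)"
    have "(\<Sum>e\<in>B. c e *\<^sub>R a e) = (\<Sum>x\<in>a ` B. (if x \<in> S then u x else 0) *\<^sub>R x)"
      using inj by (subst sum.reindex) (auto simp: c_def)
    also have "\<dots> = (\<Sum>x\<in>S. u x *\<^sub>R x)"
      using S assms by (intro sum.mono_neutral_cong_right) auto
    finally have "\<forall>e\<in>B. c e = 0" using * S by simp
    moreover obtain e where "e \<in> B" "a e = v" using S by blast
    ultimately show "u v = 0" using S(4) by (auto simp: c_def)
  qed
  ultimately show "inj_on a B \<and> independent (a ` B)" by blast
qed

lemma independent_family_unique: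
  fixes a :: "'e \<Rightarrow> 'a::real_vector"
  assumes "finite B" "inj_on a B" "independent (a ` B)"
    and "(\<Sum>e\<in>B. c e *\<^sub>R a e) = (\<Sum>e\<in>B. d e *\<^sub>R a e)" "e \<in> B"
  shows "c e = d e"
proof -
  have "(\<Sum>e\<in>B. (c e - d e) *\<^sub>R a e) = 0"
    using assms(4) by (simp add: scaleR_left_diff_distrib sum_subtractf)
  then show ?thesis using assms independent_family_iff[OF assms(1), of a] by fastforce
qed

lemma family_basis_exists: "\<exists>B. family_basis a F B"
proof -
  obtain S where S: "S \<subseteq> a ` F" "independent S" "a ` F \<subseteq> span S"
    using maximal_independent_subset[of "a ` F"] by metis
  then obtain B where "B \<subseteq> F" "inj_on a B" "S = a ` B"
    by (auto simp: subset_image_inj)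
  then show ?thesis using S unfolding family_basis_def by blast
qed

lemma family_basis_card:
  assumes "family_basis a F B"
  shows "card B = dim (a ` F)"
proof -
  have "card B = card (a ` B)" using assms by (simp add: family_basis_def card_image)
  also have "\<dots> = dim (a ` F)"
    using assms by (intro basis_card_eq_dim) (auto simp: family_basis_def)
  finally show ?thesis .
qed

lemma family_basis_coords:
  assumes "family_basis a F B" "finite F" "e \<in> F"
  obtains c where "a e = (\<Sum>f\<in>B. c f *\<^sub>R a f)"
proof -
  have "finite B" using assms by (auto simp: family_basis_def intro: finite_subset)
  moreover have "a e \<in> span (a ` B)" using assms by (auto simp: family_basis_def)
  ultimately show ?thesis using that span_image_iff by metis
qed

lemma family_basis_exchange:
  assumes B: "family_basis a F B" "finite F" and f: "f \<in> B" and g: "g \<in> F" "g \<notin> B"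
    and ag: "a g = (\<Sum>e\<in>B. c e *\<^sub>R a e)" and cf: "c f \<noteq> 0"
  shows "family_basis a F (insert g (B - {f}))"
proof -
  define B' where "B' = insert g (B - {f})"
  have BF: "B \<subseteq> F" and finB: "finite B"
    using B by (auto simp: family_basis_def intro: finite_subset)
  have B'F: "B' \<subseteq> F" and finB': "finite B'" using BF finB g by (auto simp: B'_def)
  have "a g = c f *\<^sub>R a f + (\<Sum>e\<in>B - {f}. c e *\<^sub>R a e)"
    using ag f finB by (simp add: sum.remove[of B f])
  then have "a f = (1 / c f) *\<^sub>R (a g - (\<Sum>e\<in>B - {f}. c e *\<^sub>R a e))"
    using cf by simp
  moreover have "a g \<in> span (a ` B')" by (auto simp: B'_def intro: span_base)
  moreover have "(\<Sum>e\<in>B - {f}. c e *\<^sub>R a e) \<in> span (a ` B')"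
    by (intro span_sum span_scale span_base) (auto simp: B'_def)
  ultimately have af: "a f \<in> span (a ` B')" by (metis span_diff span_scale)
  have "a ` B \<subseteq> span (a ` B')"
  proof (rule image_subsetI)
    fix e assume "e \<in> B"
    then show "a e \<in> span (a ` B')"
      using af by (cases "e = f") (auto simp: B'_def intro: span_base)
  qed
  then have "span (a ` B) \<subseteq> span (a ` B')" by (intro span_minimal) auto
  then have sp: "a ` F \<subseteq> span (a ` B')" using B by (auto simp: family_basis_def)
  have card: "card B' = dim (a ` F)"
    using family_basis_card[OF B(1)] finB f g
    by (metis B'_def Diff_iff card_Suc_Diff1 card_insert_disjoint finite_Diff)
  have "dim (a ` F) \<le> card (a ` B')"
    using sp finB' by (intro dim_le_card) auto
  then have "card (a ` B') = card B'" using card card_image_le[OF finB', of a] by simp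
  then have inj: "inj_on a B'" by (rule eq_card_imp_inj_on[OF finB'])
  have "independent (a ` B')"
    using sp B'F finB' card \<open>card (a ` B') = card B'\<close>
    by (intro card_le_dim_spanning[of _ "a ` F"]) auto
  then show ?thesis
    using B'F inj sp by (simp add: family_basis_def B'_def)
qed

text \<open>The induction reaches \<open>B'\<close> from \<open>B\<close> by exchanging one element at a time, each time for an element of
  \<open>B'\<close>.\<close>

lemma family_basis_induct:
  assumes fin: "finite F" and B: "family_basis a F B" and B': "family_basis a F B'" and P: "P B"
    and step: "\<And>B f g c. \<lbrakk>family_basis a F B; f \<in> B; g \<in> F; g \<notin> B; a g = (\<Sum>e\<in>B. c e *\<^sub>R a e);
      c f \<noteq> 0; family_basis a F (insert g (B - {f})); P B\<rbrakk> \<Longrightarrow> P (insert g (B - {f}))"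
  shows "P B'"
  using B P
proof (induction "card (B - B')" arbitrary: B rule: less_induct)
  case less
  have finB: "finite B" "finite B'"
    using less.prems(1) B' fin by (auto simp: family_basis_def intro: finite_subset)
  have card: "card B = card B'"
    using family_basis_card less.prems(1) B' by metis
  show ?case
  proof (cases "B' \<subseteq> B")
    case True
    then have "B' = B" using card finB by (metis card_subset_eq)
    then show ?thesis using less.prems by simp
  next
    case False
    then obtain g where g: "g \<in> B'" "g \<notin> B" by blast
    have gF: "g \<in> F" using g B' by (auto simp: family_basis_def)
    obtain c where c: "a g = (\<Sum>e\<in>B. c e *\<^sub>R a e)"
      by (rule family_basis_coords[OF less.prems(1) fin gF])
    have "\<exists>f\<in>B - B'. c f \<noteq> 0"
    proof (rule ccontr)
      assume "\<not> ?thesis"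
      then have "a g = (\<Sum>e\<in>B \<inter> B'. c e *\<^sub>R a e)"
        unfolding c using finB by (intro sum.mono_neutral_right) auto
      also have "\<dots> \<in> span (a ` (B' - {g}))"
        using g by (intro span_sum span_scale span_base) auto
      also have "a ` (B' - {g}) = a ` B' - {a g}"
        using B' g by (auto simp: family_basis_def inj_on_def)
      finally show False
        using B' g by (auto simp: family_basis_def dependent_def)
    qed
    then obtain f where f: "f \<in> B" "f \<notin> B'" "c f \<noteq> 0" by blast
    define B1 where "B1 = insert g (B - {f})"
    have B1: "family_basis a F B1"
      unfolding B1_def by (rule family_basis_exchange[OF less.prems(1) fin f(1) gF g(2) c f(3)])
    have "B1 - B' = (B - B') - {f}" using g f by (auto simp: B1_def)
    then have "card (B1 - B') < card (B - B')"
      using f finB by (metis DiffI card_Diff1_less finite_Diff)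
    moreover have "P B1"
      unfolding B1_def
      by (rule step[OF less.prems(1) f(1) gF g(2) c f(3) B1[unfolded B1_def] less.prems(2)])
    ultimately show ?thesis using less.hyps B1 by blast
  qed
qed

section \<open>Simplices of a unimodular family\<close>

lemma convex_hull_image_iff:
  fixes a :: "'e \<Rightarrow> 'a::real_vector"
  assumes "finite F"
  shows "z \<in> convex hull (a ` F) \<longleftrightarrow>
    (\<exists>u. (\<forall>e\<in>F. 0 \<le> u e) \<and> sum u F = 1 \<and> (\<Sum>e\<in>F. u e *\<^sub>R a e) = z)"
proof
  assume "z \<in> convex hull (a ` F)"
  then obtain u where u: "\<And>x. x \<in> a ` F \<Longrightarrow> 0 \<le> u x" "sum u (a ` F) = 1" "(\<Sum>x\<in>a ` F. u x *\<^sub>R x) = z"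
    using assms by (auto simp: convex_hull_finite)
  obtain U where U: "U \<subseteq> F" "inj_on a U" "a ` F = a ` U"
    using subset_image_inj[of "a ` F" a F] by auto
  define u' where "u' = (\<lambda>e. if e \<in> U then u (a e) else 0)"
  have "sum u' F = sum (\<lambda>e. u (a e)) U"
    using assms U by (intro sum.mono_neutral_cong_right) (auto simp: u'_def)
  also have "\<dots> = 1" using u(2) U by (simp add: sum.reindex)
  finally have "sum u' F = 1" .
  moreover have "(\<Sum>e\<in>F. u' e *\<^sub>R a e) = (\<Sum>e\<in>U. u (a e) *\<^sub>R a e)"
    using assms U by (intro sum.mono_neutral_cong_right) (auto simp: u'_def)
  then have "(\<Sum>e\<in>F. u' e *\<^sub>R a e) = z" using u(3) U by (simp add: sum.reindex)
  moreover have "\<forall>e\<in>F. 0 \<le> u' e" using u(1) by (auto simp: u'_def)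
  ultimately show "\<exists>u. (\<forall>e\<in>F. 0 \<le> u e) \<and> sum u F = 1 \<and> (\<Sum>e\<in>F. u e *\<^sub>R a e) = z" by blast
next
  assume "\<exists>u. (\<forall>e\<in>F. 0 \<le> u e) \<and> sum u F = 1 \<and> (\<Sum>e\<in>F. u e *\<^sub>R a e) = z"
  then obtain u where u: "\<And>e. e \<in> F \<Longrightarrow> 0 \<le> u e" "sum u F = 1" "(\<Sum>e\<in>F. u e *\<^sub>R a e) = z" by blast
  have "(\<Sum>e\<in>F. u e *\<^sub>R a e) \<in> convex hull (a ` F)"
    using assms u by (intro convex_sum convex_convex_hull) (auto intro: hull_inc)
  then show "z \<in> convex hull (a ` F)" by (simp add: u(3))
qed

text \<open>The condition \<open>height\<close> places the vectors on a hyperplane that avoids the origin, so that linear and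
  affine dependences coincide. The condition \<open>unimodular\<close> makes all bases generate the same lattice, so
  that all simplices spanned by bases have the same volume.\<close>

locale unimodular_family =
  fixes a :: "'e \<Rightarrow> 'a::euclidean_space" and F :: "'e set" and h :: 'a
  assumes finite_F: "finite F"
    and height: "e \<in> F \<Longrightarrow> inner h (a e) = 1"
    and unimodular: "\<lbrakk>family_basis a F B; a e = (\<Sum>f\<in>B. c f *\<^sub>R a f); e \<in> F; f \<in> B\<rbrakk>
      \<Longrightarrow> c f \<in> {0, 1, -1}"
begin

abbreviation basis where "basis \<equiv> family_basis a F"

lemma finite_basis: "basis B \<Longrightarrow> finite B"
  using finite_F by (auto simp: family_basis_def intro: finite_subset)

lemma basis_subset: "basis B \<Longrightarrow> B \<subseteq> F"
  by (simp add: family_basis_def)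

lemma sum_coeffs:
  assumes "B \<subseteq> F" "x = (\<Sum>f\<in>B. c f *\<^sub>R a f)"
  shows "inner h x = sum c B"
proof -
  have "inner h x = (\<Sum>f\<in>B. c f * inner h (a f))"
    unfolding assms(2) by (simp add: inner_sum_right)
  also have "\<dots> = sum c B" using assms(1) height by (intro sum.cong) auto
  finally show ?thesis .
qed

abbreviation chart :: "'e set \<Rightarrow> 'e \<Rightarrow> ('a \<Rightarrow> ennreal) \<Rightarrow> ennreal" where
  "chart B b \<equiv> chart_integral (B - {b}) (a b) (\<lambda>e. a e - a b)"

lemma chart_change_origin:
  assumes "finite B" "b \<in> B" "f \<in> B" "G \<in> borel_measurable borel"
  shows "chart B b G = chart B f G"
proof (cases "b = f")
  case False
  define I where "I = B - {b, f}"
  have BI: "B - {b} = insert f I" "B - {f} = insert b I" and I: "finite I" "f \<notin> I" "b \<notin> I"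
    using False assms by (auto simp: I_def)
  show ?thesis unfolding BI by (rule chart_integral_change_origin[OF I assms(4)])
qed simp

text \<open>The coordinates of \<open>a g\<close> add up to 1, so the new axis of the chart is plus or minus the old one modulo
  the axes that stay. With only one vector in the basis there is no axis, and \<open>a g = a f\<close>.\<close>

lemma chart_exchange:
  assumes B: "basis B" and f: "f \<in> B" and g: "g \<in> F" "g \<notin> B"
    and ag: "a g = (\<Sum>e\<in>B. c e *\<^sub>R a e)" and cf: "c f \<noteq> 0" and G: "G \<in> borel_measurable borel"
    and b: "b \<in> B" and b': "b' \<in> insert g (B - {f})"
  shows "chart (insert g (B - {f})) b' G = chart B b G"
proof -
  define B' where "B' = insert g (B - {f})"
  have fin: "finite B" "finite B'" using finite_basis[OF B] by (auto simp: B'_def)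
  have sumc: "sum c B = 1"
    using sum_coeffs[OF basis_subset[OF B] ag] height[OF g(1)] by simp
  have c1: "\<bar>c f\<bar> = 1" using unimodular[OF B ag g(1) f] cf by auto
  show ?thesis
  proof (cases "B = {f}")
    case True
    then have "a g = a f" "b = f" "b' = g" using ag sumc b b' by auto
    then show ?thesis using True g by simp
  next
    case False
    then obtain d where d: "d \<in> B" "d \<noteq> f" using f by blast
    define I where "I = B - {d, f}"
    have I: "finite I" "f \<notin> I" "g \<notin> I" using fin g by (auto simp: I_def)
    have BI: "B - {d} = insert f I" "B' - {d} = insert g I"
      using d f g by (auto simp: I_def B'_def)
    have "a g - a d = (\<Sum>e\<in>B. c e *\<^sub>R (a e - a d))"
      using sumc by (simp add: ag scaleR_right_diff_distrib sum_subtractf scaleR_sum_left[symmetric])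
    also have "\<dots> = c f *\<^sub>R (a f - a d) + (\<Sum>e\<in>I. c e *\<^sub>R (a e - a d))"
    proof -
      have "(\<Sum>e\<in>B. c e *\<^sub>R (a e - a d)) = (\<Sum>e\<in>insert f I. c e *\<^sub>R (a e - a d))"
        using fin d f by (intro sum.mono_neutral_right) (auto simp: I_def)
      then show ?thesis using I by simp
    qed
    finally have "chart B' d G = chart B d G"
      unfolding BI using chart_integral_exchange[OF I G _ c1] by simp
    moreover have "chart B' d G = chart B' b' G"
      using fin d b' G by (intro chart_change_origin) (auto simp: B'_def)
    moreover have "chart B d G = chart B b G"
      using fin d b G by (intro chart_change_origin) auto
    ultimately show ?thesis by (simp add: B'_def)
  qed
qed

lemma chart_independent_of_basis:
  assumes B: "basis B" "b \<in> B" and B': "basis B'" "b' \<in> B'" and G: "G \<in> borel_measurable borel"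
  shows "chart B' b' G = chart B b G"
proof -
  have "\<forall>b'\<in>B'. chart B' b' G = chart B b G"
  proof (rule family_basis_induct[OF finite_F B(1) B'(1)])
    show "\<forall>b'\<in>B. chart B b' G = chart B b G"
      using chart_change_origin[OF finite_basis[OF B(1)] _ B(2) G] by simp
  next
    fix B1 f g c
    assume *: "basis B1" "f \<in> B1" "g \<in> F" "g \<notin> B1" "a g = (\<Sum>e\<in>B1. c e *\<^sub>R a e)" "c f \<noteq> 0"
      "basis (insert g (B1 - {f}))" "\<forall>b'\<in>B1. chart B1 b' G = chart B b G"
    show "\<forall>b'\<in>insert g (B1 - {f}). chart (insert g (B1 - {f})) b' G = chart B b G"
      using chart_exchange[OF *(1-6) G *(2)] bspec[OF *(8,2)] by simp
  qed
  then show ?thesis using B' by blast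
qed

lemma chart_point_eq:
  assumes "finite B" "b \<in> B"
  shows "a b + (\<Sum>e\<in>B - {b}. x e *\<^sub>R (a e - a b)) =
    (\<Sum>e\<in>B. (x(b := 1 - sum x (B - {b}))) e *\<^sub>R a e)"
proof -
  have "(\<Sum>e\<in>B - {b}. (x(b := 1 - sum x (B - {b}))) e *\<^sub>R a e) = (\<Sum>e\<in>B - {b}. x e *\<^sub>R a e)"
    by (intro sum.cong) auto
  moreover have "a b + (\<Sum>e\<in>B - {b}. x e *\<^sub>R (a e - a b)) =
      (1 - sum x (B - {b})) *\<^sub>R a b + (\<Sum>e\<in>B - {b}. x e *\<^sub>R a e)"
    by (simp add: scaleR_right_diff_distrib scaleR_left_diff_distrib sum_subtractf scaleR_sum_left)
  ultimately show ?thesis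
    by (simp add: sum.remove[OF assms])
qed

lemma chart_own_simplex:
  assumes B: "basis B" and b: "b \<in> B"
  shows "chart B b (indicator (convex hull (a ` B))) = ennreal (1 / fact (card B - 1))"
proof -
  have fin: "finite B" by (rule finite_basis[OF B])
  have "a b + (\<Sum>e\<in>B - {b}. x e *\<^sub>R (a e - a b)) \<in> convex hull (a ` B) \<longleftrightarrow>
    (\<forall>e\<in>B - {b}. 0 \<le> x e) \<and> sum x (B - {b}) \<le> 1" for x
  proof -
    define x' where "x' = x(b := 1 - sum x (B - {b}))"
    have x'B: "sum x' B = 1"
    proof -
      have "sum x' (B - {b}) = sum x (B - {b})" by (intro sum.cong) (auto simp: x'_def)
      then show ?thesis using fin b by (simp add: sum.remove[of B b] x'_def)
    qed
    have "(\<Sum>e\<in>B. x' e *\<^sub>R a e) \<in> convex hull (a ` B) \<longleftrightarrow> (\<forall>e\<in>B. 0 \<le> x' e)"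
      unfolding convex_hull_image_iff[OF fin]
    proof
      assume "\<exists>u. (\<forall>e\<in>B. 0 \<le> u e) \<and> sum u B = 1 \<and> (\<Sum>e\<in>B. u e *\<^sub>R a e) = (\<Sum>e\<in>B. x' e *\<^sub>R a e)"
      then obtain u where u: "\<forall>e\<in>B. 0 \<le> u e" "(\<Sum>e\<in>B. u e *\<^sub>R a e) = (\<Sum>e\<in>B. x' e *\<^sub>R a e)" by blast
      then have "u e = x' e" if "e \<in> B" for e
        using independent_family_unique[OF fin _ _ u(2) that] B by (simp add: family_basis_def)
      with u show "\<forall>e\<in>B. 0 \<le> x' e" by simp
    next
      assume "\<forall>e\<in>B. 0 \<le> x' e"
      with x'B show "\<exists>u. (\<forall>e\<in>B. 0 \<le> u e) \<and> sum u B = 1 \<and> (\<Sum>e\<in>B. u e *\<^sub>R a e) = (\<Sum>e\<in>B. x' e *\<^sub>R a e)"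
        by blast
    qed
    also have "(\<forall>e\<in>B. 0 \<le> x' e) \<longleftrightarrow> (\<forall>e\<in>B - {b}. 0 \<le> x e) \<and> sum x (B - {b}) \<le> 1"
      using b by (auto simp: x'_def)
    finally show ?thesis unfolding chart_point_eq[OF fin b] x'_def .
  qed
  from chart_integral_simplex[OF _ this] fin b show ?thesis by simp
qed

lemma simplex_measurable: "finite B \<Longrightarrow> indicator (convex hull (a ` B)) \<in> borel_measurable borel"
  by (intro borel_measurable_indicator borel_compact finite_imp_compact_convex_hull) auto

lemma chart_simplex:
  assumes "basis B" "b \<in> B" "basis B'"
  shows "chart B b (indicator (convex hull (a ` B'))) = ennreal (1 / fact (dim (a ` F) - 1))"
proof -
  have card: "card B = card B'" using assms family_basis_card by metis
  have "B \<noteq> {}" "finite B" using assms finite_basis by auto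
  then have "B' \<noteq> {}" using card finite_basis[OF assms(3)] by auto
  then obtain b' where b': "b' \<in> B'" by blast
  have "chart B b (indicator (convex hull (a ` B'))) = chart B' b' (indicator (convex hull (a ` B')))"
    by (rule chart_independent_of_basis[OF assms(3) b' assms(1,2) simplex_measurable[OF finite_basis[OF assms(3)]]])
  then show ?thesis using chart_own_simplex[OF assms(3) b'] family_basis_card[OF assms(3)] by simp
qed

text \<open>The points that lie on one of finitely many hyperplanes form a null set, so a dissection need only
  be checked away from them.\<close>

lemma chart_dissection:
  assumes B: "basis B" "b \<in> B" and fin: "finite \<T>" "finite Y"
    and bases: "\<And>B'. B' \<in> \<T> \<Longrightarrow> basis B'" and Y: "\<And>y. y \<in> Y \<Longrightarrow> \<exists>e\<in>F. inner y (a e) \<noteq> 0"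
    and dissect: "\<And>z. \<lbrakk>\<And>y. y \<in> Y \<Longrightarrow> inner y z \<noteq> 0\<rbrakk> \<Longrightarrow>
      indicator Q z = (\<Sum>B'\<in>\<T>. indicator (convex hull (a ` B')) z :: ennreal)"
  shows "chart B b (indicator Q) = of_nat (card \<T>) * ennreal (1 / fact (dim (a ` F) - 1))"
proof -
  let ?M = "Pi\<^sub>M (B - {b}) (\<lambda>_. lborel :: real measure)"
  define pt where "pt = (\<lambda>x. a b + (\<Sum>e\<in>B - {b}. x e *\<^sub>R (a e - a b)))"
  have finB: "finite (B - {b})" using finite_basis[OF B(1)] by simp
  note [measurable] = chart_point_measurable[OF finB]
  have pt[measurable]: "pt \<in> borel_measurable ?M" unfolding pt_def by measurable
  have "AE x in ?M. inner y (pt x) \<noteq> 0" if y: "y \<in> Y" for y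
  proof -
    have "inner y (a b) \<noteq> 0 \<or> (\<exists>e\<in>B - {b}. inner y (a e - a b) \<noteq> 0)"
    proof (rule ccontr)
      assume *: "\<not> ?thesis"
      have zero: "inner y (a f) = 0" if "f \<in> B" for f
        using * that by (cases "f = b") (auto simp: inner_diff_right)
      obtain e where e: "e \<in> F" "inner y (a e) \<noteq> 0" using Y[OF y] by blast
      obtain c where "a e = (\<Sum>f\<in>B. c f *\<^sub>R a f)" by (rule family_basis_coords[OF B(1) finite_F e(1)])
      then have "inner y (a e) = 0" using zero by (simp add: inner_sum_right)
      with e show False by simp
    qed
    from chart_integral_hyperplane[OF finB this]
    have "(\<integral>\<^sup>+x. indicator {z. inner y z = 0} (pt x) \<partial>?M) = 0"
      by (simp add: chart_integral_def pt_def)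
    then have "AE x in ?M. (indicator {z. inner y z = 0} (pt x) :: ennreal) = 0"
      by (subst (asm) nn_integral_0_iff_AE) measurable
    then show ?thesis by (auto simp: indicator_def split: if_splits)
  qed
  then have "AE x in ?M. \<forall>y\<in>Y. inner y (pt x) \<noteq> 0"
    using fin(2) by (simp add: AE_finite_all)
  then have "AE x in ?M. indicator Q (pt x) = (\<Sum>B'\<in>\<T>. indicator (convex hull (a ` B')) (pt x) :: ennreal)"
    by (rule AE_mp) (intro AE_I2 impI dissect, blast)
  then have "chart B b (indicator Q) =
    (\<integral>\<^sup>+x. (\<Sum>B'\<in>\<T>. indicator (convex hull (a ` B')) (pt x)) \<partial>?M)"
    unfolding chart_integral_def pt_def by (intro nn_integral_cong_AE)
  also have "\<dots> = (\<Sum>B'\<in>\<T>. chart B b (indicator (convex hull (a ` B'))))"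
  proof -
    have "(\<lambda>x. indicator (convex hull (a ` B')) (pt x) :: ennreal) \<in> borel_measurable ?M"
      if "B' \<in> \<T>" for B'
      using measurable_compose[OF pt simplex_measurable[OF finite_basis[OF bases[OF that]]]] .
    then show ?thesis
      by (simp add: nn_integral_sum chart_integral_def pt_def)
  qed
  also have "\<dots> = (\<Sum>B'\<in>\<T>. ennreal (1 / fact (dim (a ` F) - 1)))"
    using chart_simplex[OF B] bases by (intro sum.cong) auto
  finally show ?thesis by simp
qed

end

section \<open>Dissection of the root polytope by lower facets\<close>

lemma nonneg_after_small_step:
  fixes u d :: "'e \<Rightarrow> real"
  assumes "finite F" "\<And>e. e \<in> F \<Longrightarrow> 0 \<le> u e" "\<And>e. e \<in> F \<Longrightarrow> u e = 0 \<Longrightarrow> 0 \<le> d e"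
  shows "\<exists>\<epsilon>>0. \<forall>e\<in>F. 0 \<le> u e + \<epsilon> * d e"
proof -
  have "\<exists>\<epsilon>>0. \<forall>\<delta>. 0 < \<delta> \<and> \<delta> \<le> \<epsilon> \<longrightarrow> (\<forall>e\<in>F. 0 \<le> u e + \<delta> * d e)"
    using assms
  proof (induction F rule: finite_induct)
    case empty
    show ?case by (intro exI[of _ 1]) simp
  next
    case (insert i F)
    then obtain \<epsilon> where \<epsilon>: "\<epsilon> > 0" "\<And>\<delta> e. 0 < \<delta> \<Longrightarrow> \<delta> \<le> \<epsilon> \<Longrightarrow> e \<in> F \<Longrightarrow> 0 \<le> u e + \<delta> * d e"
      by auto
    have "\<exists>\<eta>>0. \<forall>\<delta>. 0 < \<delta> \<and> \<delta> \<le> \<eta> \<longrightarrow> 0 \<le> u i + \<delta> * d i"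
    proof (cases "0 \<le> d i")
      case True
      then show ?thesis using insert.prems(1)[of i] by (intro exI[of _ 1]) simp
    next
      case False
      then have ui: "u i > 0" using insert.prems(1,2)[of i] by (cases "u i = 0") auto
      have "0 \<le> u i + \<delta> * d i" if "0 < \<delta>" "\<delta> \<le> u i / (- d i)" for \<delta>
        using that False by (simp add: field_simps)
      moreover have "u i / (- d i) > 0" using ui False by (simp add: field_simps)
      ultimately show ?thesis by blast
    qed
    then obtain \<eta> where \<eta>: "\<eta> > 0" "\<And>\<delta>. 0 < \<delta> \<Longrightarrow> \<delta> \<le> \<eta> \<Longrightarrow> 0 \<le> u i + \<delta> * d i" by blast
    show ?case
      using \<epsilon> \<eta> by (intro exI[of _ "min \<epsilon> \<eta>"]) auto
  qed
  then show ?thesis by blast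
qed

text \<open>The linear program has an optimal solution because its feasible set is compact.\<close>

lemma exists_min_cost_representation:
  fixes a :: "'e \<Rightarrow> 'a::euclidean_space" and w :: "'e \<Rightarrow> real"
  assumes "finite F" "z \<in> convex hull (a ` F)"
  shows "\<exists>u. (\<forall>e\<in>F. 0 \<le> u e) \<and> sum u F = 1 \<and> (\<Sum>e\<in>F. u e *\<^sub>R a e) = z \<and>
    (\<forall>u'. (\<forall>e\<in>F. 0 \<le> u' e) \<and> sum u' F = 1 \<and> (\<Sum>e\<in>F. u' e *\<^sub>R a e) = z \<longrightarrow>
      (\<Sum>e\<in>F. u e * w e) \<le> (\<Sum>e\<in>F. u' e * w e))"
proof -
  define P where "P = Pi\<^sub>E UNIV (\<lambda>e. if e \<in> F then {0..1::real} else {0})"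
  define K where "K = P \<inter> ({u. (\<Sum>e\<in>F. u e *\<^sub>R a e) = z} \<inter> {u. sum u F = 1})"
  have coord: "continuous_on UNIV (\<lambda>u. u e :: real)" for e :: 'e
    by (rule continuous_on_product_coordinates)
  have "compactin (product_topology (\<lambda>_. euclidean) UNIV) P"
    unfolding P_def compactin_PiE by auto
  then have "compact P" by (simp add: euclidean_product_topology)
  moreover have "closed {u. (\<Sum>e\<in>F. u e *\<^sub>R a e) = z}" "closed {u. sum u F = (1::real)}"
    by (intro closed_Collect_eq continuous_on_sum continuous_on_scaleR coord continuous_on_const)+
  ultimately have "compact K" unfolding K_def by (intro compact_Int_closed closed_Int)
  have inK: "(\<lambda>e. if e \<in> F then u e else 0) \<in> K"
    if u: "\<forall>e\<in>F. 0 \<le> u e" "sum u F = 1" "(\<Sum>e\<in>F. u e *\<^sub>R a e) = z" for u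
  proof -
    have "u e \<le> 1" if "e \<in> F" for e
      using member_le_sum[OF that, of u] u(1,2) assms(1) by simp
    then have "(if e \<in> F then u e else 0) \<in> (if e \<in> F then {0..1} else {0})" for e
      using u(1) by simp
    then have "(\<lambda>e. if e \<in> F then u e else 0) \<in> P" unfolding P_def by (intro PiE_I) simp_all
    moreover have "(\<Sum>e\<in>F. (if e \<in> F then u e else 0) *\<^sub>R a e) = z"
      unfolding u(3)[symmetric] by (intro sum.cong) simp_all
    moreover have "(\<Sum>e\<in>F. if e \<in> F then u e else 0) = 1"
      unfolding u(2)[symmetric] by (intro sum.cong) simp_all
    ultimately show ?thesis by (simp only: K_def Int_iff mem_Collect_eq simp_thms)
  qed
  have "K \<noteq> {}"
    using inK assms(2) unfolding convex_hull_image_iff[OF assms(1)] by blast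
  moreover have "continuous_on K (\<lambda>u. \<Sum>e\<in>F. u e * w e)"
    by (intro continuous_on_sum continuous_on_mult continuous_on_const
      continuous_on_subset[OF coord subset_UNIV])
  ultimately obtain u where u: "u \<in> K" "\<And>u'. u' \<in> K \<Longrightarrow> (\<Sum>e\<in>F. u e * w e) \<le> (\<Sum>e\<in>F. u' e * w e)"
    using continuous_attains_inf[OF \<open>compact K\<close>] by blast
  have "0 \<le> u e" if "e \<in> F" for e
  proof -
    have "u e \<in> (if e \<in> F then {0..1} else {0})"
      using u(1) unfolding K_def P_def by (blast intro: PiE_mem)
    then show ?thesis using that by simp
  qed
  moreover have "sum u F = 1" "(\<Sum>e\<in>F. u e *\<^sub>R a e) = z" using u(1) by (auto simp: K_def)
  moreover have "(\<Sum>e\<in>F. u e * w e) \<le> (\<Sum>e\<in>F. u' e * w e)"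
    if u': "\<forall>e\<in>F. 0 \<le> u' e" "sum u' F = 1" "(\<Sum>e\<in>F. u' e *\<^sub>R a e) = z" for u'
  proof -
    have "(\<Sum>e\<in>F. (if e \<in> F then u' e else 0) * w e) = (\<Sum>e\<in>F. u' e * w e)"
      by (intro sum.cong) simp_all
    then show ?thesis using u(2)[OF inK[OF u']] by simp
  qed
  ultimately show ?thesis by blast
qed

lemma exists_separating_normal:
  fixes S :: "'a::euclidean_space set"
  assumes "S \<subseteq> T" "\<not> T \<subseteq> span S"
  shows "\<exists>y. (\<forall>x\<in>span S. inner y x = 0) \<and> (\<exists>x\<in>T. inner y x \<noteq> 0)"
proof -
  have "span S \<subset> span T"
    using assms span_mono[OF assms(1)] span_superset[of T] by blast
  then obtain y where y: "y \<noteq> 0" "y \<in> span T" "\<And>x. x \<in> span S \<Longrightarrow> Linear_Algebra.orthogonal y x"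
    by (erule orthogonal_to_subspace_exists_gen)
  have "\<exists>x\<in>T. inner y x \<noteq> 0"
  proof (rule ccontr)
    assume "\<not> ?thesis"
    then have "\<And>x. x \<in> T \<Longrightarrow> Linear_Algebra.orthogonal y x" by (auto simp: Linear_Algebra.orthogonal_def)
    then have "Linear_Algebra.orthogonal y y" by (rule orthogonal_to_span[OF y(2)])
    then show False using y(1) by (simp add: Linear_Algebra.orthogonal_def)
  qed
  then show ?thesis using y(3) by (auto simp: Linear_Algebra.orthogonal_def)
qed

context unimodular_family
begin

text \<open>The coordinates \<open>c\<close> of \<open>a e\<close> in a basis are unique, and \<open>w e\<close> minus the cost of \<open>c\<close> is what linear
  programming calls the reduced cost of \<open>e\<close>.\<close>

definition generic_cost :: "('e \<Rightarrow> real) \<Rightarrow> bool" where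
  "generic_cost w \<longleftrightarrow> (\<forall>B e c. basis B \<longrightarrow> e \<in> F - B \<longrightarrow> a e = (\<Sum>f\<in>B. c f *\<^sub>R a f) \<longrightarrow>
     (\<Sum>f\<in>B. c f * w f) \<noteq> w e)"

text \<open>If every vector \<open>a e\<close> is lifted to height \<open>w e\<close> in an additional direction, these bases are the
  simplicial facets of the lifted polytope that are visible from below and contain no other lifted
  vector.\<close>

definition lower_basis :: "('e \<Rightarrow> real) \<Rightarrow> 'e set \<Rightarrow> bool" where
  "lower_basis w B \<longleftrightarrow> basis B \<and> (\<forall>e c. e \<in> F - B \<longrightarrow> a e = (\<Sum>f\<in>B. c f *\<^sub>R a f) \<longrightarrow>
     (\<Sum>f\<in>B. c f * w f) < w e)"

definition generic_point :: "'a \<Rightarrow> bool" where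
  "generic_point z \<longleftrightarrow> (\<forall>I\<subseteq>F. z \<in> span (a ` I) \<longrightarrow> a ` F \<subseteq> span (a ` I))"

text \<open>Moving weight onto \<open>e\<close> along its expression in the basis keeps the represented point and changes
  the cost at the rate of the reduced cost of \<open>e\<close>.\<close>

lemma pivot_direction:
  assumes B: "basis B" and e: "e \<in> F - B" and c: "a e = (\<Sum>f\<in>B. c f *\<^sub>R a f)"
    and d_def: "d = (\<lambda>g. if g = e then 1 else if g \<in> B then - c g else 0)"
  shows "sum d F = 0" "(\<Sum>g\<in>F. d g *\<^sub>R a g) = 0"
    "(\<Sum>g\<in>F. d g * w g) = w e - (\<Sum>f\<in>B. c f * w f)"
proof -
  have split: "(\<Sum>g\<in>F. \<phi> g) = \<phi> e + (\<Sum>g\<in>B. \<phi> g)"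
    if "\<And>g. g \<in> F - insert e B \<Longrightarrow> \<phi> g = 0" for \<phi> :: "'e \<Rightarrow> 'b::comm_monoid_add"
  proof -
    have "(\<Sum>g\<in>F. \<phi> g) = (\<Sum>g\<in>insert e B. \<phi> g)"
      using basis_subset[OF B] e that finite_F by (intro sum.mono_neutral_right) auto
    then show ?thesis using e finite_basis[OF B] by simp
  qed
  have dB: "g \<in> B \<Longrightarrow> d g = - c g" for g using e by (auto simp: d_def)
  have de: "d e = 1" by (simp add: d_def)
  have d0: "d g = 0" if "g \<in> F - insert e B" for g using that by (simp add: d_def)
  have "sum c B = 1"
    using sum_coeffs[OF basis_subset[OF B] c] height e by simp
  then show "sum d F = 0"
    using split[of d] d0 by (simp add: de dB sum_negf cong: sum.cong)
  show "(\<Sum>g\<in>F. d g *\<^sub>R a g) = 0"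
    using split[of "\<lambda>g. d g *\<^sub>R a g"] d0 by (simp add: de dB sum_negf c cong: sum.cong)
  show "(\<Sum>g\<in>F. d g * w g) = w e - (\<Sum>f\<in>B. c f * w f)"
    using split[of "\<lambda>g. d g * w g"] d0 by (simp add: de dB sum_negf cong: sum.cong)
qed

text \<open>Take a representation of \<open>z\<close> of least cost. Its support spans, as \<open>z\<close> is generic. If it
  contained an element outside of a basis, the cost would change along the corresponding pivot
  direction, because it is generic, and decrease along that direction or its negative. So the support
  is a basis, and optimality makes its reduced costs positive.\<close>

lemma lower_basis_covers:
  assumes w: "generic_cost w" and z: "z \<in> convex hull (a ` F)" "generic_point z"
  shows "\<exists>B. lower_basis w B \<and> z \<in> convex hull (a ` B)"
proof -
  obtain u where u: "\<forall>e\<in>F. 0 \<le> u e" "sum u F = 1" "(\<Sum>e\<in>F. u e *\<^sub>R a e) = z"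
    and min: "\<And>u'. \<lbrakk>\<forall>e\<in>F. 0 \<le> u' e; sum u' F = 1; (\<Sum>e\<in>F. u' e *\<^sub>R a e) = z\<rbrakk>
       \<Longrightarrow> (\<Sum>e\<in>F. u e * w e) \<le> (\<Sum>e\<in>F. u' e * w e)"
    using exists_min_cost_representation[OF finite_F z(1), of w] by blast
  have no_descent: "0 \<le> (\<Sum>g\<in>F. d g * w g)"
    if d: "sum d F = 0" "(\<Sum>g\<in>F. d g *\<^sub>R a g) = 0" "\<And>g. g \<in> F \<Longrightarrow> u g = 0 \<Longrightarrow> 0 \<le> d g" for d
  proof -
    obtain \<epsilon> where \<epsilon>: "\<epsilon> > 0" "\<forall>e\<in>F. 0 \<le> u e + \<epsilon> * d e"
      using nonneg_after_small_step[OF finite_F, of u d] u(1) d(3) by blast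
    have "(\<Sum>e\<in>F. u e * w e) \<le> (\<Sum>e\<in>F. (u e + \<epsilon> * d e) * w e)"
    proof (rule min)
      show "(\<Sum>e\<in>F. u e + \<epsilon> * d e) = 1"
        using u(2) d(1) by (simp add: sum.distrib sum_distrib_left[symmetric])
      have "(\<Sum>e\<in>F. (u e + \<epsilon> * d e) *\<^sub>R a e) = (\<Sum>e\<in>F. u e *\<^sub>R a e) + \<epsilon> *\<^sub>R (\<Sum>e\<in>F. d e *\<^sub>R a e)"
        by (simp add: scaleR_left_distrib sum.distrib scaleR_sum_right)
      then show "(\<Sum>e\<in>F. (u e + \<epsilon> * d e) *\<^sub>R a e) = z" using u(3) d(2) by simp
    qed (use \<epsilon> in auto)
    also have "\<dots> = (\<Sum>e\<in>F. u e * w e) + \<epsilon> * (\<Sum>e\<in>F. d e * w e)"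
      by (simp add: distrib_right sum.distrib sum_distrib_left mult.assoc)
    finally show ?thesis using \<epsilon>(1) by (simp add: zero_le_mult_iff)
  qed
  define I where "I = {e\<in>F. u e \<noteq> 0}"
  have IF: "I \<subseteq> F" by (auto simp: I_def)
  have zI: "z = (\<Sum>e\<in>I. u e *\<^sub>R a e)"
    unfolding u(3)[symmetric] using finite_F by (intro sum.mono_neutral_right) (auto simp: I_def)
  then have "z \<in> span (a ` I)" by (auto intro!: span_sum span_scale intro: span_base)
  then have spI: "a ` F \<subseteq> span (a ` I)" using z(2) IF by (auto simp: generic_point_def)
  obtain B where B: "family_basis a I B" using family_basis_exists by blast
  have BI: "B \<subseteq> I" using B by (simp add: family_basis_def)
  have "span (a ` I) \<subseteq> span (a ` B)" using B by (intro span_minimal) (auto simp: family_basis_def)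
  then have bB: "basis B" using B IF spI by (auto simp: family_basis_def)
  have IB: "I = B"
  proof (rule ccontr)
    assume "I \<noteq> B"
    then obtain e where e: "e \<in> I" "e \<notin> B" using BI by blast
    have eF: "e \<in> F - B" using e IF by blast
    obtain c where c: "a e = (\<Sum>f\<in>B. c f *\<^sub>R a f)"
      by (rule family_basis_coords[OF bB finite_F]) (use eF in auto)
    define d where "d = (\<lambda>g. if g = e then 1 else if g \<in> B then - c g else 0)"
    note d = pivot_direction[OF bB eF c d_def]
    have supp: "d g = 0" if "g \<in> F" "u g = 0" for g
      using that e BI by (auto simp: d_def I_def)
    have "0 \<le> (\<Sum>g\<in>F. d g * w g)"
      by (rule no_descent) (use d supp in auto)
    moreover have "0 \<le> (\<Sum>g\<in>F. - d g * w g)"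
      by (rule no_descent) (use d supp in \<open>auto simp: sum_negf\<close>)
    ultimately have "w e - (\<Sum>f\<in>B. c f * w f) = 0"
      using d(3)[of w] by (simp add: sum_negf)
    moreover have "(\<Sum>f\<in>B. c f * w f) \<noteq> w e" using w bB eF c unfolding generic_cost_def by blast
    ultimately show False by simp
  qed
  have "(\<Sum>f\<in>B. c f * w f) < w e" if e: "e \<in> F - B" and c: "a e = (\<Sum>f\<in>B. c f *\<^sub>R a f)" for e c
  proof -
    define d where "d = (\<lambda>g. if g = e then 1 else if g \<in> B then - c g else 0)"
    note d = pivot_direction[OF bB e c d_def]
    have "0 \<le> (\<Sum>g\<in>F. d g * w g)"
    proof (rule no_descent[OF d(1,2)])
      fix g assume "g \<in> F" "u g = 0"
      then have "g \<notin> B" using IB by (auto simp: I_def)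
      then show "0 \<le> d g" by (simp add: d_def)
    qed
    then have "(\<Sum>f\<in>B. c f * w f) \<le> w e" using d(3)[of w] by simp
    moreover have "(\<Sum>f\<in>B. c f * w f) \<noteq> w e" using w bB e c unfolding generic_cost_def by blast
    ultimately show ?thesis by simp
  qed
  then have "lower_basis w B" using bB by (auto simp: lower_basis_def)
  moreover have "z \<in> convex hull (a ` B)"
    unfolding convex_hull_image_iff[OF finite_basis[OF bB]]
  proof (intro exI[of _ u] conjI)
    show "\<forall>e\<in>B. 0 \<le> u e" using u(1) basis_subset[OF bB] by blast
    have "sum u B = sum u F"
      unfolding IB[symmetric] using finite_F by (intro sum.mono_neutral_left) (auto simp: I_def)
    then show "sum u B = 1" using u(2) by simp
    show "(\<Sum>e\<in>B. u e *\<^sub>R a e) = z" using zI IB by simp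
  qed
  ultimately show ?thesis by blast
qed

lemma generic_point_coeff_nonzero:
  assumes B: "basis B" and z: "generic_point z" "z = (\<Sum>e\<in>B. u e *\<^sub>R a e)" and f: "f \<in> B"
  shows "u f \<noteq> 0"
proof
  assume "u f = 0"
  then have "z = (\<Sum>e\<in>B - {f}. u e *\<^sub>R a e)"
    unfolding z(2) using finite_basis[OF B] by (intro sum.mono_neutral_right) auto
  then have "z \<in> span (a ` (B - {f}))" by (auto intro!: span_sum span_scale intro: span_base)
  then have "a ` F \<subseteq> span (a ` (B - {f}))"
    using z(1) basis_subset[OF B] unfolding generic_point_def by (meson Diff_subset order_trans)
  then have "a f \<in> span (a ` (B - {f}))" using f basis_subset[OF B] by blast
  moreover have "a ` (B - {f}) = a ` B - {a f}"
    using B f by (auto simp: family_basis_def inj_on_def)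
  ultimately show False using B f by (auto simp: family_basis_def dependent_def)
qed

text \<open>Expressing the vectors of \<open>B'\<close> in the basis \<open>B\<close> shows that the two costs differ by a nonnegative
  combination of reduced costs, in which some element of \<open>B' - B\<close> has a positive coefficient.\<close>

lemma lower_basis_cost_less:
  assumes B: "lower_basis w B" and B': "basis B'" "B' \<noteq> B" and z: "generic_point z"
    and u: "z = (\<Sum>e\<in>B. u e *\<^sub>R a e)"
    and u': "z = (\<Sum>e\<in>B'. u' e *\<^sub>R a e)" "\<And>e. e \<in> B' \<Longrightarrow> 0 \<le> u' e"
  shows "(\<Sum>e\<in>B. u e * w e) < (\<Sum>e\<in>B'. u' e * w e)"
proof -
  have bB: "basis B" using B by (simp add: lower_basis_def)
  note finB = finite_basis[OF bB] and finB' = finite_basis[OF B'(1)]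
  have "\<exists>c. a e = (\<Sum>f\<in>B. c f *\<^sub>R a f) \<and> (e \<in> B \<longrightarrow> c = (\<lambda>f. of_bool (f = e)))" if "e \<in> B'" for e
  proof (cases "e \<in> B")
    case True
    have "(\<Sum>f\<in>B. of_bool (f = e) *\<^sub>R a f) = (\<Sum>f\<in>B. if f = e then a f else 0)"
      by (intro sum.cong) auto
    then show ?thesis using True finB by auto
  next
    case False
    have "e \<in> F" using that basis_subset[OF B'(1)] by blast
    then show ?thesis using family_basis_coords[OF bB finite_F] False by metis
  qed
  then obtain c where c: "\<And>e. e \<in> B' \<Longrightarrow> a e = (\<Sum>f\<in>B. c e f *\<^sub>R a f)"
    and c_own: "\<And>e. e \<in> B' \<Longrightarrow> e \<in> B \<Longrightarrow> c e = (\<lambda>f. of_bool (f = e))"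
    by metis
  define r where "r = (\<lambda>e. w e - (\<Sum>f\<in>B. c e f * w f))"
  have r_pos: "r e > 0" if "e \<in> B'" "e \<notin> B" for e
  proof -
    have "e \<in> F - B" using that basis_subset[OF B'(1)] by blast
    then show ?thesis using B c[OF that(1)] unfolding lower_basis_def r_def by fastforce
  qed
  have r_zero: "r e = 0" if "e \<in> B'" "e \<in> B" for e
  proof -
    have "(\<Sum>f\<in>B. of_bool (f = e) * w f) = (\<Sum>f\<in>B. if f = e then w f else 0)"
      by (intro sum.cong) auto
    then show ?thesis using that finB by (simp add: r_def c_own)
  qed
  have "z = (\<Sum>e\<in>B'. u' e *\<^sub>R (\<Sum>f\<in>B. c e f *\<^sub>R a f))"
    unfolding u'(1) using c by (intro sum.cong) auto
  also have "\<dots> = (\<Sum>e\<in>B'. \<Sum>f\<in>B. (u' e * c e f) *\<^sub>R a f)" by (simp add: scaleR_sum_right)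
  also have "\<dots> = (\<Sum>f\<in>B. (\<Sum>e\<in>B'. u' e * c e f) *\<^sub>R a f)"
    by (subst sum.swap) (simp add: scaleR_sum_left)
  finally have coeff: "u f = (\<Sum>e\<in>B'. u' e * c e f)" if "f \<in> B" for f
    using independent_family_unique[OF finB, of a u] bB that u by (simp add: family_basis_def)
  have "(\<Sum>e\<in>B'. u' e * w e) = (\<Sum>e\<in>B'. u' e * r e) + (\<Sum>e\<in>B'. \<Sum>f\<in>B. u' e * c e f * w f)"
    by (simp add: r_def right_diff_distrib sum_subtractf sum_distrib_left mult.assoc)
  also have "(\<Sum>e\<in>B'. \<Sum>f\<in>B. u' e * c e f * w f) = (\<Sum>f\<in>B. u f * w f)"
    by (subst sum.swap) (simp add: coeff sum_distrib_right)
  finally have cost: "(\<Sum>e\<in>B'. u' e * w e) = (\<Sum>e\<in>B'. u' e * r e) + (\<Sum>f\<in>B. u f * w f)" .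
  have "card B = card B'" using family_basis_card bB B'(1) by metis
  then have "\<not> B' \<subseteq> B" using B'(2) finB card_subset_eq by metis
  then obtain e where e: "e \<in> B'" "e \<notin> B" by blast
  have "u' e > 0" using generic_point_coeff_nonzero[OF B'(1) z u'(1) e(1)] u'(2)[OF e(1)] by simp
  then have "0 < u' e * r e" using r_pos[OF e] by simp
  moreover have "0 \<le> u' g * r g" if "g \<in> B'" for g
    using u'(2)[OF that] r_pos[OF that] r_zero[OF that] by (cases "g \<in> B") auto
  ultimately have "0 < (\<Sum>e\<in>B'. u' e * r e)"
    using finB' e(1) by (intro sum_pos2) auto
  then show ?thesis using cost by simp
qed

lemma lower_basis_unique:
  assumes "lower_basis w B" "z \<in> convex hull (a ` B)" "lower_basis w B'" "z \<in> convex hull (a ` B')"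
    and z: "generic_point z"
  shows "B = B'"
proof (rule ccontr)
  assume ne: "B \<noteq> B'"
  have b: "basis B" "basis B'" using assms by (auto simp: lower_basis_def)
  obtain u where u: "\<forall>e\<in>B. 0 \<le> u e" "(\<Sum>e\<in>B. u e *\<^sub>R a e) = z"
    using assms(2) convex_hull_image_iff[OF finite_basis[OF b(1)]] by blast
  obtain u' where u': "\<forall>e\<in>B'. 0 \<le> u' e" "(\<Sum>e\<in>B'. u' e *\<^sub>R a e) = z"
    using assms(4) convex_hull_image_iff[OF finite_basis[OF b(2)]] by blast
  have "(\<Sum>e\<in>B. u e * w e) < (\<Sum>e\<in>B'. u' e * w e)"
    by (rule lower_basis_cost_less[OF assms(1) b(2) ne[symmetric] z]) (use u u' in auto)
  moreover have "(\<Sum>e\<in>B'. u' e * w e) < (\<Sum>e\<in>B. u e * w e)"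
    by (rule lower_basis_cost_less[OF assms(3) b(1) ne z]) (use u u' in auto)
  ultimately show False by simp
qed

theorem chart_root_polytope:
  assumes w: "generic_cost w" and B: "basis B" "b \<in> B"
  shows "chart B b (indicator (convex hull (a ` F))) =
    of_nat (card {B'. lower_basis w B'}) * ennreal (1 / fact (dim (a ` F) - 1))"
proof -
  define \<I> where "\<I> = {I. I \<subseteq> F \<and> \<not> a ` F \<subseteq> span (a ` I)}"
  have "\<forall>I\<in>\<I>. \<exists>y. (\<forall>x\<in>span (a ` I). inner y x = 0) \<and> (\<exists>x\<in>a ` F. inner y x \<noteq> 0)"
  proof
    fix I assume "I \<in> \<I>"
    then show "\<exists>y. (\<forall>x\<in>span (a ` I). inner y x = 0) \<and> (\<exists>x\<in>a ` F. inner y x \<noteq> 0)"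
      by (intro exists_separating_normal) (auto simp: \<I>_def)
  qed
  from bchoice[OF this] obtain y where
    y: "\<And>I x. I \<in> \<I> \<Longrightarrow> x \<in> span (a ` I) \<Longrightarrow> inner (y I) x = 0"
    and y_ne: "\<And>I. I \<in> \<I> \<Longrightarrow> \<exists>x\<in>a ` F. inner (y I) x \<noteq> 0"
    by blast
  have fin\<I>: "finite \<I>" unfolding \<I>_def by (rule finite_subset[of _ "Pow F"]) (auto simp: finite_F)
  have finT: "finite {B'. lower_basis w B'}"
    by (rule finite_subset[of _ "Pow F"]) (auto simp: finite_F lower_basis_def family_basis_def)
  show ?thesis
  proof (rule chart_dissection[OF B finT, of "y ` \<I>"])
    show "finite (y ` \<I>)" using fin\<I> by simp
    show "basis B'" if "B' \<in> {B'. lower_basis w B'}" for B' using that by (simp add: lower_basis_def)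
    show "\<exists>e\<in>F. inner v (a e) \<noteq> 0" if "v \<in> y ` \<I>" for v using that y_ne by blast
  next
    fix z assume z: "\<And>v. v \<in> y ` \<I> \<Longrightarrow> inner v z \<noteq> 0"
    have gen: "generic_point z"
      unfolding generic_point_def
    proof (intro allI impI, rule ccontr)
      fix I assume "I \<subseteq> F" "z \<in> span (a ` I)" "\<not> a ` F \<subseteq> span (a ` I)"
      then have "I \<in> \<I>" by (simp add: \<I>_def)
      moreover from this have "inner (y I) z = 0" using \<open>z \<in> span (a ` I)\<close> by (rule y)
      ultimately show False using z by blast
    qed
    show "indicator (convex hull (a ` F)) z =
      (\<Sum>B'\<in>{B'. lower_basis w B'}. indicator (convex hull (a ` B')) z :: ennreal)"
    proof (cases "z \<in> convex hull (a ` F)")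
      case True
      then obtain B0 where B0: "lower_basis w B0" "z \<in> convex hull (a ` B0)"
        using lower_basis_covers[OF w _ gen] by blast
      have "(\<Sum>B'\<in>{B'. lower_basis w B'}. indicator (convex hull (a ` B')) z :: ennreal) =
        (\<Sum>B'\<in>{B'. lower_basis w B'}. if B' = B0 then 1 else 0)"
      proof (rule sum.cong[OF refl])
        fix B' assume "B' \<in> {B'. lower_basis w B'}"
        then have "z \<in> convex hull (a ` B') \<longleftrightarrow> B' = B0"
          using lower_basis_unique[OF _ _ B0 gen] B0(2) by blast
        then show "indicator (convex hull (a ` B')) z = (if B' = B0 then 1 else 0 :: ennreal)"
          by (simp add: indicator_def)
      qed
      also have "\<dots> = 1" using B0(1) finT by simp
      finally show ?thesis using True by simp
    next
      case False
      have "z \<notin> convex hull (a ` B')" if "lower_basis w B'" for B'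
      proof -
        have "a ` B' \<subseteq> a ` F"
          using that by (intro image_mono basis_subset) (simp add: lower_basis_def)
        then have "convex hull (a ` B') \<subseteq> convex hull (a ` F)" by (rule hull_mono)
        then show ?thesis using False by blast
      qed
      then have "(\<Sum>B'\<in>{B'. lower_basis w B'}. indicator (convex hull (a ` B')) z :: ennreal) = 0"
        by (intro sum.neutral) simp
      then show ?thesis using False by simp
    qed
  qed
qed

end

section \<open>Matroid bases of a matrix as bases of its columns\<close>

lemma lin_dependence_column_vec:
  "lin_dependence UNIV A C l \<longleftrightarrow>
    (\<exists>e\<in>C. l e \<noteq> 0) \<and> (\<Sum>e\<in>C. l e *\<^sub>R column_vec A e) = 0"
  by (simp add: lin_dependence_def Finite_Cartesian_Product.vec_eq_iff column_vec_def)

lemma matroid_bases_column_vec: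
  assumes fin: "finite F"
  shows "B \<in> matroid_bases F (signed_circuits UNIV F A) \<longleftrightarrow> family_basis (column_vec A) F B"
proof -
  let ?a = "column_vec A"
  have ind: "(\<forall>l. \<not> lin_dependence UNIV A B l) \<longleftrightarrow> inj_on ?a B \<and> independent (?a ` B)" if "B \<subseteq> F"
    unfolding lin_dependence_column_vec independent_family_iff[OF finite_subset[OF that fin], of ?a]
    by blast
  have span: "(\<exists>l. lin_dependence UNIV A (insert e B) l) \<longleftrightarrow> ?a e \<in> span (?a ` B)"
    if B: "B \<subseteq> F" "\<forall>l. \<not> lin_dependence UNIV A B l" and e: "e \<in> F - B" for e
  proof -
    have finB: "finite B" by (rule finite_subset[OF B(1) fin])
    have ins: "(\<Sum>g\<in>insert e B. l g *\<^sub>R ?a g) = l e *\<^sub>R ?a e + (\<Sum>g\<in>B. l g *\<^sub>R ?a g)" for l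
      using e finB by simp
    show ?thesis
    proof
      assume "\<exists>l. lin_dependence UNIV A (insert e B) l"
      then obtain l where l: "lin_dependence UNIV A (insert e B) l" by blast
      have "l e \<noteq> 0"
      proof
        assume "l e = 0"
        then have "lin_dependence UNIV A B l"
          using finB by (intro lin_dependence_drop_zeros[OF l]) auto
        then show False using B(2) by blast
      qed
      have "l e *\<^sub>R ?a e = - (\<Sum>g\<in>B. l g *\<^sub>R ?a g)"
        using l ins[of l] unfolding lin_dependence_column_vec by (simp add: eq_neg_iff_add_eq_0)
      moreover have "(\<Sum>g\<in>B. l g *\<^sub>R ?a g) \<in> span (?a ` B)"
        by (intro span_sum span_scale span_base imageI)
      ultimately have "l e *\<^sub>R ?a e \<in> span (?a ` B)" by (simp add: span_neg)
      then have "(1 / l e) *\<^sub>R (l e *\<^sub>R ?a e) \<in> span (?a ` B)" by (rule span_scale)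
      then show "?a e \<in> span (?a ` B)" using \<open>l e \<noteq> 0\<close> by simp
    next
      assume "?a e \<in> span (?a ` B)"
      then obtain c where c: "?a e = (\<Sum>g\<in>B. c g *\<^sub>R ?a g)"
        using span_image_iff[OF finB] by blast
      define l where "l = (\<lambda>g. if g = e then -1 else c g)"
      have "(\<Sum>g\<in>B. l g *\<^sub>R ?a g) = ?a e"
        unfolding c using e by (intro sum.cong) (auto simp: l_def)
      then have "(\<Sum>g\<in>insert e B. l g *\<^sub>R ?a g) = 0" unfolding ins by (simp add: l_def)
      moreover have "l e \<noteq> 0" by (simp add: l_def)
      ultimately have "lin_dependence UNIV A (insert e B) l"
        unfolding lin_dependence_column_vec by blast
      then show "\<exists>l. lin_dependence UNIV A (insert e B) l" by blast
    qed
  qed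
  have sub: "?a ` F \<subseteq> span (?a ` B) \<longleftrightarrow> (\<forall>e\<in>F - B. ?a e \<in> span (?a ` B))" if "B \<subseteq> F"
    using that by (auto intro: span_base)
  show ?thesis
    unfolding matroid_bases_iff[OF fin] family_basis_def using ind span sub by blast
qed

lemma unimodular_coordinates:
  assumes tu: "totally_unimodular UNIV E A" and F: "finite F" "F \<subseteq> E"
    and B: "family_basis (column_vec A) F B"
    and c: "column_vec A e = (\<Sum>f\<in>B. c f *\<^sub>R column_vec A f)" and e: "e \<in> F" and f: "f \<in> B"
  shows "c f \<in> {0, 1, -1}"
proof -
  let ?a = "column_vec A"
  have BF: "B \<subseteq> F" and inj: "inj_on ?a B" and ind: "independent (?a ` B)"
    using B by (auto simp: family_basis_def)
  have finB: "finite B" by (rule finite_subset[OF BF F(1)])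
  show ?thesis
  proof (cases "e \<in> B")
    case True
    have "(\<Sum>g\<in>B. of_bool (g = e) *\<^sub>R ?a g) = (\<Sum>g\<in>B. if g = e then ?a g else 0)"
      by (intro sum.cong) auto
    also have "\<dots> = ?a e" using True finB by simp
    finally have "(\<Sum>g\<in>B. c g *\<^sub>R ?a g) = (\<Sum>g\<in>B. of_bool (g = e) *\<^sub>R ?a g)" using c by simp
    from independent_family_unique[OF finB inj ind this f] show ?thesis by simp
  next
    case False
    have ins: "(\<Sum>g\<in>insert e B. l g *\<^sub>R ?a g) = l e *\<^sub>R ?a e + (\<Sum>g\<in>B. l g *\<^sub>R ?a g)" for l
      using False finB by simp
    define l0 where "l0 = (\<lambda>g. if g = e then -1 else c g)"
    have "(\<Sum>g\<in>B. l0 g *\<^sub>R ?a g) = ?a e"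
      unfolding c using False by (intro sum.cong) (auto simp: l0_def)
    then have "lin_dependence UNIV A (insert e B) l0"
      unfolding lin_dependence_column_vec ins by (auto simp: l0_def)
    moreover have "insert e B \<subseteq> E" "finite (insert e B)" using e BF F finB by auto
    ultimately obtain l where l: "lin_dependence UNIV A (insert e B) l" "\<forall>g. l g \<in> {0, 1, -1}"
      using totally_unimodular_dependence[OF tu] by blast
    have l0: "l e *\<^sub>R ?a e + (\<Sum>g\<in>B. l g *\<^sub>R ?a g) = 0"
      using l(1) unfolding lin_dependence_column_vec ins by blast
    then have "(\<Sum>g\<in>B. (l e * c g + l g) *\<^sub>R ?a g) = 0"
      unfolding c by (simp add: scaleR_left_distrib sum.distrib scaleR_sum_right)
    then have zero: "l e * c g + l g = 0" if "g \<in> B" for g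
      using spec[OF iffD1[OF independent_family_iff[OF finB] conjI[OF inj ind]], of "\<lambda>g. l e * c g + l g"]
        that by blast
    have le: "l e \<noteq> 0"
    proof
      assume "l e = 0"
      then have "\<forall>g\<in>insert e B. l g = 0" using zero by auto
      then show False using l(1) by (auto simp: lin_dependence_def)
    qed
    have "c f = - l f / l e" using zero[OF f] le by (simp add: field_simps)
    moreover have "l f \<in> {0, 1, -1}" "l e \<in> {0, 1, -1}" using l(2) by blast+
    ultimately show ?thesis using le by auto
  qed
qed

lemma independent_family_functional:
  fixes a :: "'e \<Rightarrow> 'a::euclidean_space"
  assumes "independent (a ` B)"
  shows "\<exists>h. \<forall>e\<in>B. inner h (a e) = 1"
proof -
  obtain g :: "'a \<Rightarrow> real" where g: "linear g" "\<And>x. x \<in> a ` B \<Longrightarrow> g x = 1"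
    using linear_independent_extend[OF assms, of "\<lambda>_. 1::real"] by blast
  define h where "h = (\<Sum>b\<in>Basis. g b *\<^sub>R b)"
  have "inner h x = g x" for x
  proof -
    have "g x = g (\<Sum>b\<in>Basis. inner x b *\<^sub>R b)" by (simp add: euclidean_representation)
    also have "\<dots> = (\<Sum>b\<in>Basis. inner x b * g b)"
      using g(1) by (simp add: linear_sum linear_cmul)
    also have "\<dots> = (\<Sum>b\<in>Basis. g b * inner b x)"
      by (simp add: inner_commute[of x] mult.commute)
    also have "\<dots> = inner h x" by (simp add: h_def inner_sum_left)
    finally show ?thesis by simp
  qed
  then have "\<forall>e\<in>B. inner h (a e) = 1" using g(2) by simp
  then show ?thesis by blast
qed

section \<open>Fundamental circuits of the dual are fundamental cuts\<close>

locale eulerian_dual =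
  fixes D :: "('v, 'e) pre_digraph" and A :: "'n::finite \<Rightarrow> 'e \<Rightarrow> real" and r :: 'v
  assumes eulerian_D: "eulerian D" and root: "r \<in> verts D"
    and tu: "totally_unimodular UNIV (arcs D) A"
    and dual: "is_oriented_dual (arcs D) (graphic_circuits D) (signed_circuits UNIV (arcs D) A)"
begin

sublocale fin_digraph D
  using eulerian_D by (simp add: eulerian_def)

lemma connected_D: "Digraph_Component.connected D"
  using eulerian_D by (simp add: eulerian_def)

abbreviation column :: "'e \<Rightarrow> real ^ 'n" where "column \<equiv> column_vec A"

lemma dual_basis_iff: "family_basis column (arcs D) B \<longleftrightarrow> (\<exists>T\<in>tree_arcs D. B = arcs D - T)"
  unfolding matroid_bases_column_vec[OF finite_arcs, symmetric] tree_arcs_def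
  using dual by (auto simp: is_oriented_dual_def)

lemma complement_tree_basis: "T \<in> tree_arcs D \<Longrightarrow> family_basis column (arcs D) (arcs D - T)"
  using dual_basis_iff by blast

text \<open>The fundamental cycle of \<open>f\<close> and the fundamental circuit of \<open>e\<close> in the dual can only meet in \<open>e\<close>
  and \<open>f\<close>. If they meet, orthogonality demands one agreement and one disagreement of signs, so they
  meet in both elements, agreeing in one of them only. All entries are 0, 1 or -1, so the signs
  determine them.\<close>

lemma fundamental_circuit_eq_cut:
  assumes T: "T \<in> tree_arcs D" and e: "e \<in> T"
    and c: "column e = (\<Sum>f\<in>arcs D - T. c f *\<^sub>R column f)" and f: "f \<in> arcs D - T"
  shows "c f = - cut_vector D (head_side D T e) f"
proof -
  define B where "B = arcs D - T"
  define cut where "cut = cut_vector D (head_side D T e)"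
  have TD: "T \<subseteq> arcs D" by (rule tree_arcs_subset[OF T])
  have bB: "family_basis column (arcs D) B" using complement_tree_basis[OF T] by (simp add: B_def)
  then have B: "B \<in> matroid_bases (arcs D) (signed_circuits UNIV (arcs D) A)"
    by (simp add: matroid_bases_column_vec)
  have finB: "finite B" by (simp add: B_def)
  have eB: "e \<in> arcs D - B" using e TD by (auto simp: B_def)
  obtain x where x: "x e = 1" "\<And>g. g \<notin> insert e B \<Longrightarrow> x g = 0"
    "\<And>i. i \<in> UNIV \<Longrightarrow> (\<Sum>g\<in>arcs D. x g * A i g) = 0"
    "({g. x g > 0}, {g. x g < 0}) \<in> signed_circuits UNIV (arcs D) A"
    using fundamental_circuit[OF finite_arcs B eB] by blast
  have xf: "x f = - c f"
  proof -
    have "(\<Sum>g\<in>arcs D. x g *\<^sub>R column g) = 0"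
      using x(3) by (simp add: Finite_Cartesian_Product.vec_eq_iff column_vec_def)
    moreover have "(\<Sum>g\<in>arcs D. x g *\<^sub>R column g) = (\<Sum>g\<in>insert e B. x g *\<^sub>R column g)"
    proof (rule sum.mono_neutral_right[OF finite_arcs])
      show "insert e B \<subseteq> arcs D" using eB by (auto simp: B_def)
      show "\<forall>g\<in>arcs D - insert e B. x g *\<^sub>R column g = 0" using x(2) by simp
    qed
    ultimately have "column e + (\<Sum>g\<in>B. x g *\<^sub>R column g) = 0" using eB finB x(1) by simp
    then have "(\<Sum>g\<in>B. (c g + x g) *\<^sub>R column g) = 0"
      unfolding c B_def[symmetric] by (simp add: scaleR_left_distrib sum.distrib)
    moreover have "inj_on column B" "independent (column ` B)"
      using bB by (simp_all add: family_basis_def)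
    ultimately have "c f + x f = 0"
      using spec[OF iffD1[OF independent_family_iff[OF finB] conjI], of column "\<lambda>g. c g + x g"]
        f by (simp add: B_def)
    then show ?thesis by simp
  qed
  have "c f \<in> {0, 1, -1}"
    by (rule unimodular_coordinates[OF tu finite_arcs order_refl bB c[folded B_def]])
      (use eB f in \<open>simp_all add: B_def\<close>)
  then have xf_val: "x f \<in> {0, 1, -1}" using xf by auto
  have T': "T \<in> matroid_bases (arcs D) (signed_circuits (verts D) (arcs D) (incidence D))"
    using T by (simp add: tree_arcs_def graphic_circuits_def)
  obtain z where z: "z f = 1" "\<And>g. g \<notin> insert f T \<Longrightarrow> z g = 0"
    "\<And>v. v \<in> verts D \<Longrightarrow> (\<Sum>g\<in>arcs D. z g * incidence D v g) = 0"
    "({g. z g > 0}, {g. z g < 0}) \<in> signed_circuits (verts D) (arcs D) (incidence D)"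
    using fundamental_circuit[OF finite_arcs T' f] by blast
  have ze: "z e = - cut f"
  proof -
    have "(\<Sum>g\<in>arcs D. z g * cut g) = 0"
      unfolding cut_def cut_vector_pairing[OF order_refl] using z(3) by (intro sum.neutral) auto
    moreover have "(\<Sum>g\<in>arcs D. z g * cut g) = (\<Sum>g\<in>{e, f}. z g * cut g)"
    proof (rule sum.mono_neutral_right)
      show "{e, f} \<subseteq> arcs D" using e f TD by auto
      have "z g * cut g = 0" if "g \<in> arcs D - {e, f}" for g
      proof (cases "g \<in> T")
        case True
        then show ?thesis using cut_vector_head_side[OF T e True] that by (simp add: cut_def)
      next
        case False
        then show ?thesis using z(2)[of g] that by simp
      qed
      then show "\<forall>g\<in>arcs D - {e, f}. z g * cut g = 0" by blast
    qed simp
    moreover have "e \<noteq> f" using e f by blast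
    ultimately show ?thesis
      using cut_vector_head_side[OF T e e] z(1) by (simp add: cut_def)
  qed
  have cut_val: "cut f \<in> {0, 1, -1}" by (auto simp: cut_def cut_vector_def)
  have "orthogonal_signed ({g. z g > 0}, {g. z g < 0}) ({g. x g > 0}, {g. x g < 0})"
    using dual z(4) x(4) unfolding is_oriented_dual_def graphic_circuits_def by blast
  then have disj: "({g. z g > 0} \<union> {g. z g < 0}) \<inter> ({g. x g > 0} \<union> {g. x g < 0}) = {} \<or>
    {g. z g > 0} \<inter> {g. x g > 0} \<union> {g. z g < 0} \<inter> {g. x g < 0} \<noteq> {} \<and>
    {g. z g > 0} \<inter> {g. x g < 0} \<union> {g. z g < 0} \<inter> {g. x g > 0} \<noteq> {}"
    by (simp add: orthogonal_signed_def)
  have orth: "(\<exists>g. z g * x g > 0) \<and> (\<exists>g. z g * x g < 0)" if g: "z g \<noteq> 0" "x g \<noteq> 0" for g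
  proof -
    have "g \<in> ({g. z g > 0} \<union> {g. z g < 0}) \<inter> ({g. x g > 0} \<union> {g. x g < 0})"
      using g by auto
    with disj obtain p q where "p \<in> {g. z g > 0} \<inter> {g. x g > 0} \<union> {g. z g < 0} \<inter> {g. x g < 0}"
      "q \<in> {g. z g > 0} \<inter> {g. x g < 0} \<union> {g. z g < 0} \<inter> {g. x g > 0}"
      by blast
    then have "z p * x p > 0" "z q * x q < 0" by (auto simp: zero_less_mult_iff mult_less_0_iff)
    then show ?thesis by blast
  qed
  have supp: "g = e \<or> g = f" if "z g * x g > 0 \<or> z g * x g < 0" for g
    using that z(2)[of g] x(2)[of g] by (cases "z g = 0 \<or> x g = 0") (auto simp: B_def)
  have "x f = cut f"
  proof (cases "x f = 0")
    case True
    have "z e = 0"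
    proof (rule ccontr)
      assume "z e \<noteq> 0"
      then obtain p q where pq: "z p * x p > 0" "z q * x q < 0" using orth[of e] x(1) by auto
      have "p \<noteq> f" "q \<noteq> f" using pq True by auto
      then have "p = e" "q = e" using supp[of p] supp[of q] pq by blast+
      then show False using pq by simp
    qed
    then show ?thesis using True ze by simp
  next
    case False
    then obtain p q where pq: "z p * x p > 0" "z q * x q < 0" using orth[of f] z(1) by auto
    have "p = e \<or> p = f" "q = e \<or> q = f" using supp[of p] supp[of q] pq by blast+
    moreover have "p \<noteq> q" using pq by auto
    ultimately have "p = e \<and> q = f \<or> p = f \<and> q = e" by blast
    then have "z e > 0 \<and> x f < 0 \<or> x f > 0 \<and> z e < 0" using pq z(1) x(1) by auto
    then show ?thesis using xf_val cut_val ze by auto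
  qed
  then show ?thesis using xf by (simp add: cut_def)
qed

lemma sum_over_cut:
  assumes T: "T \<in> tree_arcs D" and e: "e \<in> T"
  shows "(\<Sum>g\<in>arcs D. cut_vector D (head_side D T e) g * w g) =
    w e + (\<Sum>f\<in>arcs D - T. cut_vector D (head_side D T e) f * w f)"
proof -
  note TD = tree_arcs_subset[OF T]
  have finT: "finite T" by (rule finite_subset[OF TD finite_arcs])
  have "(\<Sum>g\<in>arcs D. cut_vector D (head_side D T e) g * w g) =
    (\<Sum>g\<in>arcs D - T. cut_vector D (head_side D T e) g * w g) +
    (\<Sum>g\<in>T. cut_vector D (head_side D T e) g * w g)"
    by (rule sum.subset_diff[OF TD finite_arcs])
  also have "(\<Sum>g\<in>T. cut_vector D (head_side D T e) g * w g) = (\<Sum>g\<in>T. if g = e then w e else 0)"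
    using cut_vector_head_side[OF T e] by (intro sum.cong) auto
  also have "\<dots> = w e" using e finT by simp
  finally show ?thesis by simp
qed

text \<open>The Eulerian condition makes the all-one vector a circulation, and circulations have no net flow
  through a fundamental cut. So a functional that is 1 on one basis is 1 on every column.\<close>

lemma columns_at_height_one: "\<exists>h. \<forall>e\<in>arcs D. inner h (column e) = 1"
proof -
  obtain B where B: "family_basis column (arcs D) B" using family_basis_exists by blast
  then obtain T where T: "T \<in> tree_arcs D" "B = arcs D - T" using dual_basis_iff by blast
  obtain h where h: "\<forall>f\<in>B. inner h (column f) = 1"
    using independent_family_functional[of column B] B unfolding family_basis_def by blast
  have circ: "(\<Sum>g\<in>arcs D. incidence D v g) = 0" if "v \<in> verts D" for v
  proof -
    have "in_arcs D v = arcs D \<inter> {g. head D g = v}" "out_arcs D v = arcs D \<inter> {g. tail D g = v}"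
      by (auto simp: in_arcs_def out_arcs_def)
    then have "(\<Sum>g\<in>arcs D. incidence D v g) = real (in_degree D v) - real (out_degree D v)"
      by (simp add: incidence_def sum_subtractf in_degree_def out_degree_def)
    then show ?thesis using eulerian_D that by (simp add: eulerian_def)
  qed
  have "inner h (column e) = 1" if e: "e \<in> arcs D" for e
  proof (cases "e \<in> T")
    case False
    then show ?thesis using h e T(2) by simp
  next
    case True
    obtain c where c: "column e = (\<Sum>f\<in>B. c f *\<^sub>R column f)"
      by (rule family_basis_coords[OF B finite_arcs e])
    have "inner h (column e) = (\<Sum>f\<in>B. c f * inner h (column f))"
      unfolding c by (simp add: inner_sum_right)
    also have "\<dots> = (\<Sum>f\<in>B. - cut_vector D (head_side D T e) f)"
    proof (rule sum.cong[OF refl])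
      fix f assume "f \<in> B"
      then show "c f * inner h (column f) = - cut_vector D (head_side D T e) f"
        using h fundamental_circuit_eq_cut[OF T(1) True c[unfolded T(2)], of f] T(2) by simp
    qed
    also have "\<dots> = 1 - (\<Sum>g\<in>arcs D. cut_vector D (head_side D T e) g * 1)"
      unfolding sum_over_cut[OF T(1) True] T(2) by (simp add: sum_negf)
    also have "(\<Sum>g\<in>arcs D. cut_vector D (head_side D T e) g * 1) = 0"
      using cut_vector_pairing[OF order_refl, of "\<lambda>_. 1" "head_side D T e"] circ by simp
    finally show ?thesis by simp
  qed
  then show ?thesis by blast
qed

text \<open>One unit of flow from the root to every vertex. On a tree, such a flow is positive exactly on
  the arcs that point away from the root.\<close>

lemma root_flow_exists:
  "\<exists>w. \<forall>x. (\<Sum>e\<in>arcs D. w e * incidence D x e) =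
    of_bool (x \<in> verts D) - real (card (verts D)) * of_bool (x = r)"
proof -
  have "\<forall>v\<in>verts D. \<exists>l. \<forall>x. (\<Sum>e\<in>arcs D. l e * incidence D x e) = of_bool (x = v) - of_bool (x = r)"
  proof
    fix v assume "v \<in> verts D"
    then have "linked D (arcs D) r v"
      using connected_D root unfolding connected_iff_linked[OF wf_digraph] by blast
    then show "\<exists>l. \<forall>x. (\<Sum>e\<in>arcs D. l e * incidence D x e) = of_bool (x = v) - of_bool (x = r)"
      by (rule linked_unit_flow[OF _ finite_arcs])
  qed
  from bchoice[OF this] obtain l where l: "\<And>v x. v \<in> verts D \<Longrightarrow>
      (\<Sum>e\<in>arcs D. l v e * incidence D x e) = of_bool (x = v) - of_bool (x = r)"
    by blast
  have "(\<Sum>e\<in>arcs D. (\<Sum>v\<in>verts D. l v e) * incidence D x e) =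
    of_bool (x \<in> verts D) - real (card (verts D)) * of_bool (x = r)" for x
  proof -
    have "(\<Sum>e\<in>arcs D. (\<Sum>v\<in>verts D. l v e) * incidence D x e) =
      (\<Sum>v\<in>verts D. \<Sum>e\<in>arcs D. l v e * incidence D x e)"
      unfolding sum_distrib_right by (rule sum.swap)
    also have "\<dots> = (\<Sum>v\<in>verts D. of_bool (x = v)) - (\<Sum>v\<in>verts D. of_bool (x = r))"
      using l by (simp add: sum_subtractf)
    also have "(\<Sum>v\<in>verts D. of_bool (x = v)) = (of_bool (x \<in> verts D) :: real)"
      by (simp add: of_bool_def)
    finally show ?thesis by simp
  qed
  then show ?thesis by (intro exI[of _ "\<lambda>e. \<Sum>v\<in>verts D. l v e"]) blast
qed

definition root_flow :: "'e \<Rightarrow> real" where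
  "root_flow = (SOME w. \<forall>x. (\<Sum>e\<in>arcs D. w e * incidence D x e) =
    of_bool (x \<in> verts D) - real (card (verts D)) * of_bool (x = r))"

text \<open>The coordinates of column \<open>e\<close> are minus the fundamental cut of \<open>e\<close>, so its reduced cost is the net
  amount of flow into the head side. This is the number of vertices there if the root is on the other
  side, and minus the number of vertices on the tail side otherwise.\<close>

lemma reduced_cost_root_flow:
  assumes T: "T \<in> tree_arcs D" and e: "e \<in> T"
    and c: "column e = (\<Sum>f\<in>arcs D - T. c f *\<^sub>R column f)"
  shows "(\<Sum>f\<in>arcs D - T. c f * root_flow f) < root_flow e \<longleftrightarrow> e \<in> away_arcs D r T"
    and "(\<Sum>f\<in>arcs D - T. c f * root_flow f) \<noteq> root_flow e"
proof -
  define X where "X = head_side D T e"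
  have eD: "e \<in> arcs D" using tree_arcs_subset[OF T] e by blast
  have flow: "(\<Sum>e\<in>arcs D. root_flow e * incidence D x e) =
    of_bool (x \<in> verts D) - real (card (verts D)) * of_bool (x = r)" for x
    using someI_ex[OF root_flow_exists] unfolding root_flow_def by blast
  have "root_flow e - (\<Sum>f\<in>arcs D - T. c f * root_flow f) =
    root_flow e + (\<Sum>f\<in>arcs D - T. cut_vector D X f * root_flow f)"
  proof -
    have "(\<Sum>f\<in>arcs D - T. c f * root_flow f) = (\<Sum>f\<in>arcs D - T. - (cut_vector D X f * root_flow f))"
    proof (rule sum.cong[OF refl])
      fix f assume "f \<in> arcs D - T"
      from fundamental_circuit_eq_cut[OF T e c this]
      show "c f * root_flow f = - (cut_vector D X f * root_flow f)" by (simp add: X_def)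
    qed
    then show ?thesis by (simp add: sum_negf)
  qed
  also have "\<dots> = (\<Sum>g\<in>arcs D. root_flow g * cut_vector D X g)"
    using sum_over_cut[OF T e, of root_flow] by (simp add: X_def mult.commute)
  also have "\<dots> = (\<Sum>v\<in>verts D \<inter> X. 1 - real (card (verts D)) * of_bool (v = r))"
    unfolding cut_vector_pairing[OF order_refl] flow by (intro sum.cong) auto
  also have "\<dots> = real (card (verts D \<inter> X)) - real (card (verts D)) * of_bool (r \<in> X)"
  proof -
    have "(\<Sum>v\<in>verts D \<inter> X. real (card (verts D)) * of_bool (v = r)) =
      (\<Sum>v\<in>verts D \<inter> X. if v = r then real (card (verts D)) else 0)"
      by (intro sum.cong) auto
    also have "\<dots> = real (card (verts D)) * of_bool (r \<in> X)" using root by simp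
    finally show ?thesis by (simp add: sum_subtractf)
  qed
  finally have cost: "root_flow e - (\<Sum>f\<in>arcs D - T. c f * root_flow f) =
    real (card (verts D \<inter> X)) - real (card (verts D)) * of_bool (r \<in> X)" .
  have "head D e \<in> verts D \<inter> X" using eD by (simp add: X_def head_side_def)
  then have pos: "card (verts D \<inter> X) > 0" by (auto simp: card_gt_0_iff)
  have "tail D e \<notin> X"
    unfolding X_def by (rule tail_notin_head_side[OF tree_arcs_subset[OF T] tree_arcs_independent[OF T] e])
  then have "verts D \<inter> X \<subset> verts D" using tail_in_verts[OF eD] by blast
  then have less: "card (verts D \<inter> X) < card (verts D)" by (intro psubset_card_mono) auto
  have away: "e \<in> away_arcs D r T \<longleftrightarrow> r \<notin> X" using e by (simp add: away_arcs_def X_def)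
  show "(\<Sum>f\<in>arcs D - T. c f * root_flow f) < root_flow e \<longleftrightarrow> e \<in> away_arcs D r T"
    "(\<Sum>f\<in>arcs D - T. c f * root_flow f) \<noteq> root_flow e"
    using cost pos less away by (cases "r \<in> X"; simp)+
qed

end

section \<open>The volume of a root polytope counts spanning trees\<close>

context eulerian_dual
begin

lemma property_star_basis_iff:
  assumes F: "property_star A (arcs D) F"
  shows "family_basis column F B \<longleftrightarrow> family_basis column (arcs D) B \<and> B \<subseteq> F"
proof -
  have sub: "F \<subseteq> arcs D" and dim: "dim (column ` F) = dim (column ` arcs D)"
    using F by (simp_all add: property_star_def column_rank_def)
  have "span (column ` F) = span (column ` arcs D)"
    using dim sub by (intro subspace_dim_equal span_mono) (auto simp: dim_span)
  then have "column ` F \<subseteq> span (column ` B) \<longleftrightarrow> column ` arcs D \<subseteq> span (column ` B)"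
    using span_superset[of "column ` F"] span_superset[of "column ` arcs D"]
      span_minimal[OF _ subspace_span, of _ "column ` B"] by blast
  then show ?thesis using sub unfolding family_basis_def by blast
qed

lemma property_star_if_contains_basis:
  assumes B: "family_basis column (arcs D) B" and F: "B \<subseteq> F" "F \<subseteq> arcs D"
  shows "property_star A (arcs D) F"
proof -
  have "family_basis column F B"
    using B F image_mono[OF F(2), of column] unfolding family_basis_def by blast
  then have "dim (column ` F) = dim (column ` arcs D)"
    using family_basis_card B by metis
  then show ?thesis using F by (simp add: property_star_def column_rank_def)
qed

text \<open>The spanning trees whose complements span the simplices that dissect the root polytope of \<open>F\<close>.\<close>

definition compatible_trees :: "'e set \<Rightarrow> 'e set set" where
  "compatible_trees F = {T\<in>tree_arcs D. arcs D - T \<subseteq> F \<and> F \<inter> T \<subseteq> away_arcs D r T}"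

text \<open>For the root flow as cost, the lower bases are the complements of the compatible trees, and the
  simplex of each basis has normalized volume 1. If the empty set is a basis, all columns vanish;
  as they lie at height one, there are none, and the empty tree is the only one.\<close>

lemma Vol_eq_card_compatible_trees:
  assumes F: "property_star A (arcs D) F"
  shows "Vol A F = real (card (compatible_trees F))"
proof -
  have FD: "F \<subseteq> arcs D" using F by (simp add: property_star_def)
  have finF: "finite F" by (rule finite_subset[OF FD finite_arcs])
  obtain h where h: "\<forall>e\<in>arcs D. inner h (column e) = 1" using columns_at_height_one by blast
  interpret U: unimodular_family column F h
  proof
    show "c f \<in> {0, 1, - 1}"
      if "family_basis column F B" "column e = (\<Sum>f\<in>B. c f *\<^sub>R column f)" "e \<in> F" "f \<in> B" for B e c f
      by (rule unimodular_coordinates[OF tu finF FD that])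
  qed (use finF FD h in auto)
  have basis_iff: "U.basis B \<longleftrightarrow> (\<exists>T\<in>tree_arcs D. B = arcs D - T \<and> arcs D - T \<subseteq> F)" for B
    unfolding property_star_basis_iff[OF F] dual_basis_iff by blast
  have generic: "U.generic_cost root_flow"
    unfolding U.generic_cost_def
  proof (intro allI impI)
    fix B e c
    assume B: "U.basis B" and e: "e \<in> F - B" and c: "column e = (\<Sum>f\<in>B. c f *\<^sub>R column f)"
    obtain T where T: "T \<in> tree_arcs D" "B = arcs D - T" using B basis_iff by blast
    have "e \<in> T" using e FD T(2) by blast
    from reduced_cost_root_flow(2)[OF T(1) this c[unfolded T(2)]]
    show "(\<Sum>f\<in>B. c f * root_flow f) \<noteq> root_flow e" by (simp add: T(2))
  qed
  have lower: "U.lower_basis root_flow (arcs D - T) \<longleftrightarrow> T \<in> compatible_trees F"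
    if T: "T \<in> tree_arcs D" for T
  proof -
    have TD: "T \<subseteq> arcs D" by (rule tree_arcs_subset[OF T])
    have "(\<forall>c. column e = (\<Sum>f\<in>arcs D - T. c f *\<^sub>R column f) \<longrightarrow>
        (\<Sum>f\<in>arcs D - T. c f * root_flow f) < root_flow e) \<longleftrightarrow> e \<in> away_arcs D r T"
      if e: "e \<in> T" for e
    proof -
      have "e \<in> arcs D" using e TD by blast
      then obtain c where c: "column e = (\<Sum>f\<in>arcs D - T. c f *\<^sub>R column f)"
        by (rule family_basis_coords[OF complement_tree_basis[OF T] finite_arcs])
      show ?thesis using reduced_cost_root_flow(1)[OF T e] c by blast
    qed
    moreover have "F - (arcs D - T) = F \<inter> T" using FD by blast
    moreover have "U.basis (arcs D - T) \<longleftrightarrow> arcs D - T \<subseteq> F"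
      unfolding property_star_basis_iff[OF F] using complement_tree_basis[OF T] by blast
    ultimately show ?thesis
      unfolding U.lower_basis_def compatible_trees_def using T by blast
  qed
  have card_lower: "card {B. U.lower_basis root_flow B} = card (compatible_trees F)"
  proof -
    have "{B. U.lower_basis root_flow B} = (\<lambda>T. arcs D - T) ` compatible_trees F"
    proof (intro equalityI subsetI)
      fix B assume "B \<in> {B. U.lower_basis root_flow B}"
      then have B: "U.lower_basis root_flow B" by simp
      then have "U.basis B" by (simp add: U.lower_basis_def)
      then obtain T where T: "T \<in> tree_arcs D" "B = arcs D - T" using basis_iff by blast
      then show "B \<in> (\<lambda>T. arcs D - T) ` compatible_trees F" using B lower[OF T(1)] by blast
    next
      fix B assume "B \<in> (\<lambda>T. arcs D - T) ` compatible_trees F"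
      then obtain T where T: "T \<in> compatible_trees F" "B = arcs D - T" by blast
      then have "T \<in> tree_arcs D" by (simp add: compatible_trees_def)
      with T lower show "B \<in> {B. U.lower_basis root_flow B}" by simp
    qed
    moreover have "inj_on (\<lambda>T. arcs D - T) (compatible_trees F)"
    proof (rule inj_onI)
      fix S T assume "S \<in> compatible_trees F" "T \<in> compatible_trees F" "arcs D - S = arcs D - T"
      moreover from this have "S \<subseteq> arcs D" "T \<subseteq> arcs D"
        using tree_arcs_subset unfolding compatible_trees_def by blast+
      ultimately show "S = T" by blast
    qed
    ultimately show ?thesis by (simp add: card_image)
  qed
  have bases: "matroid_bases F (signed_circuits UNIV F A) = {B. U.basis B}"
    using matroid_bases_column_vec[OF finF] by blast
  show ?thesis
  proof (cases "U.basis {}")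
    case True
    have "arcs D = {}"
    proof (rule ccontr)
      assume "arcs D \<noteq> {}"
      then obtain e where e: "e \<in> arcs D" by blast
      have "family_basis column (arcs D) {}" using True property_star_basis_iff[OF F] by blast
      then have "column e = 0" using e by (auto simp: family_basis_def)
      moreover have "inner h (column e) = 1" using h e by blast
      ultimately show False by simp
    qed
    moreover have trees: "T = {}" if "T \<in> tree_arcs D" for T
      using tree_arcs_subset[OF that] \<open>arcs D = {}\<close> by simp
    moreover obtain T where "T \<in> tree_arcs D" using True basis_iff by blast
    ultimately have "compatible_trees F = {{}}"
      using FD by (auto simp: compatible_trees_def)
    then show ?thesis using True by (simp add: Vol_def normalized_volume_def bases)
  next
    case False
    define N where "N = real (card (compatible_trees F))"
    define k :: real where "k = 1 / fact (dim (column ` F) - 1)"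
    have Q: "root_polytope A F \<in> sets borel"
      unfolding root_polytope_def
      by (intro borel_compact finite_imp_compact_convex_hull) (use finF in auto)
    have vol_Q: "chart_volume column B b (root_polytope A F) = N * k" if "U.basis B" "b \<in> B" for B b
    proof -
      have "chart_volume column B b (root_polytope A F) =
        enn2real (of_nat (card (compatible_trees F)) * ennreal k)"
        unfolding chart_volume_eq_chart_integral[OF U.finite_basis[OF that(1)] Q]
        using U.chart_root_polytope[OF generic that] by (simp add: root_polytope_def card_lower k_def)
      also have "\<dots> = N * k" by (simp add: enn2real_mult N_def k_def)
      finally show ?thesis .
    qed
    have vol_simplex: "chart_volume column B b (convex hull (column ` B)) = k"
      if "U.basis B" "b \<in> B" for B b
    proof -
      have "convex hull (column ` B) \<in> sets borel"
        using U.finite_basis[OF that(1)]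
        by (intro borel_compact finite_imp_compact_convex_hull) auto
      from chart_volume_eq_chart_integral[OF U.finite_basis[OF that(1)] this]
      show ?thesis using U.chart_simplex[OF that that(1)] by (simp add: k_def)
    qed
    obtain B where B: "U.basis B" using family_basis_exists by blast
    then obtain b where b: "b \<in> B" using False by (cases "B = {}") auto
    have k: "k \<noteq> 0" by (simp add: k_def)
    have "(THE v. \<forall>B\<in>{B. U.basis B}. \<forall>b\<in>B. chart_volume column B b (root_polytope A F) =
        v * chart_volume column B b (convex hull (column ` B))) = N"
    proof (rule the_equality)
      show "\<forall>B\<in>{B. U.basis B}. \<forall>b\<in>B. chart_volume column B b (root_polytope A F) =
        N * chart_volume column B b (convex hull (column ` B))"
        using vol_Q vol_simplex by simp
      fix v assume "\<forall>B\<in>{B. U.basis B}. \<forall>b\<in>B. chart_volume column B b (root_polytope A F) =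
        v * chart_volume column B b (convex hull (column ` B))"
      then have "N * k = v * k" using B b vol_Q[OF B b] vol_simplex[OF B b] by auto
      then show "v = N" using k by simp
    qed
    then show ?thesis using False by (simp add: Vol_def normalized_volume_def bases N_def)
  qed
qed

section \<open>Expansion in powers of \<open>t - 1\<close>\<close>

lemma sum_power_card_Pow:
  fixes q :: "'c::comm_semiring_1"
  assumes "finite S"
  shows "(\<Sum>X\<in>Pow S. q ^ card X) = (q + 1) ^ card S"
proof -
  have "(\<Prod>x\<in>S. q + 1) = (\<Sum>X\<in>Pow S. (\<Prod>x\<in>X. q) * (\<Prod>x\<in>S - X. 1))"
    by (rule prod_add[OF assms])
  then show ?thesis by simp
qed

text \<open>The sets \<open>F\<close> for which \<open>T\<close> is compatible are the complement of \<open>T\<close> together with any set of arcs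
  of \<open>T\<close> that point away from the root.\<close>

lemma sum_over_supersets_of_basis:
  assumes T: "T \<in> tree_arcs D" and m: "m = card (arcs D - T)"
  shows "(\<Sum>F | property_star A (arcs D) F \<and> T \<in> compatible_trees F. [:-1, 1::real:] ^ (card F - m)) =
    monom 1 (card (away_arcs D r T))"
proof -
  define B where "B = arcs D - T"
  note TD = tree_arcs_subset[OF T]
  have away: "away_arcs D r T \<subseteq> T" by (auto simp: away_arcs_def)
  have finB: "finite B" and finT: "finite T"
    by (simp add: B_def) (rule finite_subset[OF TD finite_arcs])
  have "{F. property_star A (arcs D) F \<and> T \<in> compatible_trees F} = (\<lambda>S. B \<union> S) ` Pow (away_arcs D r T)"
  proof (intro equalityI subsetI)
    fix F assume "F \<in> {F. property_star A (arcs D) F \<and> T \<in> compatible_trees F}"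
    then have "F \<subseteq> arcs D" "B \<subseteq> F" "F \<inter> T \<subseteq> away_arcs D r T"
      by (auto simp: property_star_def compatible_trees_def B_def)
    moreover from this have "F = B \<union> (F \<inter> T)" by (auto simp: B_def)
    ultimately show "F \<in> (\<lambda>S. B \<union> S) ` Pow (away_arcs D r T)" by blast
  next
    fix F assume "F \<in> (\<lambda>S. B \<union> S) ` Pow (away_arcs D r T)"
    then obtain S where S: "S \<subseteq> away_arcs D r T" "F = B \<union> S" by blast
    have "property_star A (arcs D) F"
    proof (rule property_star_if_contains_basis[OF complement_tree_basis[OF T]])
      show "arcs D - T \<subseteq> F" "F \<subseteq> arcs D" using S away TD by (auto simp: B_def)
    qed
    moreover have "T \<in> compatible_trees F" using S T by (auto simp: compatible_trees_def B_def)
    ultimately show "F \<in> {F. property_star A (arcs D) F \<and> T \<in> compatible_trees F}" by blast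
  qed
  moreover have "inj_on (\<lambda>S. B \<union> S) (Pow (away_arcs D r T))"
  proof (rule inj_onI)
    fix S S' assume "S \<in> Pow (away_arcs D r T)" "S' \<in> Pow (away_arcs D r T)" "B \<union> S = B \<union> S'"
    then show "S = S'" using away by (auto simp: B_def)
  qed
  ultimately have "(\<Sum>F | property_star A (arcs D) F \<and> T \<in> compatible_trees F. [:-1, 1::real:] ^ (card F - m)) =
    (\<Sum>S\<in>Pow (away_arcs D r T). [:-1, 1::real:] ^ (card (B \<union> S) - m))"
    by (simp add: sum.reindex)
  also have "\<dots> = (\<Sum>S\<in>Pow (away_arcs D r T). [:-1, 1::real:] ^ card S)"
  proof (rule sum.cong[OF refl])
    fix S assume "S \<in> Pow (away_arcs D r T)"
    then have "S \<subseteq> T" using away by blast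
    moreover from this have "finite S" by (rule finite_subset[OF _ finT])
    ultimately have "card (B \<union> S) = card B + card S"
      using finB by (intro card_Un_disjoint) (auto simp: B_def)
    then show "[:-1, 1::real:] ^ (card (B \<union> S) - m) = [:-1, 1::real:] ^ card S"
      by (simp add: m B_def)
  qed
  also have "\<dots> = ([:-1, 1::real:] + 1) ^ card (away_arcs D r T)"
    by (rule sum_power_card_Pow) (use finite_subset[OF away finT] in simp)
  also have "[:-1, 1::real:] + 1 = [:0, 1:]" by (simp add: one_pCons)
  also have "[:0, 1::real:] ^ card (away_arcs D r T) = monom 1 (card (away_arcs D r T))"
    by (simp add: monom_altdef)
  finally show ?thesis .
qed

lemma tree_poly_eq_volume_sum:
  assumes B: "B \<in> matroid_bases (arcs D) (signed_circuits UNIV (arcs D) A)" and m: "m = card B"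
  shows "tree_poly D r =
    (\<Sum>F | property_star A (arcs D) F. Polynomial.smult (Vol A F) ([:-1, 1:] ^ (card F - m)))"
proof -
  let ?star = "{F. property_star A (arcs D) F}"
  define p where "p = (\<lambda>F :: 'e set. [:-1, 1::real:] ^ (card F - m))"
  have "?star \<subseteq> Pow (arcs D)" by (auto simp: property_star_def)
  then have fin_star: "finite ?star" by (rule finite_subset) simp
  have "tree_arcs D \<subseteq> Pow (arcs D)" using tree_arcs_subset by blast
  then have fin_trees: "finite (tree_arcs D)" by (rule finite_subset) simp
  have card_co: "m = card (arcs D - T)" if "T \<in> tree_arcs D" for T
    using family_basis_card[OF complement_tree_basis[OF that]]
      family_basis_card[of column "arcs D" B] B m by (simp add: matroid_bases_column_vec)
  have "Polynomial.smult (Vol A F) (p F) = (\<Sum>T\<in>tree_arcs D. if T \<in> compatible_trees F then p F else 0)"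
    if "property_star A (arcs D) F" for F
  proof -
    have "(\<Sum>T\<in>tree_arcs D. if T \<in> compatible_trees F then p F else 0) =
      (\<Sum>T\<in>compatible_trees F. p F)"
      using fin_trees by (intro sum.mono_neutral_cong_right) (auto simp: compatible_trees_def)
    also have "\<dots> = Polynomial.smult (real (card (compatible_trees F))) (p F)"
      by (simp add: of_nat_poly)
    finally show ?thesis using Vol_eq_card_compatible_trees[OF that] by simp
  qed
  then have "(\<Sum>F\<in>?star. Polynomial.smult (Vol A F) (p F)) =
    (\<Sum>F\<in>?star. \<Sum>T\<in>tree_arcs D. if T \<in> compatible_trees F then p F else 0)"
    by (intro sum.cong) auto
  also have "\<dots> = (\<Sum>T\<in>tree_arcs D. \<Sum>F\<in>?star. if T \<in> compatible_trees F then p F else 0)"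
    by (rule sum.swap)
  also have "\<dots> = (\<Sum>T\<in>tree_arcs D. monom 1 (card (away_arcs D r T)))"
  proof (rule sum.cong[OF refl])
    fix T assume T: "T \<in> tree_arcs D"
    have "(\<Sum>F\<in>?star. if T \<in> compatible_trees F then p F else 0) =
      (\<Sum>F | property_star A (arcs D) F \<and> T \<in> compatible_trees F. p F)"
      using fin_star by (intro sum.mono_neutral_cong_right) auto
    then show "(\<Sum>F\<in>?star. if T \<in> compatible_trees F then p F else 0) =
      monom 1 (card (away_arcs D r T))"
      using sum_over_supersets_of_basis[OF T card_co[OF T]] by (simp add: p_def)
  qed
  also have "\<dots> = tree_poly D r"
    by (rule tree_poly_eq_sum_away_arcs[OF connected_D root, symmetric])
  finally show ?thesis by (simp add: p_def)
qed

end

theorem theorem1p7: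
  fixes D :: "('v, 'e) pre_digraph"
    and A :: "'n::finite \<Rightarrow> 'e \<Rightarrow> real"
    and r :: 'v and B :: "'e set" and m :: nat
  assumes "eulerian D"
    and "r \<in> verts D"
    and "totally_unimodular UNIV (arcs D) A"
    and "is_oriented_dual (arcs D) (graphic_circuits D) (signed_circuits UNIV (arcs D) A)"
    and "B \<in> matroid_bases (arcs D) (signed_circuits UNIV (arcs D) A)"
    and "m = card B"
  shows "tree_poly D r =
    (\<Sum>F | property_star A (arcs D) F. Polynomial.smult (Vol A F) ([:-1, 1:] ^ (card F - m)))"
proof -
  interpret eulerian_dual D A r
    by unfold_locales (fact assms)+
  show ?thesis by (rule tree_poly_eq_volume_sum[OF assms(5,6)])
qed

end
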